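(* Let $A=kQ/I$ be a monomial algebra, let $n,m\ge1$, and let $f\in\mathrm{HH}^{2n}(A)$ and $g\in\mathrm{HH}^{2m}(A)$ be represented by cocycles $f:A\otimes kAP_{2n}\otimes A\to A$ and $g:A\otimes kAP_{2m}\otimes A\to A$ on Bardzell's resolution. Then for every $w\in AP_{2n+2m}$, written as $w=w(p_1,\dots,p_{2n+2m-1})=w^{op}(q^1,\dots,q^{2n+2m-1})$, $$(f\cup g)(1\otimes w\otimes1)=f(1\otimes w(p_1,\dots,p_{2n-1})\otimes1)\;a\;g(1\otimes w^{op}(q^{2n+1},\dots,q^{2n+2m-1})\otimes1),$$ where $a$ is the path with $w=w(p_1,\dots,p_{2n-1})\,a\,w^{op}(q^{2n+1},\dots,q^{2n+2m-1})$.
   Context: **Setting.** $k$ is a field, $Q$ a finite quiver with vertices $Q_0$, arrows $Q_1$, source and target maps $s,t$. Paths are written left to right: $\alpha_1\cdots\alpha_l$ with $t(\alpha_i)=s(\alpha_{i+1})$; $|w|$ is the length of $w$; $e_x$ is the trivial path at $x$. $I\subset kQ$ is a two-sided ideal generated by paths such that $J^r\subseteq I\subseteq J^2$ for some $r\ge 2$, where $J$ is the ideal generated by the arrows; $A=kQ/I$. $\mathcal R$ is the minimal set of paths (of minimal length) generating $I$, i.e. the paths in $I$ no proper subpath of which lies in $I$. $\mathcal P$ is the set of paths not in $I$; its classes form a $k$-basis of $A$. $E=kQ_0$, and all $\otimes$ are over $E$. **Positions.** Subpaths of a path $T$ are regarded as occurrences in $T$; $s(p),t(p)$ denote starting and ending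 positions on $T$, compared in the order along $T$. If $p$ is a subpath of $T$ we write $T=L(p)\,p\,R(p)$. $\mathcal R(T)$ is the set of (occurrences of) paths of $\mathcal R$ in $T$. **The sets $AP_n$.** $AP_0=Q_0$, $AP_1=Q_1$. For $n\ge2$, $AP_n$ is the set of supports $w(p_1,\dots,p_{n-1})$ of $n$-concatenations $(p_1,\dots,p_{n-1})$: for a path $T$, $p_1\in\mathcal R(T)$; $p_2\in L_1=\{p\in\mathcal R(T): s(p_1)<s(p)<t(p_1)\}$ with $s(p_2)$ minimal in $L_1$; and for $j\ge2$, $p_{j+1}\in L_{j+1}=\{p\in\mathcal R(T): t(p_{j-1})\le s(p)<t(p_j)\}$ with $s(p_{j+1})$ minimal in $L_{j+1}$. The support is the path along $T$ from $s(p_1)$ to $t(p_{n-1})$. Dually, $AP_n^{op}$ is the set of supports of $n$-op-concatenations $(q_{n-1},\dots,q_1)$: $q_1\in\mathcal R(T)$; $q_2\in\{q\in\mathcal R(T): s(q_1)<t(q)<t(q_1)\}$ with $t(q_2)$ maximal; for $j\ge2$, $q_{j+1}\in\{q\in\mathcal R(T): s(q_j)<t(q)\le s(q_{j-1})\}$ with $t(q_{j+1})$ maximal. The support is the path along $T$ from $s(q_{n-1})$ to $t(q_1)$, and with $q^i=q_{n-i}$ it is written $w^{op}(q^1,\dots,q^{n-1})$. It is known that $AP_n=AP_n^{op}$. For $w\in AP_n$, $\mathrm{Sub}(w)$ is the set of (occurrences of) elements of $AP_{n-1}$ that are subpaths of $w$; for odd $n\ge3$ it is known that $\mathrm{Sub}(w)=\{\psi_1,\psi_2\}$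 with $w=\psi_1R(\psi_1)=L(\psi_2)\psi_2$. **Bardzell's resolution.** $\mathbb{A}\mathrm{p}A=(A\otimes kAP_n\otimes A,d_n)$ with bimodule maps $d_1(1\otimes\alpha\otimes1)=\alpha\otimes e_{t(\alpha)}\otimes1-1\otimes e_{s(\alpha)}\otimes\alpha$; $d_{2r}(1\otimes w\otimes1)=\sum_{\psi\in\mathrm{Sub}(w)}L(\psi)\otimes\psi\otimes R(\psi)$; $d_{2r+1}(1\otimes w\otimes1)=L(\psi_2)\otimes\psi_2\otimes1-1\otimes\psi_1\otimes R(\psi_1)$ for $r\ge1$. It is a projective bimodule resolution of $A$, and $\mathrm{HH}^n(A)$ is the $n$th cohomology of $\mathrm{Hom}_{A^e}(\mathbb{A}\mathrm{p}A,A)$. **The maps $F_n: A\otimes kAP_n\otimes A\to A^{\otimes(n+2)}$** (bimodule maps). $F_0(1\otimes e\otimes1)=e\otimes1$, $F_1(1\otimes\alpha\otimes1)=1\otimes\alpha\otimes1$, and for $n\ge2$, $w\in AP_n$, with $\mathrm{Sub}(w)=\{\zeta_1,\dots,\zeta_l\}$, $s(\zeta_1)<\cdots<s(\zeta_l)$, $w=L_i\zeta_iR_i$, $F_n(1\otimes w\otimes1)=\sum_{i=1}^{l-1}1\otimes L_{i+1}F_{n-1}(1\otimes\zeta_{i+1}\otimes1)R_{i+1}$. **The maps $G_n: A^{\otimes(n+2)}\to A\otimes kAP_n\otimes A$** (bimodule maps). A sequence $(v_1,\dots,v_n)\in\mathcal P^n$ is well-concatenated if $t(v_i)=s(v_{i+1})$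 for all $i<n$; $\mathcal M_{odd}=\{j: v_{2j-1}v_{2j}\notin I\}$, $\mathcal M_{even}=\{j: v_{2j}v_{2j+1}\notin I\}$; it is good if $n$ is even and $\mathcal M_{odd}=\emptyset$, or $n$ is odd and $\mathcal M_{even}=\emptyset$, and bad otherwise. $\chi(v_1,\dots,v_n)$ is the set of (occurrences of) $w\in AP_n$ with $v_1\cdots v_n=L(w)wR(w)$. $G_0(1\otimes1)=\sum_{i\in Q_0}1\otimes e_i\otimes1$; $G_1(1\otimes v\otimes1)=\sum_{i=1}^s\alpha_1\cdots\alpha_{i-1}\otimes\alpha_i\otimes\alpha_{i+1}\cdots\alpha_s$ for $v=\alpha_1\cdots\alpha_s$, $s\ge1$, and $0$ if $|v|=0$. For $n\ge2$, $G_n(1\otimes v_1\otimes\cdots\otimes v_n\otimes1)=0$ if the sequence is bad or $\chi=\emptyset$; otherwise it is $L(w_1)\otimes w_1\otimes R(w_1)$ with $w_1\in\chi(v_1,\dots,v_n)$ of minimal $s(w_1)$ if $n$ is even, and $\sum L(w)\otimes w\otimes R(w)$ over $w\in\chi(v_1,\dots,v_n)$ with $s(v_1)\le s(w)<t(v_1)$ if $n$ is odd. **Cup product.** For bimodule maps $f:A^{\otimes(n+2)}\to A$ and $g:A^{\otimes(m+2)}\to A$, $(f\cup g)(1\otimes v_1\otimes\cdots\otimes v_{n+m}\otimes1)=f(1\otimes v_1\otimes\cdots\otimes v_n\otimes1)\,g(1\otimes v_{n+1}\otimes\cdots\otimes v_{n+m}\otimes1)$. For bimodule maps $f:A\otimes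 kAP_n\otimes A\to A$ and $g:A\otimes kAP_m\otimes A\to A$, $f\cup g:=\big((f\circ G_n)\cup(g\circ G_m)\big)\circ F_{n+m}$; this induces the cup product on $\mathrm{HH}^*(A)$. *)

theory Defs
  imports
    "HOL-Algebra.QuotRing"
    "HOL-Algebra.Ideal_Product"
    "HOL-Library.Poly_Mapping"
    "Graph_Theory.Arc_Walk"
begin

text \<open>
  A quiver is a \<^typ>\<open>('v, 'a) pre_digraph\<close> (loops and multiple arrows allowed); its source and
  target maps are \<^const>\<open>tail\<close> and \<^const>\<open>head\<close>.  Every vector space below has a distinguished
  basis and is modelled by the finitely supported functions on that basis.
\<close>

section \<open>Spaces with a basis\<close>

definition span_on :: "'b set \<Rightarrow> ('b \<Rightarrow>\<^sub>0 'k::field) set" where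
  "span_on B = {x. Poly_Mapping.keys x \<subseteq> B}"

definition scale :: "'k::field \<Rightarrow> ('b \<Rightarrow>\<^sub>0 'k) \<Rightarrow> ('b \<Rightarrow>\<^sub>0 'k)" where
  "scale c x = Poly_Mapping.map ((*) c) x"

definition linext :: "('b \<Rightarrow> ('c \<Rightarrow>\<^sub>0 'k::field)) \<Rightarrow> ('b \<Rightarrow>\<^sub>0 'k) \<Rightarrow> ('c \<Rightarrow>\<^sub>0 'k)" where
  "linext \<phi> x = (\<Sum>b\<in>Poly_Mapping.keys x. scale (Poly_Mapping.lookup x b) (\<phi> b))"


section \<open>Paths and subpaths\<close>

text \<open>
  A path is its starting vertex together with its list of arrows, read from left to right;
  \<open>(x, [])\<close> is the trivial path \<open>e\<^sub>x\<close>.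
\<close>

type_synonym ('v, 'a) qpath = "'v \<times> 'a list"

abbreviation psrc :: "('v, 'a) qpath \<Rightarrow> 'v" where
  "psrc p \<equiv> fst p"

abbreviation plen :: "('v, 'a) qpath \<Rightarrow> nat" where
  "plen p \<equiv> length (snd p)"

abbreviation triv :: "'v \<Rightarrow> ('v, 'a) qpath" where
  "triv x \<equiv> (x, [])"

definition ptgt :: "('v, 'a) pre_digraph \<Rightarrow> ('v, 'a) qpath \<Rightarrow> 'v" where
  "ptgt Q p = last (pre_digraph.awalk_verts Q (fst p) (snd p))"

definition paths :: "('v, 'a) pre_digraph \<Rightarrow> ('v, 'a) qpath set" where
  "paths Q = {p. pre_digraph.awalk Q (psrc p) (snd p) (ptgt Q p)}"

definition composable :: "('v, 'a) pre_digraph \<Rightarrow> ('v, 'a) qpath \<Rightarrow> ('v, 'a) qpath \<Rightarrow> bool" where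
  "composable Q p q \<longleftrightarrow> ptgt Q p = psrc q"

definition pcat :: "('v, 'a) qpath \<Rightarrow> ('v, 'a) qpath \<Rightarrow> ('v, 'a) qpath" where
  "pcat p q = (fst p, snd p @ snd q)"

definition pconcat :: "('v, 'a) qpath list \<Rightarrow> ('v, 'a) qpath" where
  "pconcat vs = (fst (hd vs), concat (map snd vs))"

text \<open>
  The positions on a path \<open>T\<close> are \<open>0, \<dots>, plen T\<close>, and an occurrence of a subpath is the pair
  \<open>(i, j)\<close> of its starting and ending position; so \<open>L(p) = seg Q T 0 i\<close> and
  \<open>R(p) = seg Q T j (plen T)\<close>.
\<close>

type_synonym occ = "nat \<times> nat"

definition seg :: "('v, 'a) pre_digraph \<Rightarrow> ('v, 'a) qpath \<Rightarrow> nat \<Rightarrow> nat \<Rightarrow> ('v, 'a) qpath" where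
  "seg Q T i j = (ptgt Q (fst T, take i (snd T)), take (j - i) (drop i (snd T)))"

definition occs :: "('v, 'a) pre_digraph \<Rightarrow> ('v, 'a) qpath set \<Rightarrow> ('v, 'a) qpath \<Rightarrow> occ set" where
  "occs Q X T = {(i, j). i \<le> j \<and> j \<le> plen T \<and> seg Q T i j \<in> X}"


section \<open>The path algebra and its admissible monomial quotients\<close>

definition pmon :: "('v, 'a) qpath \<Rightarrow> (('v, 'a) qpath \<Rightarrow>\<^sub>0 'k::field)" where
  "pmon p = Poly_Mapping.single p 1"

definition path_mult ::
  "('v, 'a) pre_digraph \<Rightarrow> ('v, 'a) qpath \<Rightarrow> ('v, 'a) qpath \<Rightarrow> (('v, 'a) qpath \<Rightarrow>\<^sub>0 'k::field)" where
  "path_mult Q p q = (if composable Q p q then pmon (pcat p q) else 0)"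

definition path_alg :: "('v, 'a) pre_digraph \<Rightarrow> (('v, 'a) qpath \<Rightarrow>\<^sub>0 'k::field) ring" where
  "path_alg Q =
     \<lparr> carrier = span_on (paths Q),
       mult = (\<lambda>x y. linext (\<lambda>p. linext (\<lambda>q. path_mult Q p q) y) x),
       one = (\<Sum>x\<in>verts Q. pmon (triv x)),
       zero = 0,
       add = (+) \<rparr>"

definition arrow_path :: "('v, 'a) pre_digraph \<Rightarrow> 'a \<Rightarrow> ('v, 'a) qpath" where
  "arrow_path Q \<alpha> = (tail Q \<alpha>, [\<alpha>])"

definition arrow_ideal :: "('v, 'a) pre_digraph \<Rightarrow> (('v, 'a) qpath \<Rightarrow>\<^sub>0 'k::field) set" where
  "arrow_ideal Q = Idl\<^bsub>path_alg Q\<^esub> ((\<lambda>\<alpha>. pmon (arrow_path Q \<alpha>)) ` arcs Q)"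

locale monomial_algebra = fin_digraph Q
  for Q :: "('v, 'a) pre_digraph" +
  fixes I :: "(('v, 'a) qpath \<Rightarrow>\<^sub>0 'k::field) set"
  assumes generated_by_paths: "\<exists>S \<subseteq> paths Q. I = Idl\<^bsub>path_alg Q\<^esub> (pmon ` S)"
    and admissible: "\<exists>r::nat. 2 \<le> r \<and>
          arrow_ideal Q [^]\<^bsub>ideals_set (path_alg Q)\<^esub> r \<subseteq> I \<and>
          I \<subseteq> arrow_ideal Q [^]\<^bsub>ideals_set (path_alg Q)\<^esub> (2::nat)"

text \<open>The set \<open>\<P>\<close> of paths not in \<open>I\<close>, and the set \<open>\<R>\<close> of minimal paths in \<open>I\<close>.\<close>

definition Pths ::
  "('v, 'a) pre_digraph \<Rightarrow> (('v, 'a) qpath \<Rightarrow>\<^sub>0 'k::field) set \<Rightarrow> ('v, 'a) qpath set" where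
  "Pths Q I = {p \<in> paths Q. pmon p \<notin> I}"

definition Rels ::
  "('v, 'a) pre_digraph \<Rightarrow> (('v, 'a) qpath \<Rightarrow>\<^sub>0 'k::field) set \<Rightarrow> ('v, 'a) qpath set" where
  "Rels Q I = {p \<in> paths Q. pmon p \<in> I \<and>
     (\<forall>i j. i \<le> j \<and> j \<le> plen p \<and> (i, j) \<noteq> (0, plen p) \<longrightarrow> pmon (seg Q p i j) \<notin> I)}"

text \<open>
  \<open>A = kQ/I\<close>: as the classes of the paths in \<open>\<P>\<close> form a basis, every coset has exactly one
  representative supported on \<open>\<P>\<close>, and the elements of \<open>A\<close> are taken to be these
  representatives.  \<open>cls\<close> is the class of a path and \<open>nform\<close> the projection \<open>kQ \<rightarrow> A\<close>; that this is
  the quotient is proved in \<open>quotient_iso_alg\<close> below.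
\<close>

definition cls ::
  "('v, 'a) pre_digraph \<Rightarrow> (('v, 'a) qpath \<Rightarrow>\<^sub>0 'k::field) set \<Rightarrow> ('v, 'a) qpath
     \<Rightarrow> (('v, 'a) qpath \<Rightarrow>\<^sub>0 'k)" where
  "cls Q I p = (if p \<in> Pths Q I then pmon p else 0)"

definition nform ::
  "('v, 'a) pre_digraph \<Rightarrow> (('v, 'a) qpath \<Rightarrow>\<^sub>0 'k::field) set \<Rightarrow> (('v, 'a) qpath \<Rightarrow>\<^sub>0 'k)
     \<Rightarrow> (('v, 'a) qpath \<Rightarrow>\<^sub>0 'k)" where
  "nform Q I x = linext (cls Q I) x"

definition alg ::
  "('v, 'a) pre_digraph \<Rightarrow> (('v, 'a) qpath \<Rightarrow>\<^sub>0 'k::field) set \<Rightarrow> (('v, 'a) qpath \<Rightarrow>\<^sub>0 'k) ring" where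
  "alg Q I =
     \<lparr> carrier = span_on (Pths Q I),
       mult = (\<lambda>x y. nform Q I (x \<otimes>\<^bsub>path_alg Q\<^esub> y)),
       one = nform Q I \<one>\<^bsub>path_alg Q\<^esub>,
       zero = 0,
       add = (+) \<rparr>"


subsection \<open>\<open>alg Q I\<close> is \<open>kQ/I\<close>\<close>

lemma lookup_scale [simp]: "Poly_Mapping.lookup (scale c x) b = c * Poly_Mapping.lookup x b"
  unfolding scale_def by transfer (simp add: when_def)

lemma scale_simps [simp]:
  "scale 0 x = 0" "scale 1 x = x" "scale c 0 = 0" "scale c (scale d x) = scale (c * d) x"
  "scale (c + d) x = scale c x + scale d x" "scale c (x + y) = scale c x + scale c y"
  by (rule poly_mapping_eqI; simp add: lookup_add algebra_simps)+

lemma scale_sum: "scale c (\<Sum>i\<in>S. g i) = (\<Sum>i\<in>S. scale c (g i))"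
  by (induction S rule: infinite_finite_induct) auto

lemma linext_superset:
  assumes "finite S" "Poly_Mapping.keys x \<subseteq> S"
  shows "linext \<phi> x = (\<Sum>b\<in>S. scale (Poly_Mapping.lookup x b) (\<phi> b))"
  unfolding linext_def
  by (rule sum.mono_neutral_left) (use assms in \<open>auto simp: in_keys_iff\<close>)

lemma linext_add [simp]: "linext \<phi> (x + y) = linext \<phi> x + linext \<phi> y"
proof -
  let ?S = "Poly_Mapping.keys x \<union> Poly_Mapping.keys y"
  have "linext \<phi> z = (\<Sum>b\<in>?S. scale (Poly_Mapping.lookup z b) (\<phi> b))"
    if "Poly_Mapping.keys z \<subseteq> ?S" for z
    using that by (intro linext_superset) auto
  from this[of x] this[of y] this[of "x + y"] show ?thesis
    using Poly_Mapping.keys_add[of x y] by (simp add: lookup_add sum.distrib)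
qed

lemma linext_zero [simp]: "linext \<phi> 0 = 0"
  by (simp add: linext_def)

lemma linext_scale [simp]: "linext \<phi> (scale c x) = scale c (linext \<phi> x)"
proof -
  have "Poly_Mapping.keys (scale c x) \<subseteq> Poly_Mapping.keys x"
    by (auto simp: in_keys_iff)
  then show ?thesis
    using linext_superset[of "Poly_Mapping.keys x" x \<phi>]
      linext_superset[of "Poly_Mapping.keys x" "scale c x" \<phi>] by (simp add: scale_sum)
qed

lemma linext_uminus: "linext \<phi> (- x) = - linext \<phi> x"
  using linext_add[of \<phi> x "- x"] by (simp add: eq_neg_iff_add_eq_0 add.commute)

lemma linext_sum: "linext \<phi> (\<Sum>i\<in>S. g i) = (\<Sum>i\<in>S. linext \<phi> (g i))"
  by (induction S rule: infinite_finite_induct) auto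

lemma linext_pmon [simp]: "linext \<phi> (pmon p) = \<phi> p"
  by (simp add: linext_def pmon_def)

lemma linext_expand: "x = linext pmon x"
proof (rule poly_mapping_eqI)
  fix k
  show "Poly_Mapping.lookup x k = Poly_Mapping.lookup (linext pmon x) k"
    by (simp add: linext_def lookup_sum pmon_def lookup_single when_def
        if_distrib[of "\<lambda>y. _ * y"] sum.delta in_keys_iff cong: if_cong)
qed

lemma linext_cong:
  "(\<And>b. b \<in> Poly_Mapping.keys x \<Longrightarrow> \<phi> b = \<psi> b) \<Longrightarrow> linext \<phi> x = linext \<psi> x"
  by (simp add: linext_def)

lemma linext_0fun [simp]: "linext (\<lambda>_. 0) x = 0"
  by (simp add: linext_def)

lemma linext_addfun: "linext (\<lambda>b. \<phi> b + \<psi> b) x = linext \<phi> x + linext \<psi> x"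
  by (simp add: linext_def sum.distrib)

lemma linext_linext: "linext \<phi> (linext \<psi> x) = linext (\<lambda>b. linext \<phi> (\<psi> b)) x"
  unfolding linext_def[of \<psi>] linext_sum by (simp add: linext_def[of _ x])

lemma span_on_add: "x \<in> span_on B \<Longrightarrow> y \<in> span_on B \<Longrightarrow> x + y \<in> span_on B"
  using Poly_Mapping.keys_add[of x y] by (auto simp: span_on_def)

lemma span_on_zero [simp]: "0 \<in> span_on B"
  by (simp add: span_on_def)

lemma span_on_scale: "x \<in> span_on B \<Longrightarrow> scale c x \<in> span_on B"
  by (auto simp: span_on_def in_keys_iff)

lemma span_on_uminus: "x \<in> span_on B \<Longrightarrow> - x \<in> span_on B"
  by (auto simp: span_on_def in_keys_iff)

lemma span_on_sum: "(\<And>i. i \<in> S \<Longrightarrow> g i \<in> span_on B) \<Longrightarrow> (\<Sum>i\<in>S. g i) \<in> span_on B"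
  by (induction S rule: infinite_finite_induct) (auto intro: span_on_add)

lemma linext_in_span:
  "(\<And>b. b \<in> Poly_Mapping.keys x \<Longrightarrow> \<phi> b \<in> span_on B) \<Longrightarrow> linext \<phi> x \<in> span_on B"
  unfolding linext_def by (intro span_on_sum span_on_scale)

lemma pmon_in_span [simp]: "(pmon p :: _ \<Rightarrow>\<^sub>0 'k::field) \<in> span_on B \<longleftrightarrow> p \<in> B"
  by (simp add: span_on_def pmon_def)

lemma pcat_in_paths:
  "p \<in> paths Q \<Longrightarrow> q \<in> paths Q \<Longrightarrow> composable Q p q \<Longrightarrow> pcat p q \<in> paths Q"
  and ptgt_pcat: "composable Q p q \<Longrightarrow> ptgt Q (pcat p q) = ptgt Q q"
proof -
  have "last (pre_digraph.awalk_verts Q u (xs @ ys)) = 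
    last (pre_digraph.awalk_verts Q (last (pre_digraph.awalk_verts Q u xs)) ys)" for u xs ys
    by (auto simp: pre_digraph.awalk_verts_conv)
  then show t: "ptgt Q (pcat p q) = ptgt Q q" if "composable Q p q" for p q
    using that by (auto simp: ptgt_def pcat_def composable_def)
  have cas: "pre_digraph.cas Q u (xs @ ys) v" 
    if "pre_digraph.cas Q u xs w" "pre_digraph.cas Q w ys v" for u v w xs ys
    using that by (induction xs arbitrary: u) (auto simp: pre_digraph.cas.simps)
  assume "p \<in> paths Q" "q \<in> paths Q" "composable Q p q"
  then show "pcat p q \<in> paths Q"
    using t[of p q] cas[of "psrc p" "snd p" "psrc q" "snd q" "ptgt Q q"]
    by (auto simp: paths_def pre_digraph.awalk_def composable_def pcat_def)
qed

lemma pcat_assoc: "pcat (pcat p q) r = pcat p (pcat q r)"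
  by (simp add: pcat_def)

lemma composable_pcat:
  "composable Q p (pcat q r) \<longleftrightarrow> composable Q p q"
  "composable Q p q \<Longrightarrow> composable Q (pcat p q) r \<longleftrightarrow> composable Q q r"
  by (auto simp: composable_def ptgt_pcat) (simp_all add: pcat_def)

lemma path_alg_simps [simp]:
  "carrier (path_alg Q) = span_on (paths Q)" "\<zero>\<^bsub>path_alg Q\<^esub> = 0"
  "x \<oplus>\<^bsub>path_alg Q\<^esub> y = x + y"
  by (simp_all add: path_alg_def)

lemma path_alg_mult:
  "x \<otimes>\<^bsub>path_alg Q\<^esub> y = linext (\<lambda>p. linext (\<lambda>q. path_mult Q p q) y) x"
  by (simp add: path_alg_def)

lemma path_alg_one: "\<one>\<^bsub>path_alg Q\<^esub> = (\<Sum>x\<in>verts Q. pmon (triv x))"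
  by (simp add: path_alg_def)

lemma pmon_mult: "pmon p \<otimes>\<^bsub>path_alg Q\<^esub> pmon q = path_mult Q p q"
  by (simp add: path_alg_mult)

lemma path_alg_assoc:
  "(x \<otimes>\<^bsub>path_alg Q\<^esub> y) \<otimes>\<^bsub>path_alg Q\<^esub> z = x \<otimes>\<^bsub>path_alg Q\<^esub> (y \<otimes>\<^bsub>path_alg Q\<^esub> z)"
proof -
  have *: "linext (\<lambda>s. linext (path_mult Q s) z) (path_mult Q p q) = 
      linext (\<lambda>r. linext (path_mult Q p) (path_mult Q q r)) z" for p q
  proof (cases "composable Q p q")
    case True
    then show ?thesis
      by (auto simp: path_mult_def composable_pcat pcat_assoc if_distrib[of "linext _"] 
          intro!: linext_cong)
  next
    case False
    then show ?thesis
      by (auto simp: path_mult_def composable_pcat if_distrib[of "linext _"] cong: if_cong)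
  qed
  show ?thesis
    unfolding path_alg_mult linext_linext * ..
qed

lemma path_alg_one_left:
  assumes "finite (verts Q)" "x \<in> span_on (paths Q)"
  shows "\<one>\<^bsub>path_alg Q\<^esub> \<otimes>\<^bsub>path_alg Q\<^esub> x = x"
proof -
  have "\<one>\<^bsub>path_alg Q\<^esub> \<otimes>\<^bsub>path_alg Q\<^esub> x = (\<Sum>v\<in>verts Q. linext (path_mult Q (triv v)) x)"
    by (simp add: path_alg_one path_alg_mult linext_sum)
  also have "\<dots> = linext (\<lambda>q. \<Sum>v\<in>verts Q. path_mult Q (triv v) q) x"
    by (simp add: linext_def scale_sum sum.swap[of _ "verts Q"])
  also have "\<dots> = linext pmon x"
  proof (rule linext_cong)
    fix q assume "q \<in> Poly_Mapping.keys x"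
    then have q: "psrc q \<in> verts Q"
      using assms(2) by (auto simp: span_on_def paths_def pre_digraph.awalk_def)
    have "(\<Sum>v\<in>verts Q. path_mult Q (triv v) q) = (\<Sum>v\<in>verts Q. if v = psrc q then pmon q else 0)"
      by (rule sum.cong) 
        (auto simp: path_mult_def composable_def ptgt_def pcat_def pre_digraph.awalk_verts_conv)
    then show "(\<Sum>v\<in>verts Q. path_mult Q (triv v) q) = pmon q"
      using q assms(1) by simp
  qed
  finally show ?thesis
    using linext_expand[of x] by simp
qed

lemma (in wf_digraph) ptgt_in_verts: "p \<in> paths G \<Longrightarrow> ptgt G p \<in> verts G"
  unfolding paths_def by auto

lemma (in fin_digraph) path_alg_one_right:
  assumes "x \<in> span_on (paths G)"
  shows "x \<otimes>\<^bsub>path_alg G\<^esub> \<one>\<^bsub>path_alg G\<^esub> = x"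
proof -
  have "x \<otimes>\<^bsub>path_alg G\<^esub> \<one>\<^bsub>path_alg G\<^esub> = linext (\<lambda>p. \<Sum>v\<in>verts G. path_mult G p (triv v)) x"
    by (simp add: path_alg_one path_alg_mult linext_sum)
  also have "\<dots> = linext pmon x"
  proof (rule linext_cong)
    fix p assume "p \<in> Poly_Mapping.keys x"
    then have p: "ptgt G p \<in> verts G"
      using assms by (auto simp: span_on_def intro: ptgt_in_verts)
    have "(\<Sum>v\<in>verts G. path_mult G p (triv v)) = 
        (\<Sum>v\<in>verts G. if v = ptgt G p then pmon p else 0)"
      by (rule sum.cong) (auto simp: path_mult_def composable_def pcat_def)
    then show "(\<Sum>v\<in>verts G. path_mult G p (triv v)) = pmon p"
      using p by simp
  qed
  finally show ?thesis
    using linext_expand[of x] by simp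
qed

lemma path_alg_closed:
  assumes "x \<in> span_on (paths Q)" "y \<in> span_on (paths Q)"
  shows "x \<otimes>\<^bsub>path_alg Q\<^esub> y \<in> span_on (paths Q)"
  unfolding path_alg_mult
  by (intro linext_in_span)
    (use assms in \<open>auto simp: path_mult_def span_on_def[of "paths Q"] pmon_def intro: pcat_in_paths\<close>)

lemma path_alg_distrib:
  "(x + y) \<otimes>\<^bsub>path_alg Q\<^esub> z = x \<otimes>\<^bsub>path_alg Q\<^esub> z + y \<otimes>\<^bsub>path_alg Q\<^esub> z"
  "z \<otimes>\<^bsub>path_alg Q\<^esub> (x + y) = z \<otimes>\<^bsub>path_alg Q\<^esub> x + z \<otimes>\<^bsub>path_alg Q\<^esub> y"
  by (simp_all add: path_alg_mult linext_addfun)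

lemma (in fin_digraph) ring_path_alg: "ring (path_alg G :: (_ \<Rightarrow>\<^sub>0 'k::field) ring)"
proof (rule ringI)
  show "abelian_group (path_alg G :: (_ \<Rightarrow>\<^sub>0 'k) ring)"
  proof (rule abelian_groupI)
    fix x :: "_ \<Rightarrow>\<^sub>0 'k" assume "x \<in> carrier (path_alg G)"
    then show "\<exists>y\<in>carrier (path_alg G). y \<oplus>\<^bsub>path_alg G\<^esub> x = \<zero>\<^bsub>path_alg G\<^esub>"
      by (intro bexI[of _ "- x"]) (auto intro: span_on_uminus)
  qed (auto simp: add_ac intro: span_on_add)
  show "monoid (path_alg G :: (_ \<Rightarrow>\<^sub>0 'k) ring)"
  proof (rule monoidI)
    show "\<one>\<^bsub>path_alg G\<^esub> \<in> carrier (path_alg G :: (_ \<Rightarrow>\<^sub>0 'k) ring)"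
      by (auto simp: path_alg_one paths_def ptgt_def pre_digraph.awalk_def 
          pre_digraph.cas.simps pre_digraph.awalk_verts_conv intro!: span_on_sum)
  qed (auto simp: path_alg_closed path_alg_assoc path_alg_one_left path_alg_one_right)
qed (auto simp: path_alg_distrib)

context monomial_algebra
begin

lemma ideal_I: "ideal I (path_alg Q)"
proof -
  obtain S where "S \<subseteq> paths Q" "I = Idl\<^bsub>path_alg Q\<^esub> (pmon ` S)"
    using generated_by_paths by auto
  then show ?thesis
    by (auto intro!: ring.genideal_ideal ring_path_alg)
qed

lemma scale_in_I:
  assumes "x \<in> I"
  shows "scale c x \<in> I"
proof -
  have x: "x \<in> span_on (paths Q)"
    using ideal.Icarr[OF ideal_I assms] by simp
  have one: "\<one>\<^bsub>path_alg Q\<^esub> \<in> carrier (path_alg Q :: (_ \<Rightarrow>\<^sub>0 'k) ring)"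
    using ring.ring_simprules(6)[OF ring_path_alg] .
  have "scale c \<one>\<^bsub>path_alg Q\<^esub> \<otimes>\<^bsub>path_alg Q\<^esub> x = scale c (\<one>\<^bsub>path_alg Q\<^esub> \<otimes>\<^bsub>path_alg Q\<^esub> x)"
    by (simp add: path_alg_mult)
  also have "\<dots> = scale c x"
    using x by (simp add: path_alg_one_left)
  finally show ?thesis
    using ideal.I_l_closed[OF ideal_I assms, of "scale c \<one>\<^bsub>path_alg Q\<^esub>"] one
    by (simp add: span_on_scale)
qed

lemma I_eq_span: "I = span_on {p \<in> paths Q. pmon p \<in> I}"
proof
  show "span_on {p \<in> paths Q. pmon p \<in> I} \<subseteq> I"
  proof
    fix x :: "_ \<Rightarrow>\<^sub>0 'k" assume x: "x \<in> span_on {p \<in> paths Q. pmon p \<in> I}"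
    have "(\<Sum>b\<in>S. scale (Poly_Mapping.lookup x b) (pmon b)) \<in> I" 
      if "finite S" "S \<subseteq> Poly_Mapping.keys x" for S
      using that
    proof (induction S)
      case empty
      then show ?case using additive_subgroup.zero_closed[OF ideal.axioms(1)[OF ideal_I]] by simp
    next
      case (insert b S)
      then have "scale (Poly_Mapping.lookup x b) (pmon b) \<in> I"
        using x by (intro scale_in_I) (auto simp: span_on_def)
      with insert show ?case
        using additive_subgroup.a_closed[OF ideal.axioms(1)[OF ideal_I]] by simp
    qed
    from this[of "Poly_Mapping.keys x"] show "x \<in> I"
      using linext_expand[of x] by (simp add: linext_def)
  qed
next
  obtain S where S: "S \<subseteq> paths Q" "I = Idl\<^bsub>path_alg Q\<^esub> (pmon ` S)"
    using generated_by_paths by auto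
  let ?K = "span_on {p \<in> paths Q. pmon p \<in> I} :: (_ \<Rightarrow>\<^sub>0 'k) set"
  have mult: "path_mult Q p q \<in> ?K" 
    if "p \<in> paths Q" "q \<in> paths Q" "pmon p \<in> I \<or> pmon q \<in> I" for p q
  proof (cases "composable Q p q")
    case True
    have "pmon p \<otimes>\<^bsub>path_alg Q\<^esub> pmon q \<in> I"
      using that ideal.I_l_closed[OF ideal_I, of "pmon q" "pmon p"] 
        ideal.I_r_closed[OF ideal_I, of "pmon p" "pmon q"] by auto
    with True that show ?thesis
      by (simp add: pmon_mult path_mult_def pcat_in_paths)
  qed (simp add: path_mult_def)
  have "ideal ?K (path_alg Q)"
  proof (rule idealI[OF ring_path_alg])
    show "subgroup ?K (add_monoid (path_alg Q))"
    proof (rule group.subgroupI[OF abelian_group.a_group[OF ring.is_abelian_group[OF ring_path_alg]]])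
      fix x :: "_ \<Rightarrow>\<^sub>0 'k" assume x: "x \<in> ?K"
      then have "x \<in> span_on (paths Q)" by (auto simp: span_on_def)
      then have "\<ominus>\<^bsub>path_alg Q\<^esub> x = - x"
        using span_on_uminus[of x] 
        by (intro abelian_group.minus_equality[OF ring.is_abelian_group[OF ring_path_alg]]) auto
      with x show "inv\<^bsub>add_monoid (path_alg Q)\<^esub> x \<in> ?K"
        by (simp add: a_inv_def span_on_uminus)
    next
      show "?K \<subseteq> carrier (add_monoid (path_alg Q))"
        by (auto simp: span_on_def)
      show "?K \<noteq> {}"
        using span_on_zero by blast
    qed (simp add: span_on_add)
  next
    fix a x :: "_ \<Rightarrow>\<^sub>0 'k" assume "a \<in> ?K" "x \<in> carrier (path_alg Q)"
    then show "x \<otimes>\<^bsub>path_alg Q\<^esub> a \<in> ?K" "a \<otimes>\<^bsub>path_alg Q\<^esub> x \<in> ?K"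
      unfolding path_alg_mult path_alg_simps
      by (intro linext_in_span mult; force simp: span_on_def)+
  qed
  moreover have "pmon ` S \<subseteq> ?K"
  proof -
    have "(pmon ` S :: (_ \<Rightarrow>\<^sub>0 'k) set) \<subseteq> carrier (path_alg Q)"
      using S(1) by force
    from ring.genideal_self[OF ring_path_alg this] show ?thesis
      using S by (fastforce simp del: split_paired_All)
  qed
  ultimately show "I \<subseteq> ?K"
    using S(2) ring.genideal_minimal[OF ring_path_alg] by blast
qed

lemma lookup_nform:
  "Poly_Mapping.lookup (nform Q I x) p = (if p \<in> Pths Q I then Poly_Mapping.lookup x p else 0)"
proof -
  have "Poly_Mapping.lookup (nform Q I x) p = (\<Sum>b\<in>Poly_Mapping.keys x. 
      if b = p then (if p \<in> Pths Q I then Poly_Mapping.lookup x p else 0) else 0)"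
    unfolding nform_def linext_def lookup_sum
    by (rule sum.cong) (auto simp: cls_def pmon_def lookup_single when_def)
  then show ?thesis
    by (simp add: in_keys_iff)
qed

lemma nform_in_alg: "nform Q I x \<in> carrier (alg Q I)"
  by (auto simp: alg_def span_on_def in_keys_iff lookup_nform split: if_splits)

lemma nform_eq_0_iff:
  assumes "x \<in> span_on (paths Q)"
  shows "nform Q I x = 0 \<longleftrightarrow> x \<in> I"
proof -
  have "nform Q I x = 0 \<longleftrightarrow> (\<forall>p\<in>Pths Q I. Poly_Mapping.lookup x p = 0)"
    by (auto simp: poly_mapping_eq_iff fun_eq_iff lookup_nform)
  also have "\<dots> \<longleftrightarrow> x \<in> span_on {p \<in> paths Q. pmon p \<in> I}"
    using assms unfolding Pths_def span_on_def by (auto simp: in_keys_iff subset_iff; blast)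
  finally show ?thesis
    using I_eq_span by simp
qed

lemma nform_id: "x \<in> carrier (alg Q I) \<Longrightarrow> nform Q I x = x"
  by (rule poly_mapping_eqI) (auto simp: lookup_nform alg_def span_on_def in_keys_iff)

lemma nform_add: "nform Q I (x + y) = nform Q I x + nform Q I y"
  by (simp add: nform_def)

lemma nform_in_path_alg: "nform Q I x \<in> span_on (paths Q)"
  using nform_in_alg[of x] by (auto simp: alg_def span_on_def Pths_def)

lemma nform_mult:
  assumes x: "x \<in> span_on (paths Q)" and y: "y \<in> span_on (paths Q)"
  shows "nform Q I (x \<otimes>\<^bsub>path_alg Q\<^esub> y) = nform Q I x \<otimes>\<^bsub>alg Q I\<^esub> nform Q I y"
proof -
  let ?n = "nform Q I"
  have i: "z + - ?n z \<in> I" if "z \<in> span_on (paths Q)" for z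
  proof -
    have "?n (z + - ?n z) = 0"
      using nform_id[OF nform_in_alg[of z]] linext_uminus[of "cls Q I" "?n z"] 
      by (simp only: nform_add) (simp add: nform_def)
    moreover have "z + - ?n z \<in> span_on (paths Q)"
      using that nform_in_path_alg by (intro span_on_add span_on_uminus)
    ultimately show ?thesis
      using nform_eq_0_iff by blast
  qed
  let ?a = "(x + - ?n x) \<otimes>\<^bsub>path_alg Q\<^esub> y" and ?b = "?n x \<otimes>\<^bsub>path_alg Q\<^esub> (y + - ?n y)"
  have ab: "?a \<in> I" "?b \<in> I"
    using i[OF x] i[OF y] y nform_in_path_alg[of x]
      ideal.I_l_closed[OF ideal_I] ideal.I_r_closed[OF ideal_I] by auto
  then have "?a \<in> span_on (paths Q)" "?b \<in> span_on (paths Q)"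
    using ideal.Icarr[OF ideal_I] by auto
  then have 0: "?n ?a = 0" "?n ?b = 0"
    using ab nform_eq_0_iff by blast+
  have "x \<otimes>\<^bsub>path_alg Q\<^esub> y = ?a + (?n x \<otimes>\<^bsub>path_alg Q\<^esub> y)"
    by (simp flip: path_alg_distrib)
  moreover have "?n x \<otimes>\<^bsub>path_alg Q\<^esub> y = ?b + (?n x \<otimes>\<^bsub>path_alg Q\<^esub> ?n y)"
    by (simp flip: path_alg_distrib)
  ultimately show ?thesis
    using 0 by (simp add: nform_add alg_def)
qed

lemma nform_ring_hom: "nform Q I \<in> ring_hom (path_alg Q) (alg Q I)"
  by (rule ring_hom_memI) (simp_all add: nform_in_alg nform_mult nform_add, simp_all add: alg_def nform_add)

lemma nform_surj: "nform Q I ` carrier (path_alg Q) = carrier (alg Q I)"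
proof -
  have "carrier (alg Q I) \<subseteq> span_on (paths Q)"
    by (auto simp: alg_def span_on_def Pths_def)
  then show ?thesis
    using nform_id nform_in_alg by (force simp: image_iff)
qed

lemma ring_alg: "ring (alg Q I)"
proof -
  have "ring ((alg Q I) \<lparr> zero := nform Q I \<zero>\<^bsub>path_alg Q\<^esub> \<rparr>)"
    using ring.ring_hom_imp_img_ring[OF ring_path_alg nform_ring_hom]
    unfolding nform_surj by simp
  then show ?thesis
    by (simp add: alg_def nform_def)
qed

lemma a_kernel_nform: "a_kernel (path_alg Q) (alg Q I) (nform Q I) = I"
  using nform_eq_0_iff ideal.Icarr[OF ideal_I]
  by (auto simp: a_kernel_def' alg_def)

theorem quotient_iso_alg: "path_alg Q Quot I \<simeq> alg Q I"
proof -
  have "ring_hom_ring (path_alg Q) (alg Q I) (nform Q I)"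
    by (intro ring_hom_ringI2 ring_path_alg ring_alg nform_ring_hom)
  from ring_hom_ring.FactRing_iso[OF this nform_surj] show ?thesis
    by (simp add: a_kernel_nform)
qed

end


section \<open>The sets \<open>AP\<^sub>n\<close>\<close>

text \<open>
  \<open>p\<^sub>j\<close> is \<open>ps ! (j - 1)\<close>; an \<open>n\<close>-concatenation is a list of length \<open>n - 1\<close>.
  \<open>concat_cands Q I T ps k\<close> is the set among which \<open>ps ! k\<close> (\<open>k \<ge> 1\<close>) has to start first.
\<close>

definition concat_cands ::
  "('v, 'a) pre_digraph \<Rightarrow> (('v, 'a) qpath \<Rightarrow>\<^sub>0 'k::field) set \<Rightarrow> ('v, 'a) qpath
     \<Rightarrow> occ list \<Rightarrow> nat \<Rightarrow> occ set" where
  "concat_cands Q I T ps k =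
     (if k = 1 then {p \<in> occs Q (Rels Q I) T. fst (ps ! 0) < fst p \<and> fst p < snd (ps ! 0)}
      else {p \<in> occs Q (Rels Q I) T. snd (ps ! (k - 2)) \<le> fst p \<and> fst p < snd (ps ! (k - 1))})"

definition concatenation ::
  "('v, 'a) pre_digraph \<Rightarrow> (('v, 'a) qpath \<Rightarrow>\<^sub>0 'k::field) set \<Rightarrow> ('v, 'a) qpath
     \<Rightarrow> nat \<Rightarrow> occ list \<Rightarrow> bool" where
  "concatenation Q I T n ps \<longleftrightarrow>
     2 \<le> n \<and> length ps = n - 1 \<and> ps ! 0 \<in> occs Q (Rels Q I) T \<and>
     (\<forall>k. 1 \<le> k \<and> k < n - 1 \<longrightarrow>
        ps ! k \<in> concat_cands Q I T ps k \<and>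
        (\<forall>p \<in> concat_cands Q I T ps k. fst (ps ! k) \<le> fst p))"

text \<open>
  For op-concatenations, \<open>rs = [q\<^sub>1, \<dots>, q\<^sub>n\<^sub>-\<^sub>1]\<close> in \<open>op_cands\<close>, whereas \<open>op_concatenation\<close> takes
  the reversed list \<open>[q\<^sup>1, \<dots>, q\<^sup>n\<^sup>-\<^sup>1]\<close>, which is ordered along \<open>T\<close>.
\<close>

definition op_cands ::
  "('v, 'a) pre_digraph \<Rightarrow> (('v, 'a) qpath \<Rightarrow>\<^sub>0 'k::field) set \<Rightarrow> ('v, 'a) qpath
     \<Rightarrow> occ list \<Rightarrow> nat \<Rightarrow> occ set" where
  "op_cands Q I T rs k =
     (if k = 1 then {q \<in> occs Q (Rels Q I) T. fst (rs ! 0) < snd q \<and> snd q < snd (rs ! 0)}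
      else {q \<in> occs Q (Rels Q I) T. fst (rs ! (k - 1)) < snd q \<and> snd q \<le> fst (rs ! (k - 2))})"

definition op_concatenation ::
  "('v, 'a) pre_digraph \<Rightarrow> (('v, 'a) qpath \<Rightarrow>\<^sub>0 'k::field) set \<Rightarrow> ('v, 'a) qpath
     \<Rightarrow> nat \<Rightarrow> occ list \<Rightarrow> bool" where
  "op_concatenation Q I T n qs \<longleftrightarrow>
     2 \<le> n \<and> length qs = n - 1 \<and> rev qs ! 0 \<in> occs Q (Rels Q I) T \<and>
     (\<forall>k. 1 \<le> k \<and> k < n - 1 \<longrightarrow>
        rev qs ! k \<in> op_cands Q I T (rev qs) k \<and>
        (\<forall>q \<in> op_cands Q I T (rev qs) k. snd q \<le> snd (rev qs ! k)))"

text \<open>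
  The support of a list of occurrences ordered along \<open>T\<close>: \<open>w(p\<^sub>1, \<dots>, p\<^sub>l)\<close> for a concatenation,
  \<open>w\<^sup>o\<^sup>p(q\<^sup>1, \<dots>, q\<^sup>l)\<close> for an op-concatenation.
\<close>

definition supp :: "('v, 'a) pre_digraph \<Rightarrow> ('v, 'a) qpath \<Rightarrow> occ list \<Rightarrow> ('v, 'a) qpath" where
  "supp Q T ps = seg Q T (fst (hd ps)) (snd (last ps))"

definition AP ::
  "('v, 'a) pre_digraph \<Rightarrow> (('v, 'a) qpath \<Rightarrow>\<^sub>0 'k::field) set \<Rightarrow> nat \<Rightarrow> ('v, 'a) qpath set" where
  "AP Q I n =
     (if n = 0 then triv ` verts Q
      else if n = 1 then arrow_path Q ` arcs Q
      else {supp Q T ps | T ps. T \<in> paths Q \<and> concatenation Q I T n ps})"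

text \<open>\<open>Sub(w)\<close> for \<open>w \<in> AP\<^sub>n\<close>, \<open>n \<ge> 1\<close>.\<close>

definition Sub ::
  "('v, 'a) pre_digraph \<Rightarrow> (('v, 'a) qpath \<Rightarrow>\<^sub>0 'k::field) set \<Rightarrow> nat \<Rightarrow> ('v, 'a) qpath
     \<Rightarrow> occ set" where
  "Sub Q I n w = occs Q (AP Q I (n - 1)) w"


section \<open>Tensor products over \<open>E\<close>\<close>

text \<open>
  \<open>A \<otimes> kAP\<^sub>n \<otimes> A\<close> and \<open>A \<otimes> \<dots> \<otimes> A\<close> (over \<open>E = kQ\<^sub>0\<close>) have as bases the tensors \<open>x\<^sub>0 \<otimes> \<dots> \<otimes> x\<^sub>l\<close> of basis
  paths of the factors with \<open>t(x\<^sub>i) = s(x\<^sub>i\<^sub>+\<^sub>1)\<close>: a tensor of paths that do not match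
  vanishes over \<open>E\<close>.  Such a tensor is encoded as the list \<open>[x\<^sub>0, \<dots>, x\<^sub>l]\<close>.
\<close>

type_synonym ('v, 'a, 'k) tensors = "('v, 'a) qpath list \<Rightarrow>\<^sub>0 'k"

definition bardzell ::
  "('v, 'a) pre_digraph \<Rightarrow> (('v, 'a) qpath \<Rightarrow>\<^sub>0 'k::field) set \<Rightarrow> nat
     \<Rightarrow> ('v, 'a, 'k) tensors set" where
  "bardzell Q I n =
     span_on {[u, w, v] | u w v. u \<in> Pths Q I \<and> w \<in> AP Q I n \<and> v \<in> Pths Q I \<and>
                composable Q u w \<and> composable Q w v}"

text \<open>The element \<open>1 \<otimes> v\<^sub>1 \<otimes> \<dots> \<otimes> v\<^sub>l \<otimes> 1\<close> for matching paths \<open>v\<^sub>1, \<dots>, v\<^sub>l\<close>, where \<open>1 = \<Sum>\<^sub>x e\<^sub>x\<close>.\<close>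

definition unit_tensor ::
  "('v, 'a) pre_digraph \<Rightarrow> ('v, 'a) qpath list \<Rightarrow> ('v, 'a, 'k::field) tensors" where
  "unit_tensor Q vs =
     (if vs = [] then \<Sum>x\<in>verts Q. Poly_Mapping.single [triv x, triv x] 1
      else Poly_Mapping.single ([triv (psrc (hd vs))] @ vs @ [triv (ptgt Q (last vs))]) 1)"

text \<open>The element \<open>u \<otimes> w \<otimes> v\<close> for matching paths \<open>u, w, v\<close>, the outer ones read in \<open>A\<close>.\<close>

definition path_tensor ::
  "('v, 'a) pre_digraph \<Rightarrow> (('v, 'a) qpath \<Rightarrow>\<^sub>0 'k::field) set \<Rightarrow> ('v, 'a) qpath \<Rightarrow> ('v, 'a) qpath
     \<Rightarrow> ('v, 'a) qpath \<Rightarrow> ('v, 'a, 'k) tensors" where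
  "path_tensor Q I u w v =
     (if u \<in> Pths Q I \<and> v \<in> Pths Q I then Poly_Mapping.single [u, w, v] 1 else 0)"

text \<open>\<open>1 \<otimes> x\<close>; on a basis tensor, \<open>1 \<otimes> x\<^sub>0 \<otimes> \<dots> = e \<otimes> x\<^sub>0 \<otimes> \<dots>\<close> with \<open>e\<close> the trivial path at \<open>s(x\<^sub>0)\<close>.\<close>

definition one_otimes :: "('v, 'a, 'k::field) tensors \<Rightarrow> ('v, 'a, 'k) tensors" where
  "one_otimes x = linext (\<lambda>xs. Poly_Mapping.single (triv (psrc (hd xs)) # xs) 1) x"

text \<open>The \<open>A\<close>-bimodule structure \<open>a x b\<close>, for tensors with at least two factors.\<close>

definition act_basis ::
  "('v, 'a) pre_digraph \<Rightarrow> (('v, 'a) qpath \<Rightarrow>\<^sub>0 'k::field) set \<Rightarrow> ('v, 'a) qpath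
     \<Rightarrow> ('v, 'a) qpath list \<Rightarrow> ('v, 'a) qpath \<Rightarrow> ('v, 'a, 'k) tensors" where
  "act_basis Q I p xs q =
     (if composable Q p (hd xs) \<and> composable Q (last xs) q \<and>
         pcat p (hd xs) \<in> Pths Q I \<and> pcat (last xs) q \<in> Pths Q I
      then Poly_Mapping.single ([pcat p (hd xs)] @ butlast (tl xs) @ [pcat (last xs) q]) 1
      else 0)"

definition act ::
  "('v, 'a) pre_digraph \<Rightarrow> (('v, 'a) qpath \<Rightarrow>\<^sub>0 'k::field) set \<Rightarrow> (('v, 'a) qpath \<Rightarrow>\<^sub>0 'k)
     \<Rightarrow> ('v, 'a, 'k) tensors \<Rightarrow> (('v, 'a) qpath \<Rightarrow>\<^sub>0 'k) \<Rightarrow> ('v, 'a, 'k) tensors" where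
  "act Q I a x b = linext (\<lambda>p. linext (\<lambda>xs. linext (\<lambda>q. act_basis Q I p xs q) b) x) a"

text \<open>
  The bimodule map between tensor products that sends \<open>1 \<otimes> v\<^sub>1 \<otimes> \<dots> \<otimes> v\<^sub>l \<otimes> 1\<close> to
  \<open>\<phi> [v\<^sub>1, \<dots>, v\<^sub>l]\<close>.
\<close>

definition bimod_ext ::
  "('v, 'a) pre_digraph \<Rightarrow> (('v, 'a) qpath \<Rightarrow>\<^sub>0 'k::field) set
     \<Rightarrow> (('v, 'a) qpath list \<Rightarrow> ('v, 'a, 'k) tensors)
     \<Rightarrow> ('v, 'a, 'k) tensors \<Rightarrow> ('v, 'a, 'k) tensors" where
  "bimod_ext Q I \<phi> x =
     linext (\<lambda>xs. act Q I (cls Q I (hd xs)) (\<phi> (butlast (tl xs))) (cls Q I (last xs))) x"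

definition bimod_map ::
  "('v, 'a) pre_digraph \<Rightarrow> (('v, 'a) qpath \<Rightarrow>\<^sub>0 'k::field) set \<Rightarrow> ('v, 'a, 'k) tensors set
     \<Rightarrow> (('v, 'a, 'k) tensors \<Rightarrow> (('v, 'a) qpath \<Rightarrow>\<^sub>0 'k)) \<Rightarrow> bool" where
  "bimod_map Q I M f \<longleftrightarrow>
     (\<forall>x\<in>M. f x \<in> carrier (alg Q I)) \<and>
     (\<forall>x\<in>M. \<forall>y\<in>M. f (x + y) = f x + f y) \<and>
     (\<forall>c. \<forall>x\<in>M. f (scale c x) = scale c (f x)) \<and>
     (\<forall>a\<in>carrier (alg Q I). \<forall>x\<in>M. \<forall>b\<in>carrier (alg Q I).
        f (act Q I a x b) = a \<otimes>\<^bsub>alg Q I\<^esub> f x \<otimes>\<^bsub>alg Q I\<^esub> b)"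


section \<open>Bardzell's resolution and the comparison maps\<close>

text \<open>
  \<open>d\<^sub>n(1 \<otimes> w \<otimes> 1)\<close> for \<open>n \<ge> 1\<close>.  For odd \<open>n \<ge> 3\<close> the prefix \<open>\<psi>\<^sub>1\<close> and the suffix \<open>\<psi>\<^sub>2\<close> in
  \<open>Sub(w)\<close> are \<open>(0, j\<^sub>1)\<close> and \<open>(i\<^sub>2, plen w)\<close>.
\<close>

definition diff_gen ::
  "('v, 'a) pre_digraph \<Rightarrow> (('v, 'a) qpath \<Rightarrow>\<^sub>0 'k::field) set \<Rightarrow> nat \<Rightarrow> ('v, 'a) qpath
     \<Rightarrow> ('v, 'a, 'k) tensors" where
  "diff_gen Q I n w =
     (if n = 1 then
        path_tensor Q I w (triv (ptgt Q w)) (triv (ptgt Q w))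
        - path_tensor Q I (triv (psrc w)) (triv (psrc w)) w
      else if even n then
        (\<Sum>(i, j)\<in>Sub Q I n w. path_tensor Q I (seg Q w 0 i) (seg Q w i j) (seg Q w j (plen w)))
      else
        (let j\<^sub>1 = (THE j. (0, j) \<in> Sub Q I n w);
             i\<^sub>2 = (THE i. (i, plen w) \<in> Sub Q I n w)
         in path_tensor Q I (seg Q w 0 i\<^sub>2) (seg Q w i\<^sub>2 (plen w)) (triv (ptgt Q w))
            - path_tensor Q I (triv (psrc w)) (seg Q w 0 j\<^sub>1) (seg Q w j\<^sub>1 (plen w))))"

definition diff ::
  "('v, 'a) pre_digraph \<Rightarrow> (('v, 'a) qpath \<Rightarrow>\<^sub>0 'k::field) set \<Rightarrow> nat
     \<Rightarrow> ('v, 'a, 'k) tensors \<Rightarrow> ('v, 'a, 'k) tensors" where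
  "diff Q I n = bimod_ext Q I (\<lambda>ws. diff_gen Q I n (hd ws))"

text \<open>The cocycles of degree \<open>n\<close> of \<open>Hom\<^bsub>A\<^sup>e\<^esub>(\<bbbA>pA, A)\<close>; they represent the elements of \<open>HH\<^sup>n(A)\<close>.\<close>

definition cocycle ::
  "('v, 'a) pre_digraph \<Rightarrow> (('v, 'a) qpath \<Rightarrow>\<^sub>0 'k::field) set \<Rightarrow> nat
     \<Rightarrow> (('v, 'a, 'k) tensors \<Rightarrow> (('v, 'a) qpath \<Rightarrow>\<^sub>0 'k)) \<Rightarrow> bool" where
  "cocycle Q I n f \<longleftrightarrow>
     bimod_map Q I (bardzell Q I n) f \<and>
     (\<forall>x \<in> bardzell Q I (Suc n). f (diff Q I (Suc n) x) = 0)"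

text \<open>
  \<open>F\<^sub>n(1 \<otimes> w \<otimes> 1)\<close>.  Distinct elements of \<open>Sub(w)\<close> start at distinct positions, so the sum over
  \<open>\<zeta>\<^sub>2, \<dots>, \<zeta>\<^sub>l\<close> is the sum over the elements that do not start first.
\<close>

fun F_gen ::
  "('v, 'a) pre_digraph \<Rightarrow> (('v, 'a) qpath \<Rightarrow>\<^sub>0 'k::field) set \<Rightarrow> nat \<Rightarrow> ('v, 'a) qpath
     \<Rightarrow> ('v, 'a, 'k) tensors" where
  "F_gen Q I 0 e = Poly_Mapping.single [e, e] 1"
| "F_gen Q I (Suc 0) \<alpha> = unit_tensor Q [\<alpha>]"
| "F_gen Q I (Suc (Suc n)) w =
     (\<Sum>(i, j) \<in> {\<zeta> \<in> Sub Q I (Suc (Suc n)) w. \<exists>\<zeta>' \<in> Sub Q I (Suc (Suc n)) w. fst \<zeta>' < fst \<zeta>}.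
        one_otimes (act Q I (cls Q I (seg Q w 0 i))
                            (F_gen Q I (Suc n) (seg Q w i j))
                            (cls Q I (seg Q w j (plen w)))))"

definition F_map ::
  "('v, 'a) pre_digraph \<Rightarrow> (('v, 'a) qpath \<Rightarrow>\<^sub>0 'k::field) set \<Rightarrow> nat
     \<Rightarrow> ('v, 'a, 'k) tensors \<Rightarrow> ('v, 'a, 'k) tensors" where
  "F_map Q I n = bimod_ext Q I (\<lambda>ws. F_gen Q I n (hd ws))"

text \<open>Here \<open>v\<^sub>j\<close> is \<open>vs ! (j - 1)\<close>.\<close>

definition M_odd ::
  "('v, 'a) pre_digraph \<Rightarrow> (('v, 'a) qpath \<Rightarrow>\<^sub>0 'k::field) set \<Rightarrow> ('v, 'a) qpath list
     \<Rightarrow> nat set" where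
  "M_odd Q I vs = {j. 1 \<le> j \<and> 2 * j \<le> length vs \<and>
     pmon (pcat (vs ! (2 * j - 2)) (vs ! (2 * j - 1))) \<notin> I}"

definition M_even ::
  "('v, 'a) pre_digraph \<Rightarrow> (('v, 'a) qpath \<Rightarrow>\<^sub>0 'k::field) set \<Rightarrow> ('v, 'a) qpath list
     \<Rightarrow> nat set" where
  "M_even Q I vs = {j. 1 \<le> j \<and> 2 * j + 1 \<le> length vs \<and>
     pmon (pcat (vs ! (2 * j - 1)) (vs ! (2 * j))) \<notin> I}"

definition good ::
  "('v, 'a) pre_digraph \<Rightarrow> (('v, 'a) qpath \<Rightarrow>\<^sub>0 'k::field) set \<Rightarrow> ('v, 'a) qpath list
     \<Rightarrow> bool" where
  "good Q I vs \<longleftrightarrow> (if even (length vs) then M_odd Q I vs = {} else M_even Q I vs = {})"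

definition chi ::
  "('v, 'a) pre_digraph \<Rightarrow> (('v, 'a) qpath \<Rightarrow>\<^sub>0 'k::field) set \<Rightarrow> ('v, 'a) qpath list
     \<Rightarrow> occ set" where
  "chi Q I vs = occs Q (AP Q I (length vs)) (pconcat vs)"

text \<open>\<open>G\<^sub>n(1 \<otimes> v\<^sub>1 \<otimes> \<dots> \<otimes> v\<^sub>n \<otimes> 1)\<close>.\<close>

definition G_gen ::
  "('v, 'a) pre_digraph \<Rightarrow> (('v, 'a) qpath \<Rightarrow>\<^sub>0 'k::field) set \<Rightarrow> ('v, 'a) qpath list
     \<Rightarrow> ('v, 'a, 'k) tensors" where
  "G_gen Q I vs =
     (let n = length vs; T = pconcat vs;
          LwR = (\<lambda>(i, j). path_tensor Q I (seg Q T 0 i) (seg Q T i j) (seg Q T j (plen T)))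
      in if n = 0 then \<Sum>x\<in>verts Q. path_tensor Q I (triv x) (triv x) (triv x)
         else if n = 1 then \<Sum>i<plen T. LwR (i, Suc i)
         else if \<not> good Q I vs \<or> chi Q I vs = {} then 0
         else if even n then LwR (ARG_MIN fst w. w \<in> chi Q I vs)
         else \<Sum>w \<in> {w \<in> chi Q I vs. fst w < plen (hd vs)}. LwR w)"

definition G_map ::
  "('v, 'a) pre_digraph \<Rightarrow> (('v, 'a) qpath \<Rightarrow>\<^sub>0 'k::field) set
     \<Rightarrow> ('v, 'a, 'k) tensors \<Rightarrow> ('v, 'a, 'k) tensors" where
  "G_map Q I = bimod_ext Q I (G_gen Q I)"


section \<open>The cup product\<close>

definition bar_cup ::
  "('v, 'a) pre_digraph \<Rightarrow> (('v, 'a) qpath \<Rightarrow>\<^sub>0 'k::field) set \<Rightarrow> nat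
     \<Rightarrow> (('v, 'a, 'k) tensors \<Rightarrow> (('v, 'a) qpath \<Rightarrow>\<^sub>0 'k))
     \<Rightarrow> (('v, 'a, 'k) tensors \<Rightarrow> (('v, 'a) qpath \<Rightarrow>\<^sub>0 'k))
     \<Rightarrow> ('v, 'a, 'k) tensors \<Rightarrow> (('v, 'a) qpath \<Rightarrow>\<^sub>0 'k)" where
  "bar_cup Q I n f g x =
     linext (\<lambda>xs. let vs = butlast (tl xs) in
         cls Q I (hd xs) \<otimes>\<^bsub>alg Q I\<^esub>
         (f (unit_tensor Q (take n vs)) \<otimes>\<^bsub>alg Q I\<^esub> g (unit_tensor Q (drop n vs)))
         \<otimes>\<^bsub>alg Q I\<^esub> cls Q I (last xs)) x"

definition cup ::
  "('v, 'a) pre_digraph \<Rightarrow> (('v, 'a) qpath \<Rightarrow>\<^sub>0 'k::field) set \<Rightarrow> nat \<Rightarrow> nat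
     \<Rightarrow> (('v, 'a, 'k) tensors \<Rightarrow> (('v, 'a) qpath \<Rightarrow>\<^sub>0 'k))
     \<Rightarrow> (('v, 'a, 'k) tensors \<Rightarrow> (('v, 'a) qpath \<Rightarrow>\<^sub>0 'k))
     \<Rightarrow> ('v, 'a, 'k) tensors \<Rightarrow> (('v, 'a) qpath \<Rightarrow>\<^sub>0 'k)" where
  "cup Q I n m f g = bar_cup Q I n (f \<circ> G_map Q I) (g \<circ> G_map Q I) \<circ> F_map Q I (n + m)"

end

theory Submission
  imports Defs
begin

text \<open>
  Put \<open>N = 2n + 2m\<close> and count positions along \<open>w\<close>.  Unfolding its recursion, \<open>F\<^sub>N(1 \<otimes> w \<otimes> 1)\<close> is a
  sum over descending sequences \<open>w = \<zeta>\<^sub>N, \<zeta>\<^sub>N\<^sub>-\<^sub>1, \<dots>, \<zeta>\<^sub>1\<close>, where \<open>\<zeta>\<^sub>k \<in> AP\<^sub>k\<close> lies in \<open>\<zeta>\<^sub>k\<^sub>+\<^sub>1\<close> and is not the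
  first such subpath.  Its summand is \<open>1 \<otimes> v\<^sub>1 \<otimes> \<dots> \<otimes> v\<^sub>N \<otimes> R\<close>, where \<open>v\<^sub>1, \<dots>, v\<^sub>N\<^sub>-\<^sub>1\<close> lead from the
  start of each \<open>\<zeta>\<close> to the start of the next one, \<open>v\<^sub>N\<close> is the arrow \<open>\<zeta>\<^sub>1\<close>, and \<open>R\<close> is the rest of \<open>w\<close>.

  The maps \<open>G\<close> in even degree vanish unless \<open>v\<^sub>1v\<^sub>2, v\<^sub>3v\<^sub>4, \<dots>\<close> all lie in \<open>I\<close>, and this leaves a single
  summand.  Indeed, if \<open>v\<^sub>1v\<^sub>2 \<in> I\<close>, then some relation of \<open>w\<close> ends no later than \<open>\<zeta>\<^sub>N\<^sub>-\<^sub>2\<close> starts.  As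
  concatenations are chosen greedily, the last relation of \<open>\<zeta>\<^sub>N\<^sub>-\<^sub>2\<close> then cannot come before the last
  relation of \<open>w\<close>, so \<open>\<zeta>\<^sub>N\<^sub>-\<^sub>2\<close> and \<open>\<zeta>\<^sub>N\<^sub>-\<^sub>1\<close> end where \<open>w\<close> ends (\<open>AP_end_if_skips_relation\<close>).  An element of
  \<open>AP\<^sub>k\<close> is determined by its end (\<open>AP_end_unique\<close>), so these two are the suffixes
  \<open>w\<^sup>o\<^sup>p(q\<^sup>3, \<dots>, q\<^sup>N\<^sup>-\<^sup>1)\<close> and \<open>w\<^sup>o\<^sup>p(q\<^sup>2, \<dots>, q\<^sup>N\<^sup>-\<^sup>1)\<close> of \<open>w\<close>.  Repeating this two steps at a time
  leads to \<open>\<zeta>\<^sub>2 = q\<^sup>N\<^sup>-\<^sup>1\<close>, of which only the last arrow can follow.  So \<open>R\<close> is trivial, and \<open>w\<close> is cut at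
  the starts of the \<open>q\<^sup>j\<close> and in front of its last arrow (\<open>F_gen_even\<close>).

  For this summand, \<open>v\<^sub>1\<cdots>v\<^sub>2\<^sub>n\<close> is the part of \<open>w\<close> in front of \<open>v = w\<^sup>o\<^sup>p(q\<^sup>2\<^sup>n\<^sup>+\<^sup>1, \<dots>, q\<^sup>N\<^sup>-\<^sup>1)\<close>, and the
  other pieces make up \<open>v\<close>.  The first element of \<open>AP\<^sub>2\<^sub>n\<close> in the former is \<open>u = w(p\<^sub>1, \<dots>, p\<^sub>2\<^sub>n\<^sub>-\<^sub>1)\<close>, and the
  first element of \<open>AP\<^sub>2\<^sub>m\<close> in the latter is \<open>v\<close> itself.  Hence \<open>G\<close> yields \<open>1 \<otimes> u \<otimes> a\<close> and
  \<open>1 \<otimes> v \<otimes> 1\<close>, and the cup product is \<open>f(u) a g(v)\<close>.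

  The description of suffixes by op-concatenations rests on the duality \<open>AP\<^sub>n = AP\<^sub>n\<^sup>o\<^sup>p\<close> in a sharp
  form (\<open>op_chain\<close>): the two sequences of relations with the same support interlace, \<open>p\<^sub>i \<le> q\<^sup>i < p\<^sub>i\<^sub>+\<^sub>1\<close>.  This also shows that
  \<open>u\<close> ends no later than \<open>v\<close> starts, as \<open>t(p\<^sub>2\<^sub>n\<^sub>-\<^sub>1) \<le> s(p\<^sub>2\<^sub>n\<^sub>+\<^sub>1) \<le> s(q\<^sup>2\<^sup>n\<^sup>+\<^sup>1)\<close>.
\<close>

section \<open>Greedy chains in an antichain of intervals\<close>

text \<open>
  The combinatorics of concatenations concerns only the starts \<open>s\<close> and ends \<open>t\<close> of relations.  They
  take values in the integers so that reading a path backwards amounts to replacing \<open>(s, t)\<close> by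
  \<open>(-t, -s)\<close>: an op-concatenation is then a greedy chain as well, and every fact about greedy chains
  has its mirror image.
\<close>

definition candidates :: "'b set \<Rightarrow> ('b \<Rightarrow> int) \<Rightarrow> ('b \<Rightarrow> int) \<Rightarrow> 'b list \<Rightarrow> nat \<Rightarrow> 'b set" where
  "candidates R s t ps k =
     {p \<in> R. (if k = 0 then s (ps ! 0) < s p else t (ps ! (k - 1)) \<le> s p) \<and> s p < t (ps ! k)}"

definition greedy_chain :: "'b set \<Rightarrow> ('b \<Rightarrow> int) \<Rightarrow> ('b \<Rightarrow> int) \<Rightarrow> 'b list \<Rightarrow> bool" where
  "greedy_chain R s t ps \<longleftrightarrow> ps \<noteq> [] \<and> ps ! 0 \<in> R \<and>
     (\<forall>k. Suc k < length ps \<longrightarrow>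
        ps ! Suc k \<in> candidates R s t ps k \<and> (\<forall>p \<in> candidates R s t ps k. s (ps ! Suc k) \<le> s p))"

lemma chain_start: "greedy_chain R s t ps \<Longrightarrow> ps ! 0 \<in> R"
  by (simp add: greedy_chain_def)

lemma chain_succ: "greedy_chain R s t ps \<Longrightarrow> Suc k < length ps \<Longrightarrow> ps ! Suc k \<in> candidates R s t ps k"
  by (simp add: greedy_chain_def)

lemma chain_first:
  "greedy_chain R s t ps \<Longrightarrow> Suc k < length ps \<Longrightarrow> p \<in> candidates R s t ps k \<Longrightarrow> s (ps ! Suc k) \<le> s p"
  by (simp add: greedy_chain_def)

locale interval_antichain =
  fixes R :: "'b set" and s t :: "'b \<Rightarrow> int"
  assumes finite_R: "finite R"
    and nonempty: "p \<in> R \<Longrightarrow> s p < t p"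
    and not_nested: "p \<in> R \<Longrightarrow> q \<in> R \<Longrightarrow> s p \<le> s q \<Longrightarrow> t q \<le> t p \<Longrightarrow> p = q"
begin

lemma dual: "interval_antichain R (\<lambda>p. - t p) (\<lambda>p. - s p)"
proof
  show "p = q" if "p \<in> R" "q \<in> R" "- t p \<le> - t q" "- s q \<le> - s p" for p q
    using not_nested[of p q] that by auto
qed (use finite_R nonempty in auto)

lemma end_less_iff: "p \<in> R \<Longrightarrow> q \<in> R \<Longrightarrow> t p < t q \<longleftrightarrow> s p < s q"
  using not_nested[of p q] not_nested[of q p] by force

lemma end_le_iff: "p \<in> R \<Longrightarrow> q \<in> R \<Longrightarrow> t p \<le> t q \<longleftrightarrow> s p \<le> s q"
  using end_less_iff[of q p] by linarith

lemma start_inj: "p \<in> R \<Longrightarrow> q \<in> R \<Longrightarrow> s p = s q \<Longrightarrow> p = q"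
  using end_le_iff[of q p] not_nested[of p q] by simp

context
  fixes ps assumes ps: "greedy_chain R s t ps"
begin

lemma chain_in: "k < length ps \<Longrightarrow> ps ! k \<in> R"
  using ps by (cases k) (auto simp: greedy_chain_def candidates_def)

lemma chain_overlap: "Suc k < length ps \<Longrightarrow> s (ps ! Suc k) < t (ps ! k)"
  using ps by (auto simp: greedy_chain_def candidates_def)

lemma chain_skip: "Suc (Suc k) < length ps \<Longrightarrow> t (ps ! k) \<le> s (ps ! Suc (Suc k))"
  using ps by (auto simp: greedy_chain_def candidates_def dest!: spec[of _ "Suc k"])

lemma chain_second_first: "Suc 0 < length ps \<Longrightarrow> p \<in> R \<Longrightarrow> s (ps ! 0) < s p \<Longrightarrow> s p < t (ps ! 0)
    \<Longrightarrow> s (ps ! Suc 0) \<le> s p"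
  using ps by (auto simp: greedy_chain_def candidates_def dest!: spec[of _ "0"])

text \<open>
  Only candidates that start before \<open>t (ps ! Suc k)\<close> compete for the place \<open>k + 2\<close>, but those that start
  later come after the chosen one anyway.
\<close>

lemma chain_next_first:
  assumes "Suc (Suc k) < length ps" "p \<in> R" "t (ps ! k) \<le> s p"
  shows "s (ps ! Suc (Suc k)) \<le> s p"
proof (cases "s p < t (ps ! Suc k)")
  case True
  then show ?thesis
    using ps assms by (auto simp: greedy_chain_def candidates_def dest!: spec[of _ "Suc k"])
next
  case False
  then show ?thesis using chain_overlap[of "Suc k"] assms by simp
qed

lemma chain_step: "Suc k < length ps \<Longrightarrow> s (ps ! k) < s (ps ! Suc k)"
proof (cases k)
  case 0
  assume "Suc k < length ps"
  with 0 show ?thesis using ps by (auto simp: greedy_chain_def candidates_def)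
next
  case (Suc k')
  assume "Suc k < length ps"
  then show ?thesis using Suc chain_skip[of k'] chain_overlap[of k'] by simp
qed

lemma chain_mono: "i \<le> j \<Longrightarrow> j < length ps \<Longrightarrow> s (ps ! i) \<le> s (ps ! j)"
  by (induction j rule: dec_induct) (use chain_step in force)+

lemma chain_mono_end: "i \<le> j \<Longrightarrow> j < length ps \<Longrightarrow> t (ps ! i) \<le> t (ps ! j)"
  using chain_mono[of i j] end_le_iff chain_in by simp

lemma chain_take:
  assumes "0 < k"
  shows "greedy_chain R s t (take k ps)"
  using ps assms by (auto simp: greedy_chain_def candidates_def)

lemma chain_unique:
  assumes qs: "greedy_chain R s t qs" and len: "length qs = length ps" and start: "s (qs ! 0) = s (ps ! 0)"
  shows "qs = ps"
proof -
  have "k < length ps \<Longrightarrow> \<forall>i\<le>k. qs ! i = ps ! i" for k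
  proof (induction k)
    case 0
    then show ?case using start_inj[of "qs ! 0" "ps ! 0"] start ps qs by (simp add: greedy_chain_def)
  next
    case (Suc k)
    then have IH: "\<forall>i\<le>k. qs ! i = ps ! i" by simp
    then have "candidates R s t qs k = candidates R s t ps k"
      by (simp add: candidates_def)
    moreover have "rs ! Suc k \<in> candidates R s t rs k \<and> (\<forall>p\<in>candidates R s t rs k. s (rs ! Suc k) \<le> s p)"
      if "rs = ps \<or> rs = qs" for rs
      using ps qs Suc.prems len that by (auto simp: greedy_chain_def)
    note first = this[of ps] this[of qs]
    ultimately have "s (qs ! Suc k) \<le> s (ps ! Suc k)" "s (ps ! Suc k) \<le> s (qs ! Suc k)"
      by simp_all
    moreover have "ps ! Suc k \<in> R" "qs ! Suc k \<in> R"
      using first by (auto simp: candidates_def)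
    ultimately have "qs ! Suc k = ps ! Suc k" by (intro start_inj) simp_all
    then show ?case using IH by (auto simp: le_Suc_eq)
  qed
  then show ?thesis using len by (intro nth_equalityI) auto
qed

text \<open>
  Two steps lead a chain past the end of the interval where they begin, and to the first interval there.
  So if \<open>qs\<close> starts behind \<open>ps ! 0\<close> and both advance in double steps, \<open>qs\<close> stays at or behind the interval
  of \<open>ps\<close> two places further on.  At the places in between there need not be such a comparison, so it is
  \<open>AP\<^sub>n\<close> and \<open>AP\<^sub>n\<^sub>+\<^sub>2\<close> for even \<open>n\<close> that can be compared.
\<close>

lemma chain_interleave:
  assumes qs: "greedy_chain R s t qs" and len: "length ps = length qs + 2"
    and start: "t (ps ! 0) \<le> s (qs ! 0)"
    and "even i" "i < length qs"
  shows "s (ps ! (i + 2)) \<le> s (qs ! i)"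
proof -
  have "2 * k < length qs \<Longrightarrow> s (ps ! (2 * k + 2)) \<le> s (qs ! (2 * k))" for k
  proof (induction k)
    case 0
    then show ?case using chain_next_first[of 0 "qs ! 0"] start qs len
      by (simp add: greedy_chain_def)
  next
    case (Suc k)
    have in_R: "qs ! (2 * k) \<in> R" "qs ! (2 * k + 2) \<in> R" "ps ! (2 * k + 2) \<in> R"
      using Suc.prems len chain_in[of "2 * k + 2"]
        interval_antichain.chain_in[OF interval_antichain_axioms qs] by auto
    have "t (ps ! (2 * k + 2)) \<le> t (qs ! (2 * k))"
      using Suc in_R by (simp add: end_le_iff)
    also have "\<dots> \<le> s (qs ! (2 * k + 2))"
      using interval_antichain.chain_skip[OF interval_antichain_axioms qs, of "2 * k"] Suc.prems
      by simp
    finally show ?case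
      using chain_next_first[of "2 * k + 2" "qs ! (2 * k + 2)"] in_R Suc.prems len by simp
  qed
  from this[of "i div 2"] show ?thesis using assms by simp
qed

lemma chain_gap:
  assumes "Suc (Suc k) < length ps" "q \<in> R" "s q < s (ps ! Suc (Suc k))"
  shows "s q < t (ps ! k)"
  using chain_next_first[of k q] assms by force

text \<open>
  The mirrored chain is built from the last interval backwards.  Write \<open>p\<^sub>i\<close> for the given chain and
  \<open>q\<^sup>i\<close> for the new one.  The invariant \<open>p\<^sub>i \<le> q\<^sup>i < p\<^sub>i\<^sub>+\<^sub>1\<close> makes \<open>p\<^sub>i\<^sub>-\<^sub>1\<close> a candidate for the next place: its
  end is at most \<open>s(p\<^sub>i\<^sub>+\<^sub>1) \<le> s(q\<^sup>i\<^sup>+\<^sup>1)\<close>, and \<open>s(q\<^sup>i) < t(p\<^sub>i\<^sub>-\<^sub>1)\<close>, since otherwise \<open>q\<^sup>i\<close> would have been chosen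
  instead of \<open>p\<^sub>i\<^sub>+\<^sub>1\<close>.
\<close>

lemma op_chain_aux:
  "0 < j \<Longrightarrow> j \<le> length ps \<Longrightarrow> \<exists>rs. length rs = j \<and> greedy_chain R (\<lambda>p. - t p) (\<lambda>p. - s p) rs \<and>
     rs ! 0 = last ps \<and>
     (\<forall>i<j. s (ps ! (length ps - 1 - i)) \<le> s (rs ! i) \<and>
            (0 < i \<longrightarrow> s (rs ! i) < s (ps ! (length ps - i))))"
proof (induction j rule: nat_induct_non_zero)
  case 1
  have "last ps \<in> R" "ps \<noteq> []"
    using chain_in[of "length ps - 1"] ps by (auto simp: greedy_chain_def last_conv_nth)
  then show ?case
    by (intro exI[of _ "[last ps]"]) (simp add: greedy_chain_def last_conv_nth)
next
  case (Suc j)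
  then obtain rs where rs: "length rs = j" "greedy_chain R (\<lambda>p. - t p) (\<lambda>p. - s p) rs"
    "rs ! 0 = last ps"
    and lower: "\<And>i. i < j \<Longrightarrow> s (ps ! (length ps - 1 - i)) \<le> s (rs ! i)"
    and upper: "\<And>i. i < j \<Longrightarrow> 0 < i \<Longrightarrow> s (rs ! i) < s (ps ! (length ps - i))"
    by auto
  \<comment> \<open>the index of the interval of \<open>ps\<close> to which the new one is compared\<close>
  define l where "l = length ps - 1 - j"
  have l: "length ps = l + j + 1" "0 < j" using Suc by (auto simp: l_def)
  have rs_in: "i < j \<Longrightarrow> rs ! i \<in> R" for i
    using interval_antichain.chain_in[OF dual rs(2)] rs(1) by simp
  have near: "s (rs ! (j - 1)) < t (ps ! l)"
  proof (cases "j = 1")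
    case True
    then show ?thesis using rs(3) l chain_overlap[of l] ps by (simp add: greedy_chain_def last_conv_nth)
  next
    case False
    then show ?thesis using chain_gap[of l "rs ! (j - 1)"] upper[of "j - 1"] rs_in[of "j - 1"] l by simp
  qed
  let ?C = "candidates R (\<lambda>p. - t p) (\<lambda>p. - s p) rs (j - 1)"
  have cand: "ps ! l \<in> ?C"
  proof (cases "j = 1")
    case True
    then show ?thesis using near rs(3) l chain_in[of l] chain_in[of "Suc l"] chain_step[of l] ps
      end_less_iff[of "ps ! l" "ps ! Suc l"]
      by (simp add: greedy_chain_def last_conv_nth candidates_def)
  next
    case False
    have "length ps - 1 - (j - 2) = Suc (Suc l)" using l False by simp
    then have "t (ps ! l) \<le> s (rs ! (j - 2))"
      using chain_skip[of l] lower[of "j - 2"] l False by (simp add: numeral_2_eq_2)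
    then show ?thesis using near False l chain_in[of l]
      by (simp add: candidates_def numeral_2_eq_2)
  qed
  have "finite ?C" using finite_R by (simp add: candidates_def)
  then obtain q where q: "q \<in> ?C" "\<And>p. p \<in> ?C \<Longrightarrow> - t q \<le> - t p"
    using cand arg_min_if_finite[of ?C "\<lambda>p. - t p"]
    by (metis arg_min_least empty_iff)
  have q_in: "q \<in> R" using q(1) by (simp add: candidates_def)
  have "s (ps ! l) \<le> s q"
    using q(2)[OF cand] end_le_iff[of "ps ! l" q] q_in chain_in[of l] l by simp
  have "s q < s (ps ! Suc l)"
  proof -
    have "t q < t (ps ! Suc l)"
    proof (cases "j = 1")
      case True
      then show ?thesis using q(1) rs(3) l ps by (simp add: candidates_def greedy_chain_def last_conv_nth)
    next
      case False
      then have "t q \<le> s (rs ! (j - 2))" using q(1) l by (simp add: candidates_def numeral_2_eq_2)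
      also have "\<dots> < t (ps ! Suc l)"
      proof (cases "j = 2")
        case True
        then show ?thesis using rs(3) l chain_overlap[of "Suc l"] ps
          by (simp add: greedy_chain_def last_conv_nth numeral_2_eq_2)
      next
        case j: False
        have "length ps - (j - 2) = Suc (Suc (Suc l))" using l False j by simp
        then show ?thesis
          using chain_gap[of "Suc l" "rs ! (j - 2)"] upper[of "j - 2"] rs_in[of "j - 2"] l False j
          by (simp add: numeral_3_eq_3)
      qed
      finally show ?thesis .
    qed
    then show ?thesis using end_less_iff[of q "ps ! Suc l"] q_in chain_in[of "Suc l"] l by simp
  qed
  have new_chain: "greedy_chain R (\<lambda>p. - t p) (\<lambda>p. - s p) (rs @ [q])"
    unfolding greedy_chain_def
  proof (intro conjI allI impI)
    fix k assume "Suc k < length (rs @ [q])"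
    then consider "Suc k < j" | "Suc k = j" using rs(1) by fastforce
    then have "(rs @ [q]) ! Suc k \<in> candidates R (\<lambda>p. - t p) (\<lambda>p. - s p) rs k \<and>
       (\<forall>p\<in>candidates R (\<lambda>p. - t p) (\<lambda>p. - s p) rs k. - t ((rs @ [q]) ! Suc k) \<le> - t p)"
    proof cases
      case 2
      then have "k = j - 1" by simp
      then show ?thesis using rs(1) q 2 by auto
    qed (use rs(1,2) in \<open>auto simp: nth_append greedy_chain_def\<close>)
    moreover have "candidates R (\<lambda>p. - t p) (\<lambda>p. - s p) (rs @ [q]) k = candidates R (\<lambda>p. - t p) (\<lambda>p. - s p) rs k"
    proof -
      have "(rs @ [q]) ! k = rs ! k" "(rs @ [q]) ! (k - 1) = rs ! (k - 1)" "(rs @ [q]) ! 0 = rs ! 0"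
        using rs(1) l \<open>Suc k < length (rs @ [q])\<close> by (auto simp: nth_append)
      then show ?thesis by (simp only: candidates_def)
    qed
    ultimately show "(rs @ [q]) ! Suc k \<in> candidates R (\<lambda>p. - t p) (\<lambda>p. - s p) (rs @ [q]) k"
      "\<forall>p\<in>candidates R (\<lambda>p. - t p) (\<lambda>p. - s p) (rs @ [q]) k. - t ((rs @ [q]) ! Suc k) \<le> - t p"
      by auto
  next
    show "rs @ [q] \<noteq> []" "(rs @ [q]) ! 0 \<in> R" using rs(1) l rs_in[of 0] by (simp_all add: nth_append)
  qed
  have bounds: "s (ps ! (length ps - 1 - i)) \<le> s ((rs @ [q]) ! i) \<and>
      (0 < i \<longrightarrow> s ((rs @ [q]) ! i) < s (ps ! (length ps - i)))" if "i < Suc j" for i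
  proof (cases "i = j")
    case True
    have "length ps - 1 - j = l" "length ps - j = Suc l" using l by auto
    with True show ?thesis
      using \<open>s (ps ! l) \<le> s q\<close> \<open>s q < s (ps ! Suc l)\<close> rs(1) by (simp add: nth_append)
  next
    case False
    with that have "i < j" by simp
    with lower[OF this] upper[OF this] rs(1) show ?thesis by (simp add: nth_append)
  qed
  show ?case
  proof (intro exI[of _ "rs @ [q]"] conjI[OF _ conjI[OF _ conjI]])
    show "(rs @ [q]) ! 0 = last ps"
      using rs(1,3) l(2) nth_append_left[of 0 rs "[q]"] by simp
    show "length (rs @ [q]) = Suc j" using rs(1) by simp
    show "greedy_chain R (\<lambda>p. - t p) (\<lambda>p. - s p) (rs @ [q])" by (rule new_chain)
    show "\<forall>i<Suc j. s (ps ! (length ps - 1 - i)) \<le> s ((rs @ [q]) ! i) \<and>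
      (0 < i \<longrightarrow> s ((rs @ [q]) ! i) < s (ps ! (length ps - i)))"
      by (intro allI impI bounds)
  qed
qed

text \<open>
  At the first place the interlacing is an equality: an interval after \<open>p\<^sub>1\<close> and before \<open>p\<^sub>2\<close> would contradict
  the choice of \<open>p\<^sub>2\<close>.  So a chain and its mirrored chain span the same stretch.
\<close>

lemma op_chain:
  obtains rs where "length rs = length ps" "greedy_chain R (\<lambda>p. - t p) (\<lambda>p. - s p) rs"
    "hd rs = last ps" "last rs = hd ps"
    "\<And>i. i < length ps \<Longrightarrow> s (ps ! i) \<le> s (rev rs ! i)"
proof -
  have pos: "0 < length ps" using ps by (simp add: greedy_chain_def)
  from op_chain_aux[OF this order_refl] obtain rs where
    rs: "length rs = length ps" "greedy_chain R (\<lambda>p. - t p) (\<lambda>p. - s p) rs" "rs ! 0 = last ps"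
    and lower: "\<And>i. i < length ps \<Longrightarrow> s (ps ! (length ps - 1 - i)) \<le> s (rs ! i)"
    and upper: "\<And>i. i < length ps \<Longrightarrow> 0 < i \<Longrightarrow> s (rs ! i) < s (ps ! (length ps - i))"
    by auto
  have "rs ! (length ps - 1) = ps ! 0"
  proof (cases "length ps = 1")
    case True
    then have "last ps = ps ! 0" by (cases ps) auto
    then show ?thesis using rs(3) True by simp
  next
    case False
    let ?q = "rs ! (length ps - 1)"
    have two: "1 < length ps" using pos False by linarith
    have len: "length ps - (length ps - 1) = 1" using pos by linarith
    have q: "?q \<in> R" "s (ps ! 0) \<le> s ?q" "s ?q < s (ps ! 1)"
      using interval_antichain.chain_in[OF dual rs(2), of "length ps - 1"] rs(1) pos two
        lower[of "length ps - 1"] upper[of "length ps - 1"] unfolding len by auto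
    then have "s ?q = s (ps ! 0)"
      using chain_second_first[of ?q] chain_overlap[of 0] two by (cases "s (ps ! 0) < s ?q") simp_all
    then show ?thesis using start_inj q(1) chain_in[OF pos] by simp
  qed
  moreover have "s (ps ! i) \<le> s (rev rs ! i)" if "i < length ps" for i
    using lower[of "length ps - 1 - i"] that rs(1) by (simp add: rev_nth)
  moreover have "hd rs = rs ! 0" "last rs = rs ! (length ps - 1)" "hd ps = ps ! 0"
    using rs(1) pos by (simp_all add: hd_conv_nth last_conv_nth flip: length_greater_0_conv)
  ultimately show ?thesis
    using that[of rs] rs(1-3) by simp
qed

end

text \<open>
  Restricting to the intervals inside a window (and shifting positions) does not change which chains
  there are: the chosen interval starts first, hence ends first in an antichain, so intervals that
  stick out of the window never beat it.
\<close>

lemma chain_window: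
  assumes img: "h ` R1 = {p \<in> R. lo \<le> s p \<and> t p \<le> hi}"
    and s: "\<And>p. s (h p) = s1 p + c" and t: "\<And>p. t (h p) = t1 p + c"
  shows chain_from_window: "greedy_chain R1 s1 t1 ps \<Longrightarrow> greedy_chain R s t (map h ps)"
    and chain_to_window: "greedy_chain R s t qs \<Longrightarrow> lo \<le> s (hd qs) \<Longrightarrow> t (last qs) \<le> hi \<Longrightarrow>
      \<exists>ps. greedy_chain R1 s1 t1 ps \<and> qs = map h ps"
proof -
  have h_in: "h p \<in> R \<and> lo \<le> s (h p) \<and> t (h p) \<le> hi" if "p \<in> R1" for p
    using img that by blast
  have candidates_h: "p \<in> candidates R1 s1 t1 ps k \<longleftrightarrow> p \<in> R1 \<and> h p \<in> candidates R s t (map h ps) k"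
    if "k < length ps" for k p ps
  proof -
    have "map h ps ! k = h (ps ! k)" "map h ps ! 0 = h (ps ! 0)" "map h ps ! (k - 1) = h (ps ! (k - 1))"
      using that by (auto intro!: nth_map)
    then show ?thesis using h_in[of p] by (auto simp: candidates_def s t)
  qed
  show "greedy_chain R s t (map h ps)" if ps: "greedy_chain R1 s1 t1 ps"
    unfolding greedy_chain_def
  proof (intro conjI allI impI ballI)
    show "map h ps \<noteq> []" "map h ps ! 0 \<in> R"
      using ps h_in[of "ps ! 0"] by (simp_all add: greedy_chain_def)
    have ps_in: "ps ! k \<in> R1" if "k < length ps" for k
      using chain_start[OF ps] chain_succ[OF ps, of "k - 1"] that
      by (cases k) (simp_all add: candidates_def)
    fix k assume "Suc k < length (map h ps)"
    then have k: "Suc k < length ps" by simp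
    show "map h ps ! Suc k \<in> candidates R s t (map h ps) k"
      using chain_succ[OF ps k] candidates_h[of k ps] k by simp
    fix p assume p: "p \<in> candidates R s t (map h ps) k"
    then have p_in: "p \<in> R" by (simp add: candidates_def)
    show "s (map h ps ! Suc k) \<le> s p"
    proof (rule ccontr)
      assume "\<not> ?thesis"
      then have neg: "s p < s (h (ps ! Suc k))" using k by simp
      have pos: "0 < length ps" using k by linarith
      have "lo \<le> s p"
      proof (cases k)
        case 0
        then have "s (h (ps ! 0)) < s p" using p nth_map[OF pos, of h] by (simp add: candidates_def)
        then show ?thesis using h_in[OF ps_in[OF pos]] by simp
      next
        case (Suc k')
        then have "t (h (ps ! k')) \<le> s p" using p k by (simp add: candidates_def)
        then show ?thesis
          using nonempty[of "h (ps ! k')"] h_in[OF ps_in, of k'] k Suc by simp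
      qed
      moreover have "t p \<le> hi"
        using neg h_in[OF ps_in[OF k]] end_less_iff[OF p_in, of "h (ps ! Suc k)"] by simp
      ultimately obtain p1 where p1: "p1 \<in> R1" "p = h p1"
        using p_in img by blast
      then have "p1 \<in> candidates R1 s1 t1 ps k"
        using p candidates_h[of k ps p1] k by simp
      then show False
        using neg chain_first[OF ps k] p1(2) by (force simp: s)
    qed
  qed
  show "\<exists>ps. greedy_chain R1 s1 t1 ps \<and> qs = map h ps"
    if qs: "greedy_chain R s t qs" and lo: "lo \<le> s (hd qs)" and hi: "t (last qs) \<le> hi"
  proof -
    have ne: "qs \<noteq> []" using qs by (simp add: greedy_chain_def)
    have win: "qs ! k \<in> h ` R1" if "k < length qs" for k
    proof -
      have "k \<le> length qs - 1" "length qs - 1 < length qs" using that by auto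
      then have "t (qs ! k) \<le> t (last qs)"
        using chain_mono_end[OF qs] ne by (simp add: last_conv_nth)
      then show ?thesis
        using chain_in[OF qs that] chain_mono[OF qs _ that, of 0] lo hi ne
        unfolding img by (simp add: hd_conv_nth)
    qed
    define ps where "ps = map (inv_into R1 h) qs"
    have len: "length ps = length qs" by (simp add: ps_def)
    have nth: "ps ! k \<in> R1" "h (ps ! k) = qs ! k" if "k < length qs" for k
      using inv_into_into[OF win[OF that]] f_inv_into_f[OF win[OF that]] that
      by (simp_all add: ps_def)
    have map: "map h ps = qs" using nth(2) len by (intro nth_equalityI) simp_all
    have "greedy_chain R1 s1 t1 ps"
      unfolding greedy_chain_def
    proof (intro conjI allI impI ballI)
      show "ps \<noteq> []" "ps ! 0 \<in> R1" using nth(1)[of 0] ne len by auto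
      fix k assume k: "Suc k < length ps"
      then have k': "Suc k < length qs" "k < length ps" using len by simp_all
      show "ps ! Suc k \<in> candidates R1 s1 t1 ps k"
        using chain_succ[OF qs k'(1)] candidates_h[OF k'(2)] nth[OF k'(1)] map by simp
      fix p assume "p \<in> candidates R1 s1 t1 ps k"
      then have "s (qs ! Suc k) \<le> s (h p)"
        using chain_first[OF qs k'(1)] candidates_h[OF k'(2)] map by simp
      then show "s1 (ps ! Suc k) \<le> s1 p" using nth(2)[OF k'(1)] s by (metis add_le_cancel_right)
    qed
    then show ?thesis using map by blast
  qed
qed

end

section \<open>Subpaths\<close>

abbreviation vert :: "('v, 'a) pre_digraph \<Rightarrow> ('v, 'a) qpath \<Rightarrow> nat \<Rightarrow> 'v" where
  "vert Q T i \<equiv> ptgt Q (fst T, take i (snd T))"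

lemma ptgt_triv [simp]: "ptgt Q (triv x) = x"
  by (simp add: ptgt_def pre_digraph.awalk_verts_conv)

lemma vert_append: "ptgt Q (ptgt Q (u, xs), ys) = ptgt Q (u, xs @ ys)"
  using ptgt_pcat[of Q "(u, xs)" "(ptgt Q (u, xs), ys)"] by (simp add: composable_def pcat_def)

lemma psrc_seg [simp]: "psrc (seg Q T i j) = vert Q T i"
  by (simp add: seg_def)

lemma plen_seg: "j \<le> plen T \<Longrightarrow> plen (seg Q T i j) = j - i"
  by (simp add: seg_def)

lemma seg_seg:
  assumes "j \<le> plen T" "a \<le> b" "b \<le> j - i"
  shows "seg Q (seg Q T i j) a b = seg Q T (i + a) (i + b)"
proof -
  have "min (b - a) (j - i - a) = b - a" using assms by auto
  moreover have "take i (snd T) @ take a (take (j - i) (drop i (snd T))) = take (i + a) (snd T)"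
    using assms by (simp add: take_add min_absorb1)
  ultimately show ?thesis
    using assms by (simp add: seg_def vert_append drop_take add.commute)
qed

lemma vert_seg: "j \<le> plen T \<Longrightarrow> a \<le> j - i \<Longrightarrow> vert Q (seg Q T i j) a = vert Q T (i + a)"
  using arg_cong[OF seg_seg[of j T a a i Q], of psrc] by simp

lemma ptgt_seg: "i \<le> j \<Longrightarrow> ptgt Q (seg Q T i j) = vert Q T j"
  using take_add[of i "j - i" "snd T"] by (simp add: seg_def vert_append)

lemma seg_whole [simp]: "seg Q T 0 (plen T) = T"
  by (simp add: seg_def)

lemma seg_empty [simp]: "seg Q T i i = triv (vert Q T i)"
  by (simp add: seg_def)

lemma pcat_seg: "i \<le> j \<Longrightarrow> j \<le> k \<Longrightarrow> pcat (seg Q T i j) (seg Q T j k) = seg Q T i k"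
  using take_add[of "j - i" "k - j" "drop i (snd T)"] by (simp add: seg_def pcat_def)

lemma composable_seg: "i \<le> j \<Longrightarrow> composable Q (seg Q T i j) (seg Q T j k)"
  by (simp add: composable_def ptgt_seg)

lemma pcat_triv_right [simp]: "pcat p (triv x) = p"
  by (simp add: pcat_def)

lemma pcat_triv_left: "x = psrc p \<Longrightarrow> pcat (triv x) p = p"
  by (simp add: pcat_def)

lemma composable_triv [simp]: "composable Q (triv x) p \<longleftrightarrow> x = psrc p" "composable Q p (triv x) \<longleftrightarrow> ptgt Q p = x"
  by (simp_all add: composable_def)

lemma (in wf_digraph) seg_in_paths:
  assumes "T \<in> paths G" "i \<le> j" "j \<le> plen T"
  shows "seg G T i j \<in> paths G"
proof -
  have "take i (snd T) @ take (j - i) (drop i (snd T)) = take j (snd T)"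
    using take_add[of i "j - i" "snd T"] assms by simp
  then have *: "snd T = take i (snd T) @ take (j - i) (drop i (snd T)) @ drop j (snd T)"
    by (metis append_assoc append_take_drop_id)
  have "awalk (fst T) (take i (snd T) @ take (j - i) (drop i (snd T)) @ drop j (snd T)) (ptgt G T)"
    using assms(1) * by (simp add: paths_def)
  then have "awalk (vert G T i) (take (j - i) (drop i (snd T)))
      (awlast (vert G T i) (take (j - i) (drop i (snd T))))"
    by (simp only: awalk_append_iff ptgt_def fst_conv snd_conv)
  then show ?thesis
    by (simp add: paths_def seg_def ptgt_def)
qed

section \<open>Relations in a path\<close>

lemma all_positive_iff: "(\<forall>j. 1 \<le> j \<and> S j \<longrightarrow> P j) \<longleftrightarrow> (\<forall>j. S (Suc j) \<longrightarrow> P (Suc j))"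
proof (intro iffI allI impI)
  show "P j" if "\<forall>j. S (Suc j) \<longrightarrow> P (Suc j)" "1 \<le> j \<and> S j" for j
    using that by (cases j) auto
qed auto

context monomial_algebra
begin

abbreviation R_occs where "R_occs T \<equiv> occs Q (Rels Q I) T"
abbreviation st :: "occ \<Rightarrow> int" where "st p \<equiv> int (fst p)"
abbreviation en :: "occ \<Rightarrow> int" where "en p \<equiv> int (snd p)"

lemma mult_plen:
  fixes x y :: "_ \<Rightarrow>\<^sub>0 'k"
  assumes "x \<in> span_on {p \<in> paths Q. m \<le> plen p}" "y \<in> span_on {p \<in> paths Q. n \<le> plen p}"
  shows "x \<otimes>\<^bsub>path_alg Q\<^esub> y \<in> span_on {p \<in> paths Q. m + n \<le> plen p}"
proof -
  have "(path_mult Q p q :: _ \<Rightarrow>\<^sub>0 'k) \<in> span_on {p \<in> paths Q. m + n \<le> plen p}"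
    if "p \<in> paths Q" "m \<le> plen p" "q \<in> paths Q" "n \<le> plen q" for p q
    using that pcat_in_paths[of p Q q] by (auto simp: path_mult_def pcat_def)
  moreover have "p \<in> paths Q" "k \<le> plen p"
    if "z \<in> span_on {p \<in> paths Q. k \<le> plen p}" "p \<in> Poly_Mapping.keys z" for z :: "_ \<Rightarrow>\<^sub>0 'k" and p k
    using that unfolding span_on_def by blast+
  ultimately show ?thesis
    unfolding path_alg_mult using assms by (intro linext_in_span) blast
qed

lemma span_plen_ideal: "ideal (span_on {p \<in> paths Q. m \<le> plen p}) (path_alg Q :: (_ \<Rightarrow>\<^sub>0 'k) ring)"
proof (rule idealI[OF ring_path_alg])
  let ?K = "span_on {p \<in> paths Q. m \<le> plen p} :: (_ \<Rightarrow>\<^sub>0 'k) set"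
  show "subgroup ?K (add_monoid (path_alg Q))"
  proof (rule group.subgroupI[OF abelian_group.a_group[OF ring.is_abelian_group[OF ring_path_alg]]])
    fix x :: "_ \<Rightarrow>\<^sub>0 'k" assume x: "x \<in> ?K"
    then have "x \<in> span_on (paths Q)" by (auto simp: span_on_def)
    then have "\<ominus>\<^bsub>path_alg Q\<^esub> x = - x"
      using span_on_uminus[of x]
      by (intro abelian_group.minus_equality[OF ring.is_abelian_group[OF ring_path_alg]]) auto
    with x show "inv\<^bsub>add_monoid (path_alg Q)\<^esub> x \<in> ?K"
      by (simp add: a_inv_def span_on_uminus)
  next
    show "?K \<subseteq> carrier (add_monoid (path_alg Q))"
      by (auto simp: span_on_def)
    show "?K \<noteq> {}"
      using span_on_zero by blast
  qed (simp add: span_on_add)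
next
  fix a x :: "_ \<Rightarrow>\<^sub>0 'k" assume ax: "a \<in> span_on {p \<in> paths Q. m \<le> plen p}" "x \<in> carrier (path_alg Q)"
  have x: "x \<in> span_on {p \<in> paths Q. 0 \<le> plen p}" using ax(2) by simp
  show "x \<otimes>\<^bsub>path_alg Q\<^esub> a \<in> span_on {p \<in> paths Q. m \<le> plen p}"
    "a \<otimes>\<^bsub>path_alg Q\<^esub> x \<in> span_on {p \<in> paths Q. m \<le> plen p}"
    using mult_plen[OF ax(1) x] mult_plen[OF x ax(1)] by simp_all
qed

lemma arrow_ideal_plen: "(arrow_ideal Q :: (_ \<Rightarrow>\<^sub>0 'k) set) \<subseteq> span_on {p \<in> paths Q. 1 \<le> plen p}"
  unfolding arrow_ideal_def
proof (rule ring.genideal_minimal[OF ring_path_alg span_plen_ideal], safe)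
  fix \<alpha> assume "\<alpha> \<in> arcs Q"
  then have "arrow_path Q \<alpha> \<in> paths Q"
    by (auto simp: arrow_path_def paths_def ptgt_def awalk_Cons_iff awalk_Nil_iff)
  then show "pmon (arrow_path Q \<alpha>) \<in> span_on {p \<in> paths Q. 1 \<le> plen p}"
    by (simp add: arrow_path_def)
qed

text \<open>
  From \<open>I \<subseteq> J\<^sup>2\<close>.  Thus vertices and arrows are nonzero in \<open>A\<close>, and a relation has an arrow that is not its
  first one.
\<close>

lemma plen_of_I:
  assumes "pmon p \<in> I"
  shows "2 \<le> plen p"
proof -
  let ?J = "arrow_ideal Q :: (_ \<Rightarrow>\<^sub>0 'k) set"
  have in_J2: "pmon p \<in> ?J [^]\<^bsub>ideals_set (path_alg Q)\<^esub> (2::nat)"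
    using admissible assms by blast
  have J2: "?J [^]\<^bsub>ideals_set (path_alg Q)\<^esub> (2::nat) =
      ideal_prod (path_alg Q) (ideal_prod (path_alg Q) (carrier (path_alg Q)) ?J) ?J"
    by (simp add: nat_pow_def ideals_set_def numeral_2_eq_2)
  have prod: "x \<in> span_on {p \<in> paths Q. m + n \<le> plen p}"
    if "x \<in> ideal_prod (path_alg Q) K L" "K \<subseteq> span_on {p \<in> paths Q. m \<le> plen p}"
      "L \<subseteq> span_on {p \<in> paths Q. n \<le> plen p}" for x :: "_ \<Rightarrow>\<^sub>0 'k" and K L m n
    using that(1)
  proof induction
    case (prod i j)
    then show ?case using mult_plen that by blast
  next
    case (sum a b)
    then show ?case by (simp add: span_on_add)
  qed
  have "ideal_prod (path_alg Q) (carrier (path_alg Q)) ?J \<subseteq> span_on {p \<in> paths Q. 0 + 1 \<le> plen p}"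
    using prod[where K = "carrier (path_alg Q)" and L = ?J and m = 0 and n = 1] arrow_ideal_plen by auto
  then have "ideal_prod (path_alg Q) (carrier (path_alg Q)) ?J \<subseteq> span_on {p \<in> paths Q. 1 \<le> plen p}"
    by simp
  moreover have "pmon p \<in> ideal_prod (path_alg Q) (ideal_prod (path_alg Q) (carrier (path_alg Q)) ?J) ?J"
    using in_J2 J2 by simp
  ultimately have "(pmon p :: _ \<Rightarrow>\<^sub>0 'k) \<in> span_on {p \<in> paths Q. 1 + 1 \<le> plen p}"
    using prod arrow_ideal_plen by blast
  then show ?thesis
    by simp
qed

lemma pcat_in_I:
  assumes "p \<in> paths Q" "q \<in> paths Q" "composable Q p q" "pmon p \<in> I \<or> pmon q \<in> I"
  shows "pmon (pcat p q) \<in> I"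
proof -
  have "pmon p \<otimes>\<^bsub>path_alg Q\<^esub> pmon q \<in> I"
    using assms ideal.I_l_closed[OF ideal_I, of "pmon q" "pmon p"]
      ideal.I_r_closed[OF ideal_I, of "pmon p" "pmon q"] by auto
  then show ?thesis using assms by (simp add: pmon_mult path_mult_def)
qed

lemma seg_in_I_mono:
  assumes T: "T \<in> paths Q" and ord: "i \<le> a" "a \<le> b" "b \<le> j" "j \<le> plen T" and "pmon (seg Q T a b) \<in> I"
  shows "pmon (seg Q T i j) \<in> I"
proof -
  have "pmon (seg Q T i b) \<in> I"
    using pcat_in_I[of "seg Q T i a" "seg Q T a b"] assms
    by (simp add: pcat_seg composable_seg seg_in_paths)
  then show ?thesis
    using pcat_in_I[of "seg Q T i b" "seg Q T b j"] assms
    by (simp add: pcat_seg composable_seg seg_in_paths)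
qed

lemma seg_in_I_iff:
  assumes T: "T \<in> paths Q" and "i \<le> j" "j \<le> plen T"
  shows "pmon (seg Q T i j) \<in> I \<longleftrightarrow> (\<exists>(a, b) \<in> R_occs T. i \<le> a \<and> b \<le> j)"
proof
  assume "\<exists>(a, b) \<in> R_occs T. i \<le> a \<and> b \<le> j"
  then show "pmon (seg Q T i j) \<in> I"
    using assms by (auto simp: occs_def Rels_def intro: seg_in_I_mono)
next
  assume "pmon (seg Q T i j) \<in> I"
  then show "\<exists>(a, b) \<in> R_occs T. i \<le> a \<and> b \<le> j"
    using assms(2,3)
  proof (induction "j - i" arbitrary: i j rule: less_induct)
    case less
    show ?case
    proof (cases "seg Q T i j \<in> Rels Q I")
      case True
      then show ?thesis using less.prems by (auto simp: occs_def)
    next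
      case False
      then obtain a b where ab: "a \<le> b" "b \<le> j - i" "(a, b) \<noteq> (0, j - i)"
        "pmon (seg Q (seg Q T i j) a b) \<in> I"
        using less.prems T by (auto simp: Rels_def plen_seg seg_in_paths)
      then have "\<exists>(a', b') \<in> R_occs T. i + a \<le> a' \<and> b' \<le> i + b"
        using less.prems by (intro less.hyps) (auto simp: seg_seg)
      then show ?thesis using ab less.prems by fastforce
    qed
  qed
qed

lemma R_occs_D:
  assumes "(a, b) \<in> R_occs T"
  shows "a + 2 \<le> b" "b \<le> plen T" "pmon (seg Q T a b) \<in> I"
  using assms plen_of_I[of "seg Q T a b"] plen_seg[of b T Q a] by (auto simp: occs_def Rels_def)

lemma proper_seg_notin_I:
  assumes T: "T \<in> paths Q" and R: "(a, b) \<in> R_occs T" and ij: "a \<le> i" "i \<le> j" "j \<le> b"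
    "(i, j) \<noteq> (a, b)"
  shows "pmon (seg Q T i j) \<notin> I"
proof -
  have b: "b \<le> plen T" "a \<le> b" using R_occs_D[OF R] by auto
  have "seg Q (seg Q T a b) (i - a) (j - a) = seg Q T i j"
    using ij b by (simp add: seg_seg)
  moreover have "i - a \<le> j - a" "j - a \<le> plen (seg Q T a b)" "(i - a, j - a) \<noteq> (0, plen (seg Q T a b))"
    using ij b by (auto simp: plen_seg)
  ultimately show ?thesis using R unfolding occs_def Rels_def by fastforce
qed

lemma R_antichain:
  assumes T: "T \<in> paths Q"
  shows "interval_antichain (R_occs T) st en"
proof
  have "R_occs T \<subseteq> {..plen T} \<times> {..plen T}" by (auto simp: occs_def)
  then show "finite (R_occs T)" by (rule finite_subset) simp
  show "st p < en p" if "p \<in> R_occs T" for p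
    using R_occs_D[of "fst p" "snd p" T] that by simp
  show "p = q" if pq: "p \<in> R_occs T" "q \<in> R_occs T" "st p \<le> st q" "en q \<le> en p" for p q
  proof (rule ccontr)
    assume "p \<noteq> q"
    then show False
      using proper_seg_notin_I[OF T, of "fst p" "snd p" "fst q" "snd q"]
        R_occs_D[of "fst q" "snd q" T] pq by (auto simp: prod_eq_iff)
  qed
qed

abbreviation rchain where "rchain T ps \<equiv> greedy_chain (R_occs T) st en ps"
abbreviation op_rchain where "op_rchain T rs \<equiv> greedy_chain (R_occs T) (\<lambda>p. - en p) (\<lambda>p. - st p) rs"

lemma concatenation_iff:
  "concatenation Q I T n ps \<longleftrightarrow> 2 \<le> n \<and> length ps = n - 1 \<and> rchain T ps"
proof -
  have "concat_cands Q I T ps (Suc k) = candidates (R_occs T) st en ps k" for k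
    by (cases k) (auto simp: concat_cands_def candidates_def)
  moreover have "(\<forall>k. 1 \<le> k \<and> k < n - 1 \<longrightarrow> P k) \<longleftrightarrow> (\<forall>k. Suc k < n - 1 \<longrightarrow> P (Suc k))" for P
    by (rule all_positive_iff)
  ultimately show ?thesis
    by (auto simp: concatenation_def greedy_chain_def)
qed

lemma op_concatenation_iff:
  "op_concatenation Q I T n qs \<longleftrightarrow> 2 \<le> n \<and> length qs = n - 1 \<and> op_rchain T (rev qs)"
proof -
  have "op_cands Q I T rs (Suc k) = candidates (R_occs T) (\<lambda>p. - en p) (\<lambda>p. - st p) rs k" for k rs
    by (cases k) (auto simp: op_cands_def candidates_def)
  moreover have "(\<forall>k. 1 \<le> k \<and> k < n - 1 \<longrightarrow> P k) \<longleftrightarrow> (\<forall>k. Suc k < n - 1 \<longrightarrow> P (Suc k))" for P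
    by (rule all_positive_iff)
  ultimately show ?thesis
    by (auto simp: op_concatenation_def greedy_chain_def)
qed

lemma R_occs_window:
  assumes T: "i \<le> j" "j \<le> plen T"
  shows "(\<lambda>(a, b). (i + a, i + b)) ` R_occs (seg Q T i j) = {p \<in> R_occs T. int i \<le> st p \<and> en p \<le> int j}"
proof (intro equalityI subsetI)
  fix p assume p: "p \<in> {p \<in> R_occs T. int i \<le> st p \<and> en p \<le> int j}"
  then have "(fst p - i, snd p - i) \<in> R_occs (seg Q T i j)"
    using T by (auto simp: occs_def plen_seg seg_seg)
  moreover have "p = (\<lambda>(a, b). (i + a, i + b)) (fst p - i, snd p - i)"
    using p by (auto simp: occs_def)
  ultimately show "p \<in> (\<lambda>(a, b). (i + a, i + b)) ` R_occs (seg Q T i j)"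
    by (rule rev_image_eqI)
qed (use T in \<open>auto simp: occs_def plen_seg seg_seg\<close>)

lemma chain_seg:
  assumes T: "T \<in> paths Q" "i \<le> j" "j \<le> plen T"
  shows chain_from_seg: "rchain (seg Q T i j) ps \<Longrightarrow> rchain T (map (\<lambda>(a, b). (i + a, i + b)) ps)"
    and chain_to_seg: "rchain T qs \<Longrightarrow> i \<le> fst (hd qs) \<Longrightarrow> snd (last qs) \<le> j \<Longrightarrow>
      \<exists>ps. rchain (seg Q T i j) ps \<and> qs = map (\<lambda>(a, b). (i + a, i + b)) ps"
  using interval_antichain.chain_window[OF R_antichain[OF T(1)] R_occs_window[OF T(2,3)],
      of st "int i" en]
  by (auto simp: case_prod_beta)

text \<open>
  Membership in \<open>AP\<^sub>n\<close> may be tested with concatenations on any path that contains the given one.  All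
  subpaths of subpaths can therefore be treated as occurrences in one fixed path.
\<close>

lemma AP_seg_iff:
  assumes T: "T \<in> paths Q" "i \<le> j" "j \<le> plen T" and n: "2 \<le> n"
  shows "seg Q T i j \<in> AP Q I n \<longleftrightarrow>
    (\<exists>ps. length ps = n - 1 \<and> rchain T ps \<and> fst (hd ps) = i \<and> snd (last ps) = j)"
proof
  assume "\<exists>ps. length ps = n - 1 \<and> rchain T ps \<and> fst (hd ps) = i \<and> snd (last ps) = j"
  then obtain ps where "concatenation Q I T n ps" "seg Q T i j = supp Q T ps"
    using n by (auto simp: concatenation_iff supp_def)
  then show "seg Q T i j \<in> AP Q I n"
    using n T(1) by (auto simp: AP_def simp del: split_paired_Ex)
next
  assume "seg Q T i j \<in> AP Q I n"
  then obtain T0 ps0 where T0: "T0 \<in> paths Q" and ps0: "length ps0 = n - 1" "rchain T0 ps0"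
    and eq: "seg Q T i j = seg Q T0 (fst (hd ps0)) (snd (last ps0))"
    using n by (auto simp: AP_def concatenation_iff supp_def split: if_splits)
  interpret T0: interval_antichain "R_occs T0" st en by (rule R_antichain[OF T0])
  define i0 j0 where "i0 = fst (hd ps0)" and "j0 = snd (last ps0)"
  have ne: "ps0 \<noteq> []" using ps0(2) by (simp add: greedy_chain_def)
  have last_in: "ps0 ! (n - 2) \<in> R_occs T0" "last ps0 = ps0 ! (n - 2)"
    using T0.chain_in[OF ps0(2), of "n - 2"] ps0(1) n ne by (auto simp: last_conv_nth numeral_2_eq_2)
  have "st (ps0 ! 0) \<le> st (ps0 ! (n - 2))"
    using T0.chain_mono[OF ps0(2), of 0 "n - 2"] ps0(1) n by simp
  then have ij0: "i0 \<le> j0" "j0 \<le> plen T0"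
    using R_occs_D[of "fst (last ps0)" "snd (last ps0)" T0] last_in ne
    by (auto simp: i0_def j0_def hd_conv_nth)
  obtain ps1 where ps1: "rchain (seg Q T0 i0 j0) ps1" "ps0 = map (\<lambda>(a, b). (i0 + a, i0 + b)) ps1"
    using chain_to_seg[OF T0 ij0 ps0(2)] unfolding i0_def j0_def by blast
  have ne1: "ps1 \<noteq> []" using ps1(1) by (simp add: greedy_chain_def)
  have "j0 - i0 = j - i"
    using arg_cong[OF eq, of plen] T ij0 by (simp add: plen_seg i0_def j0_def)
  then have ends: "fst (hd ps1) = 0" "snd (last ps1) = j - i"
    using ne1 i0_def j0_def ij0 unfolding ps1(2) by (auto simp: hd_map last_map case_prod_beta)
  have "rchain T (map (\<lambda>(a, b). (i + a, i + b)) ps1)"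
    using chain_from_seg[OF T, of ps1] ps1(1) eq by (simp add: i0_def j0_def)
  then show "\<exists>ps. length ps = n - 1 \<and> rchain T ps \<and> fst (hd ps) = i \<and> snd (last ps) = j"
    using ends ne1 T(2) ps0(1) ps1(2)
    by (intro exI[of _ "map (\<lambda>(a, b). (i + a, i + b)) ps1"])
      (auto simp: hd_map last_map case_prod_beta)
qed

lemma rchain_ends:
  assumes T: "T \<in> paths Q" and ps: "rchain T ps"
  shows "fst (hd ps) \<le> snd (last ps)" "snd (last ps) \<le> plen T"
    "seg Q T (fst (hd ps)) (snd (last ps)) \<in> AP Q I (length ps + 1)"
proof -
  interpret interval_antichain "R_occs T" st en by (rule R_antichain[OF T])
  have ne: "ps \<noteq> []" using ps by (simp add: greedy_chain_def)
  have "last ps \<in> R_occs T" "st (hd ps) \<le> st (last ps)"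
    using chain_in[OF ps, of "length ps - 1"] chain_mono[OF ps, of 0 "length ps - 1"] ne
    by (simp_all add: last_conv_nth hd_conv_nth)
  then show ends: "fst (hd ps) \<le> snd (last ps)" "snd (last ps) \<le> plen T"
    using R_occs_D[of "fst (last ps)" "snd (last ps)" T] by simp_all
  have "2 \<le> length ps + 1" "length ps = length ps + 1 - 1" using ne by (cases ps; simp)+
  then show "seg Q T (fst (hd ps)) (snd (last ps)) \<in> AP Q I (length ps + 1)"
    using AP_seg_iff[OF T, of "fst (hd ps)" "snd (last ps)" "length ps + 1"] ends ps by fastforce
qed

lemma AP_seg_op_iff:
  assumes T: "T \<in> paths Q" "i \<le> j" "j \<le> plen T" and n: "2 \<le> n"
  shows "seg Q T i j \<in> AP Q I n \<longleftrightarrow>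
    (\<exists>qs. length qs = n - 1 \<and> op_rchain T (rev qs) \<and> fst (hd qs) = i \<and> snd (last qs) = j)"
proof -
  interpret interval_antichain "R_occs T" st en by (rule R_antichain[OF T(1)])
  have "\<exists>qs. length qs = length ps \<and> op_rchain T (rev qs) \<and> hd qs = hd ps \<and> last qs = last ps"
    if ps: "rchain T ps" for ps
  proof -
    obtain rs where "length rs = length ps" "op_rchain T rs" "hd rs = last ps" "last rs = hd ps"
      using op_chain[OF ps] by blast
    moreover from this have "rs \<noteq> []" by (simp add: greedy_chain_def)
    ultimately show ?thesis by (intro exI[of _ "rev rs"]) (simp add: hd_rev last_rev)
  qed
  moreover have "\<exists>ps. length ps = length qs \<and> rchain T ps \<and> hd ps = hd qs \<and> last ps = last qs"
    if qs: "op_rchain T (rev qs)" for qs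
  proof -
    have "qs \<noteq> []" using qs by (simp add: greedy_chain_def)
    moreover obtain ps where "length ps = length (rev qs)" "rchain T ps"
      "hd ps = last (rev qs)" "last ps = hd (rev qs)"
      using interval_antichain.op_chain[OF dual qs] by auto
    ultimately show ?thesis by (intro exI[of _ ps]) (simp add: hd_rev last_rev)
  qed
  ultimately show ?thesis
    unfolding AP_seg_iff[OF T n] by metis
qed

lemma AP_start_unique:
  assumes T: "T \<in> paths Q" and n: "2 \<le> n"
    and "(i, j) \<in> occs Q (AP Q I n) T" "(i, j') \<in> occs Q (AP Q I n) T"
  shows "j = j'"
proof -
  interpret interval_antichain "R_occs T" st en by (rule R_antichain[OF T(1)])
  obtain ps ps' where ps: "length ps = n - 1" "rchain T ps" "fst (hd ps) = i" "snd (last ps) = j"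
    and ps': "length ps' = n - 1" "rchain T ps'" "fst (hd ps') = i" "snd (last ps') = j'"
    using assms by (auto simp: occs_def AP_seg_iff)
  have "ps \<noteq> []" "ps' \<noteq> []" using ps ps' by (auto simp: greedy_chain_def)
  then have "ps = ps'"
    using chain_unique[OF ps'(2) ps(2)] ps ps' by (simp add: hd_conv_nth)
  then show ?thesis using ps ps' by simp
qed

text \<open>
  By duality, elements of \<open>AP\<^sub>n\<close> are spanned by op-concatenations, and these are determined by their last
  relation.
\<close>

lemma AP_end_unique:
  assumes T: "T \<in> paths Q" and n: "2 \<le> n"
    and "(i, j) \<in> occs Q (AP Q I n) T" "(i', j) \<in> occs Q (AP Q I n) T"
  shows "i = i'"
proof -
  interpret interval_antichain "R_occs T" "\<lambda>p. - en p" "\<lambda>p. - st p"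
    by (rule interval_antichain.dual[OF R_antichain[OF T(1)]])
  obtain qs qs' where qs: "length qs = n - 1" "op_rchain T (rev qs)" "fst (hd qs) = i" "snd (last qs) = j"
    and qs': "length qs' = n - 1" "op_rchain T (rev qs')" "fst (hd qs') = i'" "snd (last qs') = j"
    using assms by (auto simp: occs_def AP_seg_op_iff)
  have "qs \<noteq> []" "qs' \<noteq> []" using qs qs' by (auto simp: greedy_chain_def)
  then have "rev qs = rev qs'"
    using chain_unique[OF qs'(2) qs(2)] qs qs' by (simp add: hd_rev flip: hd_conv_nth)
  then show ?thesis using qs qs' by simp
qed

text \<open>
  This is what singles out one summand of \<open>F\<close>.  A relation in front of the inner path ends no
  later than that path starts, so the inner chain starts behind the first relation of the outer one, and
  \<open>chain_interleave\<close> compares their last relations.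
\<close>

lemma AP_end_if_skips_relation:
  assumes T: "T \<in> paths Q" and n: "2 \<le> n" "even n"
    and w: "(i, j) \<in> occs Q (AP Q I (n + 2)) T" and z: "(i', j') \<in> occs Q (AP Q I n) T"
    and ord: "i \<le> i'" "j' \<le> j" and rel: "pmon (seg Q T i i') \<in> I"
  shows "j' = j"
proof -
  interpret interval_antichain "R_occs T" st en by (rule R_antichain[OF T(1)])
  obtain ps where ps: "length ps = n + 1" "rchain T ps" "fst (hd ps) = i" "snd (last ps) = j"
    using w T by (auto simp: occs_def AP_seg_iff)
  obtain qs where qs: "length qs = n - 1" "rchain T qs" "fst (hd qs) = i'" "snd (last qs) = j'"
    using z n T by (auto simp: occs_def AP_seg_iff)
  have ne: "ps \<noteq> []" "qs \<noteq> []" using ps qs by (auto simp: greedy_chain_def)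
  have "i' \<le> plen T" using z by (auto simp: occs_def)
  then obtain a b where ab: "(a, b) \<in> R_occs T" "i \<le> a" "b \<le> i'"
    using rel seg_in_I_iff[OF T, of i i'] ord by auto
  then have "en (ps ! 0) \<le> st (qs ! 0)"
    using end_le_iff[of "ps ! 0" "(a, b)"] chain_in[OF ps(2), of 0] ps qs ne by (simp add: hd_conv_nth)
  then have "st (ps ! (n - 2 + 2)) \<le> st (qs ! (n - 2))"
    using chain_interleave[OF ps(2) qs(2), of "n - 2"] n ps(1) qs(1) by simp
  then have "en (ps ! n) \<le> en (qs ! (n - 2))"
    using end_le_iff[of "ps ! n" "qs ! (n - 2)"] chain_in[OF ps(2), of n] chain_in[OF qs(2), of "n - 2"]
      n ps(1) qs(1) le_add_diff_inverse2[OF n(1)] by simp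
  moreover have "last ps = ps ! n" "last qs = qs ! (n - 2)"
    using ne ps(1) qs(1) n by (simp_all add: last_conv_nth numeral_2_eq_2)
  ultimately show ?thesis using ps(4) qs(4) ord by simp
qed

end

section \<open>The comparison map into the bar resolution\<close>

fun pieces :: "('v, 'a) pre_digraph \<Rightarrow> ('v, 'a) qpath \<Rightarrow> nat list \<Rightarrow> ('v, 'a) qpath list" where
  "pieces Q T (i # j # is) = seg Q T i j # pieces Q T (j # is)"
| "pieces Q T is = []"

text \<open>
  The condition \<open>\<M>\<^sub>o\<^sub>d\<^sub>d = \<emptyset>\<close>, in the form in which \<open>F\<close> produces its tensors: two factors at a time, from the
  left.
\<close>

fun rel_pairs :: "(('v, 'a) qpath \<Rightarrow>\<^sub>0 'k::field) set \<Rightarrow> ('v, 'a) qpath list \<Rightarrow> bool" where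
  "rel_pairs I (u # v # vs) \<longleftrightarrow> pmon (pcat u v) \<in> I \<and> rel_pairs I vs"
| "rel_pairs I vs \<longleftrightarrow> True"

text \<open>
  For a linear functional \<open>\<Phi>\<close>, the functional \<open>x \<mapsto> \<Phi>(1 \<otimes> L x R)\<close> on basis tensors; here \<open>1 \<otimes> L x R\<close> is the
  shape of every summand in the recursion for \<open>F\<close>.
\<close>

definition pull_back ::
  "('v, 'a) pre_digraph \<Rightarrow> (('v, 'a) qpath \<Rightarrow>\<^sub>0 'k::field) set \<Rightarrow> ('v, 'a) qpath \<Rightarrow> ('v, 'a) qpath
     \<Rightarrow> (('v, 'a) qpath list \<Rightarrow> ('c \<Rightarrow>\<^sub>0 'k)) \<Rightarrow> ('v, 'a) qpath list \<Rightarrow> ('c \<Rightarrow>\<^sub>0 'k)" where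
  "pull_back Q I L R \<Phi> xs =
     (if L \<in> Pths Q I \<and> R \<in> Pths Q I \<and> composable Q L (hd xs) \<and> composable Q (last xs) R \<and>
         pcat L (hd xs) \<in> Pths Q I \<and> pcat (last xs) R \<in> Pths Q I
      then \<Phi> (triv (psrc L) # pcat L (hd xs) # butlast (tl xs) @ [pcat (last xs) R]) else 0)"

lemma linext_single [simp]: "linext \<phi> (Poly_Mapping.single b 1) = \<phi> b"
  by (simp add: linext_def)

lemma single_in_span [simp]: "(Poly_Mapping.single p (1::'k::field)) \<in> span_on B \<longleftrightarrow> p \<in> B"
  by (simp add: span_on_def)

lemma linext_act_basis:
  "linext \<Phi> (act Q I (cls Q I L) X (cls Q I R)) =
     linext (\<lambda>xs. if L \<in> Pths Q I \<and> R \<in> Pths Q I then linext \<Phi> (act_basis Q I L xs R) else 0) X"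
  by (simp add: act_def cls_def linext_linext)

lemma linext_one_otimes_act:
  "linext \<Phi> (one_otimes (act Q I (cls Q I L) X (cls Q I R))) = linext (pull_back Q I L R \<Phi>) X"
proof -
  have "linext \<Phi> (one_otimes Y) = linext (\<lambda>xs. \<Phi> (triv (psrc (hd xs)) # xs)) Y" for Y
    by (simp add: one_otimes_def linext_linext)
  then show ?thesis
    by (simp only: linext_act_basis)
      (rule linext_cong, auto simp: pull_back_def act_basis_def pcat_def)
qed

lemma sum_eq_single_term:
  assumes "finite S" "x \<in> S" "\<And>y. y \<in> S \<Longrightarrow> y \<noteq> x \<Longrightarrow> f y = 0"
  shows "sum f S = f x"
proof -
  have "sum f {x} = sum f S"
    using assms by (intro sum.mono_neutral_left) auto
  then show ?thesis by simp
qed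

lemma F_gen_in_span:
  "1 \<le> n \<Longrightarrow> F_gen Q I n w \<in> span_on {xs. length xs = n + 2 \<and> (\<exists>x. hd xs = triv x)}"
proof (induction Q I n w rule: F_gen.induct)
  case (2 Q I \<alpha>)
  then show ?case by (simp add: unit_tensor_def)
next
  case (3 Q I n w)
  have "one_otimes (act Q I a X b) \<in> span_on {xs. length xs = Suc (Suc n) + 2 \<and> (\<exists>x. hd xs = triv x)}"
    if "X \<in> span_on {xs. length xs = Suc n + 2 \<and> (\<exists>x. hd xs = triv x)}" for a b X
  proof -
    have "length xs = Suc n + 2" if "xs \<in> Poly_Mapping.keys X" for xs
      using that \<open>X \<in> _\<close> by (auto simp: span_on_def)
    then have "act Q I a X b \<in> span_on {xs. length xs = Suc n + 2}"
      unfolding act_def by (intro linext_in_span) (auto simp: act_basis_def)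
    then have "length xs = Suc n + 2" if "xs \<in> Poly_Mapping.keys (act Q I a X b)" for xs
      using that by (auto simp: span_on_def)
    then show ?thesis
      unfolding one_otimes_def by (intro linext_in_span) auto
  qed
  note step = this
  show ?case
    unfolding F_gen.simps
  proof (intro span_on_sum)
    fix \<zeta> assume "\<zeta> \<in> {\<zeta> \<in> Sub Q I (Suc (Suc n)) w. \<exists>\<zeta>'\<in>Sub Q I (Suc (Suc n)) w. fst \<zeta>' < fst \<zeta>}"
    then show "(case \<zeta> of (i, j) \<Rightarrow> one_otimes (act Q I (cls Q I (seg Q w 0 i)) (F_gen Q I (Suc n) (seg Q w i j))
        (cls Q I (seg Q w j (plen w))))) \<in> span_on {xs. length xs = Suc (Suc n) + 2 \<and> (\<exists>x. hd xs = triv x)}"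
      using 3(1)[of \<zeta> "fst \<zeta>" "snd \<zeta>"] by (cases \<zeta>) (auto intro!: step[simplified])
  qed
qed simp

declare F_gen.simps(3) [simp del]

context monomial_algebra
begin

lemma triv_vert_in_Pths:
  assumes "T \<in> paths Q" "i \<le> plen T"
  shows "triv (vert Q T i) \<in> Pths Q I"
  using seg_in_paths[of T i i] assms plen_of_I[of "triv (vert Q T i)"] by (auto simp: Pths_def)

lemma Sub_seg_iff:
  assumes "i \<le> j" "j \<le> plen T"
  shows "(a, b) \<in> Sub Q I n (seg Q T i j) \<longleftrightarrow>
    a \<le> b \<and> i + b \<le> j \<and> seg Q T (i + a) (i + b) \<in> AP Q I (n - 1)"
  using assms by (auto simp: Sub_def occs_def plen_seg seg_seg)

lemma finite_Sub [simp]: "finite (Sub Q I n w)"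
proof -
  have "Sub Q I n w \<subseteq> {..plen w} \<times> {..plen w}" by (auto simp: Sub_def occs_def)
  then show ?thesis by (rule finite_subset) simp
qed

text \<open>
  Provides the first element of \<open>Sub(w)\<close>, the one that \<open>F\<close> leaves out.
\<close>

lemma AP_prefix:
  assumes T: "T \<in> paths Q" "i \<le> j" "j \<le> plen T" and n: "2 \<le> n" and w: "seg Q T i j \<in> AP Q I (Suc n)"
  obtains j' where "i \<le> j'" "j' \<le> j" "seg Q T i j' \<in> AP Q I n"
proof -
  interpret interval_antichain "R_occs T" st en by (rule R_antichain[OF T(1)])
  obtain ps where ps: "length ps = n" "rchain T ps" "fst (hd ps) = i" "snd (last ps) = j"
    using AP_seg_iff[OF T, of "Suc n"] w n by auto
  have ne: "ps \<noteq> []" using ps by (auto simp: greedy_chain_def)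
  let ?ps = "take (n - 1) ps"
  have ps': "rchain T ?ps" "hd ?ps = hd ps" "last ?ps = ps ! (n - 2)" "length ?ps + 1 = n"
    using chain_take[OF ps(2), of "n - 1"] n ps(1) ne
    by (simp_all add: last_conv_nth numeral_2_eq_2)
  have "en (ps ! (n - 2)) \<le> en (ps ! (n - 1))"
    using chain_mono_end[OF ps(2), of "n - 2" "n - 1"] ps(1) n by simp
  then have "snd (last ?ps) \<le> j"
    unfolding ps'(3) using ps ne by (simp add: last_conv_nth)
  then show ?thesis
    using that rchain_ends[OF T(1) ps'(1)] unfolding ps'(2,4) ps(3) by blast
qed

lemma op_rchain_Cons:
  assumes T: "T \<in> paths Q" and qs: "op_rchain T (rev (q # qs))" "qs \<noteq> []"
  shows op_rchain_tl: "op_rchain T (rev qs)"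
    and "fst q < fst (hd qs)" "fst (hd qs) < snd q" "q \<in> R_occs T"
proof -
  interpret interval_antichain "R_occs T" "\<lambda>p. - en p" "\<lambda>p. - st p"
    by (rule interval_antichain.dual[OF R_antichain[OF T(1)]])
  obtain l where l: "length qs = Suc l" using qs(2) by (cases qs) auto
  have "rev qs = take (length qs) (rev (q # qs))" by simp
  then show "op_rchain T (rev qs)"
    using chain_take[OF qs(1), of "length qs"] qs(2) by simp
  have nth: "rev (q # qs) ! l = hd qs" "rev (q # qs) ! Suc l = q"
    using l qs(2) by (simp_all add: nth_append rev_nth hd_conv_nth)
  have "hd qs \<in> R_occs T" "q \<in> R_occs T"
    using chain_in[OF qs(1), of l] chain_in[OF qs(1), of "Suc l"] l unfolding nth by simp_all
  moreover have "- en q > - en (hd qs)" "- en q < - st (hd qs)"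
    using chain_step[OF qs(1), of l] chain_overlap[OF qs(1), of l] l unfolding nth by simp_all
  ultimately show "q \<in> R_occs T" "fst q < fst (hd qs)"
    using end_less_iff[of "hd qs" q] by simp_all
  show "fst (hd qs) < snd q" using \<open>- en q < - st (hd qs)\<close> by simp
qed

lemma op_rchain_ends:
  assumes T: "T \<in> paths Q" and qs: "op_rchain T (rev qs)"
  shows "fst (hd qs) + 2 \<le> snd (last qs)" "snd (last qs) \<le> plen T"
    "seg Q T (fst (hd qs)) (snd (last qs)) \<in> AP Q I (length qs + 1)"
proof -
  interpret op: interval_antichain "R_occs T" "\<lambda>p. - en p" "\<lambda>p. - st p"
    by (rule interval_antichain.dual[OF R_antichain[OF T(1)]])
  have ne: "qs \<noteq> []" using qs by (simp add: greedy_chain_def)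
  have "hd qs \<in> R_occs T" "last qs \<in> R_occs T"
    using op.chain_in[OF qs, of 0] op.chain_in[OF qs, of "length qs - 1"] ne
    by (simp_all add: rev_nth last_conv_nth hd_conv_nth)
  moreover have "en (hd qs) \<le> en (last qs)"
    using op.chain_mono[OF qs, of 0 "length qs - 1"] ne by (simp add: rev_nth last_conv_nth hd_conv_nth)
  ultimately show ends: "fst (hd qs) + 2 \<le> snd (last qs)" "snd (last qs) \<le> plen T"
    using R_occs_D[of "fst (hd qs)" "snd (hd qs)" T] R_occs_D[of "fst (last qs)" "snd (last qs)" T] by simp_all
  show "seg Q T (fst (hd qs)) (snd (last qs)) \<in> AP Q I (length qs + 1)"
  proof -
    have "2 \<le> length qs + 1" "length qs = length qs + 1 - 1" using ne by (cases qs; simp)+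
    then show ?thesis
      using AP_seg_op_iff[OF T, of "fst (hd qs)" "snd (last qs)" "length qs + 1"] ends qs by fastforce
  qed
qed

lemma op_rchain_drop:
  assumes T: "T \<in> paths Q" and qs: "op_rchain T (rev qs)" "k < length qs"
  shows "op_rchain T (rev (drop k qs))"
  using interval_antichain.chain_take[OF interval_antichain.dual[OF R_antichain[OF T]] qs(1), of "length qs - k"]
    qs(2) by (simp add: rev_drop)

lemma AP_one_seg:
  assumes "T \<in> paths Q" "i \<le> j" "j \<le> plen T"
  shows "seg Q T i j \<in> AP Q I 1 \<longleftrightarrow> j = Suc i"
proof
  assume "seg Q T i j \<in> AP Q I 1"
  then have "plen (seg Q T i j) = 1" by (auto simp: AP_def arrow_path_def)
  then show "j = Suc i" using assms by (simp add: plen_seg)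
next
  assume "j = Suc i"
  then have "length (snd (seg Q T i j)) = 1" using assms by (simp add: plen_seg)
  then obtain \<alpha> where "snd (seg Q T i j) = [\<alpha>]" by (auto simp: length_Suc_conv)
  then have seg: "seg Q T i j = (vert Q T i, [\<alpha>])" by (simp add: prod_eq_iff)
  have "seg Q T i j \<in> paths Q" using assms by (rule seg_in_paths)
  then have "\<alpha> \<in> arcs Q \<and> vert Q T i = tail Q \<alpha>"
    by (auto simp: seg paths_def awalk_Cons_iff)
  then show "seg Q T i j \<in> AP Q I 1"
    by (auto simp: AP_def seg arrow_path_def)
qed

lemma linext_F_gen_Suc:
  "linext \<Phi> (F_gen Q I (Suc (Suc n)) w) =
    (\<Sum>(a, b) \<in> {\<zeta> \<in> Sub Q I (Suc (Suc n)) w. \<exists>\<zeta>' \<in> Sub Q I (Suc (Suc n)) w. fst \<zeta>' < fst \<zeta>}.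
      linext (pull_back Q I (seg Q w 0 a) (seg Q w b (plen w)) \<Phi>) (F_gen Q I (Suc n) (seg Q w a b)))"
  unfolding F_gen.simps linext_sum
  by (intro sum.cong refl) (simp add: case_prod_beta linext_one_otimes_act)

text \<open>
  For a relation \<open>w\<close>, the summands of \<open>F\<^sub>2(1 \<otimes> w \<otimes> 1)\<close> belong to the arrows of \<open>w\<close> but the first.  Up to the end of
  any arrow but the last, \<open>w\<close> is a proper part of a relation and so does not lie in \<open>I\<close>.
\<close>

lemma F_gen_two:
  assumes T: "T \<in> paths Q" and R: "(i, j) \<in> R_occs T"
    and kill: "\<And>xs. length xs = 4 \<Longrightarrow> \<not> rel_pairs I (butlast (tl xs)) \<Longrightarrow> \<Phi> xs = 0"
  shows "linext \<Phi> (F_gen Q I 2 (seg Q T i j)) =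
    \<Phi> [triv (vert Q T i), seg Q T i (j - 1), seg Q T (j - 1) j, triv (vert Q T j)]"
proof -
  define w where "w = seg Q T i j"
  have ij: "i + 2 \<le> j" "j \<le> plen T" using R_occs_D[OF R] by auto
  then have w_len: "plen w = j - i" by (simp add: w_def plen_seg)
  have Sub: "(a, b) \<in> Sub Q I 2 w \<longleftrightarrow> a < j - i \<and> b = Suc a" for a b
    using AP_one_seg[OF T, of "i + a" "i + b"] ij by (auto simp: w_def Sub_seg_iff)
  define S where "S = {\<zeta> \<in> Sub Q I 2 w. \<exists>\<zeta>'\<in>Sub Q I 2 w. fst \<zeta>' < fst \<zeta>}"
  define summand where "summand a b = pull_back Q I (seg Q w 0 a) (seg Q w b (plen w)) \<Phi>
      [triv (vert Q T (i + a)), seg Q T (i + a) (i + b), triv (vert Q T (i + b))]" for a b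
  have seg_w: "seg Q w a b = seg Q T (i + a) (i + b)" if "a \<le> b" "i + b \<le> j" for a b
    using that ij by (simp add: w_def seg_seg)
  have "linext \<Phi> (F_gen Q I 2 w) =
      (\<Sum>(a, b)\<in>S. linext (pull_back Q I (seg Q w 0 a) (seg Q w b (plen w)) \<Phi>) (F_gen Q I (Suc 0) (seg Q w a b)))"
    using linext_F_gen_Suc[of \<Phi> 0 w] by (simp add: S_def numeral_2_eq_2)
  also have "\<dots> = (\<Sum>(a, b)\<in>S. summand a b)"
  proof (intro sum.cong refl)
    fix \<zeta> assume \<zeta>: "\<zeta> \<in> S"
    obtain a b where ab: "\<zeta> = (a, b)" by fastforce
    with \<zeta> have "seg Q w a b = seg Q T (i + a) (i + b)" "b = Suc a" "i + b \<le> j"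
      using Sub[of a b] ij by (auto simp: S_def seg_w)
    moreover from this have "vert Q w a = vert Q T (i + a)"
      using vert_seg[of j T a i Q] ij by (simp add: w_def)
    ultimately show "(case \<zeta> of (a, b) \<Rightarrow> linext (pull_back Q I (seg Q w 0 a) (seg Q w b (plen w)) \<Phi>)
        (F_gen Q I (Suc 0) (seg Q w a b))) = (case \<zeta> of (a, b) \<Rightarrow> summand a b)"
      by (simp add: ab unit_tensor_def summand_def ptgt_seg)
  qed
  also have "\<dots> = (case (j - i - 1, j - i) of (a, b) \<Rightarrow> summand a b)"
  proof (rule sum_eq_single_term)
    show "finite S" by (simp add: S_def)
    have "(0, 1) \<in> Sub Q I 2 w" using ij by (simp add: Sub)
    then show "(j - i - 1, j - i) \<in> S"
      using ij by (auto simp: S_def Sub intro: bexI[of _ "(0, 1)"])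
    fix \<zeta> assume \<zeta>: "\<zeta> \<in> S" "\<zeta> \<noteq> (j - i - 1, j - i)"
    then obtain a b where "\<zeta> = (a, b)" "(a, b) \<in> Sub Q I 2 w" by (cases \<zeta>) (auto simp: S_def)
    with \<zeta>(2) have ab: "\<zeta> = (a, b)" "b = Suc a" "i + b < j" by (auto simp: Sub)
    have "pmon (seg Q T i (i + b)) \<notin> I"
      using ab by (intro proper_seg_notin_I[OF T R]) auto
    moreover have "pcat (seg Q w 0 a) (seg Q T (i + a) (i + b)) = seg Q T i (i + b)"
      using ab seg_w[of 0 a] by (simp add: pcat_seg)
    ultimately show "(case \<zeta> of (a, b) \<Rightarrow> summand a b) = 0"
      by (auto simp: ab(1) summand_def pull_back_def intro!: kill)
  qed
  also have "\<dots> = \<Phi> [triv (vert Q T i), seg Q T i (j - 1), seg Q T (j - 1) j, triv (vert Q T j)]"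
  proof -
    have "pmon (seg Q T i (j - 1)) \<notin> I"
      using ij by (intro proper_seg_notin_I[OF T R]) auto
    then have "seg Q T i (j - 1) \<in> Pths Q I"
      using seg_in_paths[OF T, of i "j - 1"] ij by (simp add: Pths_def)
    moreover have "i + (j - i - 1) = j - 1" "seg Q w 0 (j - i - 1) = seg Q T i (j - 1)"
      "i + (j - i) = j" "seg Q w (j - i) (plen w) = triv (vert Q T j)"
      "vert Q w (j - i - 1) = vert Q T (j - 1)" "vert Q w (j - i) = vert Q T j"
      using vert_seg[of j T "j - i - 1" i Q, folded w_def] vert_seg[of j T "j - i" i Q, folded w_def] seg_w[of 0 "j - i - 1"] seg_w[of "j - i" "j - i"] ij by (simp_all add: w_len)
    ultimately show ?thesis
      using triv_vert_in_Pths[OF T] ij by (simp add: summand_def pull_back_def ptgt_seg composable_def)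
  qed
  finally show ?thesis by (simp add: w_def)
qed

text \<open>
  Two steps of the recursion put \<open>L\<close> and \<open>L'\<close> in front of a tensor from \<open>F\<^sub>n\<close>.  As the latter starts with a
  trivial path, \<open>L\<close> and \<open>L'\<close> are the first two inner factors, and \<open>\<Phi>\<close> vanishes if \<open>LL' \<notin> I\<close>.
\<close>

lemma linext_pull_back_twice_eq_0:
  assumes kill: "\<And>xs. length xs = n + 4 \<Longrightarrow> \<not> rel_pairs I (butlast (tl xs)) \<Longrightarrow> \<Phi> xs = 0"
    and n: "1 \<le> n" and notin: "pmon (pcat L L') \<notin> I"
  shows "linext (pull_back Q I L' R' (pull_back Q I L R \<Phi>)) (F_gen Q I n z) = 0"
proof -
  have "pull_back Q I L' R' (pull_back Q I L R \<Phi>) xs = 0" if xs: "xs \<in> Poly_Mapping.keys (F_gen Q I n z)" for xs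
  proof -
    from F_gen_in_span[OF n, of Q I z] xs obtain x where "length xs = n + 2" "hd xs = triv x"
      by (auto simp: span_on_def)
    then show ?thesis
      using notin by (auto simp: pull_back_def intro!: kill)
  qed
  then have "linext (pull_back Q I L' R' (pull_back Q I L R \<Phi>)) (F_gen Q I n z) = linext (\<lambda>_. 0) (F_gen Q I n z)"
    by (rule linext_cong)
  then show ?thesis by simp
qed

text \<open>
  One step of the recursion, provided that only subpaths that end where \<open>w\<close> ends contribute: there is
  just one of them.
\<close>

lemma F_gen_step:
  assumes T: "T \<in> paths Q" "i \<le> j" "j \<le> plen T" and n: "2 \<le> n"
    and w: "seg Q T i j \<in> AP Q I (n + 1)" and z: "seg Q T i1 j \<in> AP Q I n" "i < i1" "i1 \<le> j"
    and zero: "\<And>a b. seg Q T (i + a) (i + b) \<in> AP Q I n \<Longrightarrow> a \<le> b \<Longrightarrow> i + b \<le> j \<Longrightarrow> i + b \<noteq> j \<Longrightarrow>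
      linext (pull_back Q I (seg Q T i (i + a)) (seg Q T (i + b) j) \<Phi>) (F_gen Q I n (seg Q T (i + a) (i + b))) = 0"
  shows "linext \<Phi> (F_gen Q I (n + 1) (seg Q T i j)) =
    linext (pull_back Q I (seg Q T i i1) (triv (vert Q T j)) \<Phi>) (F_gen Q I n (seg Q T i1 j))"
proof -
  define w where "w = seg Q T i j"
  have len: "plen w = j - i" using T by (simp add: w_def plen_seg)
  have seg_w: "seg Q w a b = seg Q T (i + a) (i + b)" if "a \<le> b" "i + b \<le> j" for a b
    using that T by (simp add: w_def seg_seg)
  have Sub: "(a, b) \<in> Sub Q I (Suc n) w \<longleftrightarrow> a \<le> b \<and> i + b \<le> j \<and> seg Q T (i + a) (i + b) \<in> AP Q I n" for a b
    using T by (simp add: w_def Sub_seg_iff)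
  obtain l where l: "n = Suc l" using n by (cases n) auto
  let ?S = "{\<zeta> \<in> Sub Q I (n + 1) w. \<exists>\<zeta>' \<in> Sub Q I (n + 1) w. fst \<zeta>' < fst \<zeta>}"
  let ?f = "\<lambda>(a, b). linext (pull_back Q I (seg Q w 0 a) (seg Q w b (plen w)) \<Phi>) (F_gen Q I n (seg Q w a b))"
  have "linext \<Phi> (F_gen Q I (n + 1) w) = sum ?f ?S"
    using linext_F_gen_Suc[of \<Phi> l w] l by simp
  also have "\<dots> = ?f (i1 - i, j - i)"
  proof (rule sum_eq_single_term)
    show "finite ?S" by simp
    obtain j' where "i \<le> j'" "j' \<le> j" "seg Q T i j' \<in> AP Q I n"
      using AP_prefix[OF T n] w by auto
    then have "(0, j' - i) \<in> Sub Q I (n + 1) w" by (simp add: Sub)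
    moreover have "(i1 - i, j - i) \<in> Sub Q I (n + 1) w"
      using z T by (simp add: Sub)
    ultimately show "(i1 - i, j - i) \<in> ?S"
      using z by (auto intro!: bexI[of _ "(0, j' - i)"])
    fix \<zeta> assume \<zeta>: "\<zeta> \<in> ?S" "\<zeta> \<noteq> (i1 - i, j - i)"
    obtain a b where ab: "\<zeta> = (a, b)" by fastforce
    with \<zeta> have S: "a \<le> b" "i + b \<le> j" "seg Q T (i + a) (i + b) \<in> AP Q I n"
      by (auto simp: Sub)
    have "i + b \<noteq> j"
    proof
      assume j: "i + b = j"
      then have "(i + a, j) \<in> occs Q (AP Q I n) T" "(i1, j) \<in> occs Q (AP Q I n) T"
        using S z T by (auto simp: occs_def)
      then have "i + a = i1" by (rule AP_end_unique[OF T(1) n])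
      with j show False using \<zeta>(2) ab by auto
    qed
    then show "?f \<zeta> = 0"
      using zero[OF S(3,1,2)] S T seg_w[of 0 a] seg_w[of a b] seg_w[of b "j - i"] by (simp add: ab len)
  qed
  also have "\<dots> = linext (pull_back Q I (seg Q T i i1) (triv (vert Q T j)) \<Phi>) (F_gen Q I n (seg Q T i1 j))"
    using seg_w[of 0 "i1 - i"] seg_w[of "i1 - i" "j - i"] seg_w[of "j - i" "j - i"] z T by (simp add: len)
  finally show ?thesis by (simp add: w_def)
qed

lemma pull_back_triv_end:
  assumes T: "T \<in> paths Q" "i \<le> i1" "i1 \<le> j" "j \<le> plen T" and L: "pmon (seg Q T i i1) \<notin> I"
    and hd: "hd xs = triv (vert Q T i1)" and last: "last xs = triv (vert Q T j)"
  shows "pull_back Q I (seg Q T i i1) (triv (vert Q T j)) \<Phi> xs =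
    \<Phi> (triv (vert Q T i) # seg Q T i i1 # butlast (tl xs) @ [triv (vert Q T j)])"
proof -
  have "seg Q T i i1 \<in> Pths Q I"
    using seg_in_paths[OF T(1), of i i1] T L by (simp add: Pths_def)
  then show ?thesis
    using T triv_vert_in_Pths[OF T(1), of j] by (simp add: pull_back_def hd last ptgt_seg)
qed

text \<open>
  Let \<open>\<Phi>\<close> be a linear functional that vanishes on all tensors with some \<open>v\<^sub>2\<^sub>j\<^sub>-\<^sub>1v\<^sub>2\<^sub>j \<notin> I\<close>.  The only summand
  of \<open>F\<close> it sees is the one cut at the starts of the op-concatenation and before the last arrow.
\<close>

lemma F_gen_even:
  assumes T: "T \<in> paths Q"
  shows "op_rchain T (rev qs) \<Longrightarrow> length qs = 2 * k + 1 \<Longrightarrow>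
    (\<And>xs. length xs = 2 * k + 4 \<Longrightarrow> \<not> rel_pairs I (butlast (tl xs)) \<Longrightarrow> \<Phi> xs = 0) \<Longrightarrow>
    linext \<Phi> (F_gen Q I (2 * k + 2) (seg Q T (fst (hd qs)) (snd (last qs)))) =
    \<Phi> (triv (vert Q T (fst (hd qs))) #
        pieces Q T (map fst qs @ [snd (last qs) - 1, snd (last qs)]) @ [triv (vert Q T (snd (last qs)))])"
proof (induction k arbitrary: qs \<Phi>)
  case 0
  then obtain i j where qs: "qs = [(i, j)]" by (cases qs) auto
  then have "(i, j) \<in> R_occs T" using 0(1) by (simp add: greedy_chain_def)
  then show ?case using F_gen_two[OF T, of i j \<Phi>] 0(3) by (simp add: qs numeral_2_eq_2)
next
  case (Suc k)
  then obtain q q1 qs' where qs: "qs = q # q1 # qs'" "length qs' = 2 * k + 1"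
    by (auto simp: length_Suc_conv)
  then have ne: "qs' \<noteq> []" by auto
  define i i1 i2 j where "i = fst q" and "i1 = fst q1" and "i2 = fst (hd qs')" and "j = snd (last qs)"
  note op0 = Suc.prems(1)[unfolded qs(1)]
  note op1 = op_rchain_tl[OF T op0 list.distinct(2)]
  note op2 = op_rchain_tl[OF T op1 ne]
  have i: "i < i1" "i1 < snd q" "q \<in> R_occs T"
    using op_rchain_Cons[OF T op0] by (simp_all add: i_def i1_def)
  have i1: "i1 < i2" "i2 < snd q1" "q1 \<in> R_occs T"
    using op_rchain_Cons[OF T op1 ne] by (simp_all add: i1_def i2_def)
  have last: "snd (last (q # q1 # qs')) = j" "snd (last (q1 # qs')) = j" "snd (last qs') = j"
    using ne by (simp_all add: j_def qs)
  have ends: "i2 + 2 \<le> j" "j \<le> plen T" "seg Q T i2 j \<in> AP Q I (2 * k + 2)"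
    using op_rchain_ends[OF T op2] last qs(2) by (simp_all add: i2_def)
  have AP1: "seg Q T i1 j \<in> AP Q I (2 * k + 3)" and AP0: "seg Q T i j \<in> AP Q I (2 * k + 4)"
    using op_rchain_ends[OF T op1] op_rchain_ends[OF T op0] last qs(2)
    by (simp_all add: i_def i1_def eval_nat_numeral)
  have not0: "pmon (seg Q T i i1) \<notin> I" and not1: "pmon (seg Q T i1 i2) \<notin> I"
    using proper_seg_notin_I[OF T, of i "snd q" i i1] proper_seg_notin_I[OF T, of i1 "snd q1" i1 i2] i i1
    by (auto simp: i_def i1_def prod_eq_iff)
  \<comment> \<open>if the pair cut off lies in \<open>I\<close>, the remaining path ends where the whole path ends\<close>
  have zero: "linext (pull_back Q I (seg Q T l l') R' (pull_back Q I (seg Q T i l) R \<Phi>))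
      (F_gen Q I (2 * k + 2) (seg Q T l' r)) = 0"
    if l: "seg Q T l' r \<in> AP Q I (2 * k + 2)" "i \<le> l" "l \<le> l'" "l' \<le> r" "r \<le> j" "r \<noteq> j" for l l' r R R'
  proof -
    have "(i, j) \<in> occs Q (AP Q I (2 * k + 2 + 2)) T" "(l', r) \<in> occs Q (AP Q I (2 * k + 2)) T"
      using l ends AP0 i i1 by (auto simp: occs_def eval_nat_numeral)
    then have "pmon (seg Q T i l') \<notin> I"
      using AP_end_if_skips_relation[OF T, of "2 * k + 2" i j l' r] l by auto
    then show ?thesis
      using l Suc.prems(3) by (intro linext_pull_back_twice_eq_0) (auto simp: pcat_seg)
  qed
  let ?\<Phi>1 = "pull_back Q I (seg Q T i i1) (triv (vert Q T j)) \<Phi>"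
  let ?\<Phi>2 = "pull_back Q I (seg Q T i1 i2) (triv (vert Q T j)) ?\<Phi>1"
  have "linext \<Phi> (F_gen Q I (2 * k + 3 + 1) (seg Q T i j)) = linext ?\<Phi>1 (F_gen Q I (2 * k + 3) (seg Q T i1 j))"
  proof (rule F_gen_step[OF T])
    fix a b assume ab: "seg Q T (i + a) (i + b) \<in> AP Q I (2 * k + 3)" "a \<le> b" "i + b \<le> j" "i + b \<noteq> j"
    let ?\<Psi> = "pull_back Q I (seg Q T i (i + a)) (seg Q T (i + b) j) \<Phi>"
    define z where "z = seg Q T (i + a) (i + b)"
    have b: "i + b \<le> plen T" using ab ends by simp
    have "linext ?\<Psi> (F_gen Q I (Suc (Suc (2 * k + 1))) z) = 0"
      unfolding linext_F_gen_Suc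
    proof (intro sum.neutral ballI)
      fix \<zeta> assume \<zeta>: "\<zeta> \<in> {\<zeta> \<in> Sub Q I (Suc (Suc (2 * k + 1))) z.
          \<exists>\<zeta>'\<in>Sub Q I (Suc (Suc (2 * k + 1))) z. fst \<zeta>' < fst \<zeta>}"
      obtain c d where cd: "\<zeta> = (c, d)" by fastforce
      with \<zeta> have S: "c \<le> d" "i + a + d \<le> i + b" "seg Q T (i + a + c) (i + a + d) \<in> AP Q I (2 * k + 2)"
        using Sub_seg_iff[of "i + a" "i + b" T c d] ab(2) b by (auto simp: z_def)
      have "seg Q z c d = seg Q T (i + a + c) (i + a + d)" "seg Q z 0 c = seg Q T (i + a) (i + a + c)"
        using S b seg_seg[of "i + b" T c d "i + a" Q] seg_seg[of "i + b" T 0 c "i + a" Q]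
        by (simp_all add: z_def)
      then show "(case \<zeta> of (a, b) \<Rightarrow> linext (pull_back Q I (seg Q z 0 a) (seg Q z b (plen z)) ?\<Psi>)
          (F_gen Q I (Suc (2 * k + 1)) (seg Q z a b))) = 0"
        using zero[of "i + a + c" "i + a + d" "i + a"] S ab by (simp add: cd)
    qed
    then show "linext ?\<Psi> (F_gen Q I (2 * k + 3) (seg Q T (i + a) (i + b))) = 0"
      by (simp add: z_def eval_nat_numeral)
  qed (use i i1 ends AP0 AP1 in \<open>auto simp: add.commute\<close>)
  also have "2 * k + 3 = 2 * k + 2 + 1" by simp
  also have "linext ?\<Phi>1 (F_gen Q I (2 * k + 2 + 1) (seg Q T i1 j)) = linext ?\<Phi>2 (F_gen Q I (2 * k + 2) (seg Q T i2 j))"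
  proof (rule F_gen_step[OF T])
    fix a b assume ab: "seg Q T (i1 + a) (i1 + b) \<in> AP Q I (2 * k + 2)" "a \<le> b" "i1 + b \<le> j" "i1 + b \<noteq> j"
    then show "linext (pull_back Q I (seg Q T i1 (i1 + a)) (seg Q T (i1 + b) j) ?\<Phi>1)
        (F_gen Q I (2 * k + 2) (seg Q T (i1 + a) (i1 + b))) = 0"
      using i by (intro zero) auto
  qed (use i i1 ends AP1 in \<open>auto simp: eval_nat_numeral\<close>)
  also have "\<dots> = ?\<Phi>2 (triv (vert Q T i2) # pieces Q T (map fst qs' @ [j - 1, j]) @ [triv (vert Q T j)])"
  proof -
    have "?\<Phi>2 xs = 0" if "length xs = 2 * k + 4" "\<not> rel_pairs I (butlast (tl xs))" for xs
      using that by (auto simp: pull_back_def intro!: Suc.prems(3))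
    from Suc.IH[OF op2 qs(2), of ?\<Phi>2, OF this] show ?thesis
      unfolding last i2_def[symmetric] .
  qed
  also have "\<dots> = \<Phi> (triv (vert Q T i) # seg Q T i i1 # seg Q T i1 i2 #
      pieces Q T (map fst qs' @ [j - 1, j]) @ [triv (vert Q T j)])"
    using i i1 ends not0 not1 by (simp add: pull_back_triv_end[OF T] butlast_append)
  also have "\<dots> = \<Phi> (triv (vert Q T i) # pieces Q T (map fst qs @ [j - 1, j]) @ [triv (vert Q T j)])"
    using ne by (cases qs') (simp_all add: qs i_def i1_def i2_def)
  finally show ?case by (simp add: i_def j_def qs eval_nat_numeral)
qed

end

section \<open>The cup product\<close>

lemma rel_pairs_iff:
  "rel_pairs I vs \<longleftrightarrow> (\<forall>j. 2 * j + 1 < length vs \<longrightarrow> pmon (pcat (vs ! (2 * j)) (vs ! (2 * j + 1))) \<in> I)"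
proof (induction I vs rule: rel_pairs.induct)
  case (1 I u v vs)
  have "(\<forall>j. P j) \<longleftrightarrow> P 0 \<and> (\<forall>j. P (Suc j))" for P :: "nat \<Rightarrow> bool"
    using nat.nchotomy by metis
  from this[of "\<lambda>j. 2 * j + 1 < length (u # v # vs) \<longrightarrow>
      pmon (pcat ((u # v # vs) ! (2 * j)) ((u # v # vs) ! (2 * j + 1))) \<in> I"] 1 show ?case
    by simp
qed auto

lemma good_iff_rel_pairs:
  assumes "even (length vs)"
  shows "good Q I vs \<longleftrightarrow> rel_pairs I vs"
proof -
  have "M_odd Q I vs = {} \<longleftrightarrow> (\<forall>j. 1 \<le> j \<and> 2 * j \<le> length vs \<longrightarrow>
      pmon (pcat (vs ! (2 * j - 2)) (vs ! (2 * j - 1))) \<in> I)"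
    by (auto simp: M_odd_def)
  also have "\<dots> \<longleftrightarrow> (\<forall>j. 2 * Suc j \<le> length vs \<longrightarrow>
      pmon (pcat (vs ! (2 * Suc j - 2)) (vs ! (2 * Suc j - 1))) \<in> I)"
    by (rule all_positive_iff)
  also have "\<dots> \<longleftrightarrow> rel_pairs I vs"
    by (auto simp: rel_pairs_iff Suc_le_eq)
  finally show ?thesis using assms by (simp add: good_def)
qed

lemma rel_pairs_append:
  "even (length us) \<Longrightarrow> rel_pairs I (us @ vs) \<longleftrightarrow> rel_pairs I us \<and> rel_pairs I vs"
  by (induction I us rule: rel_pairs.induct) auto

lemma pieces_append: "pieces Q T (is @ j # ks) = pieces Q T (is @ [j]) @ pieces Q T (j # ks)"
proof (induction "is")
  case (Cons i "is")
  then show ?case by (cases "is") auto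
qed simp

lemma length_pieces: "length (pieces Q T is) = length is - 1"
  by (induction Q T "is" rule: pieces.induct) auto

lemma pieces_concat:
  "sorted is \<Longrightarrow> 2 \<le> length is \<Longrightarrow> pconcat (pieces Q T is) = seg Q T (hd is) (last is)"
proof (induction Q T "is" rule: pieces.induct)
  case (1 Q T i j "is")
  show ?case
  proof (cases "is")
    case Nil
    then show ?thesis by (simp add: pconcat_def seg_def)
  next
    case (Cons k ks)
    have "pconcat (pieces Q T (i # j # is)) = pcat (seg Q T i j) (pconcat (pieces Q T (j # is)))"
      by (simp add: pconcat_def pcat_def)
    also have "\<dots> = pcat (seg Q T i j) (seg Q T j (last is))"
      using 1 Cons by simp
    also have "\<dots> = seg Q T i (last is)"
      using 1(2) Cons by (intro pcat_seg) auto
    finally show ?thesis using Cons by simp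
  qed
qed auto

lemma psrc_hd_pieces: "2 \<le> length is \<Longrightarrow> psrc (hd (pieces Q T is)) = vert Q T (hd is)"
  by (induction Q T "is" rule: pieces.induct) auto

lemma ptgt_last_pieces: "sorted is \<Longrightarrow> 2 \<le> length is \<Longrightarrow> ptgt Q (last (pieces Q T is)) = vert Q T (last is)"
proof (induction Q T "is" rule: pieces.induct)
  case (1 Q T i j "is")
  then show ?case by (cases "is") (auto simp: ptgt_seg)
qed auto

context monomial_algebra
begin

text \<open>
  An element of \<open>AP\<close> at position \<open>0\<close> is the first one, and no other one starts there.
\<close>

lemma G_gen_even:
  assumes vs: "vs \<noteq> []" "even (length vs)" "rel_pairs I vs" and T: "pconcat vs \<in> paths Q"
    and y: "(0, y) \<in> occs Q (AP Q I (length vs)) (pconcat vs)"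
  shows "G_gen Q I vs = path_tensor Q I (triv (psrc (pconcat vs))) (seg Q (pconcat vs) 0 y)
     (seg Q (pconcat vs) y (plen (pconcat vs)))"
proof -
  have "2 \<le> length vs" using vs(1,2) by (cases vs; cases "tl vs") auto
  obtain i j where ij: "(ARG_MIN fst w. w \<in> chi Q I vs) = (i, j)" by fastforce
  have "(i, j) \<in> chi Q I vs \<and> i \<le> 0"
    using arg_min_nat_lemma[of "\<lambda>w. w \<in> chi Q I vs" "(0, y)" fst] y ij by (auto simp: chi_def)
  then have "i = 0" "j = y"
    using AP_start_unique[OF T \<open>2 \<le> length vs\<close>, of 0 y j] y by (auto simp: chi_def)
  then show ?thesis
    using vs y ij by (auto simp: G_gen_def Let_def good_iff_rel_pairs chi_def)
qed

lemma unit_tensor_in_bardzell: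
  assumes T: "T \<in> paths Q" "i \<le> j" "j \<le> plen T" and AP: "seg Q T i j \<in> AP Q I n"
  shows "unit_tensor Q [seg Q T i j] \<in> bardzell Q I n"
  using triv_vert_in_Pths[OF T(1), of i] triv_vert_in_Pths[OF T(1), of j] T AP
  by (auto simp: unit_tensor_def bardzell_def ptgt_seg simp del: split_paired_Ex)

lemma bimod_map_zero: "bimod_map Q I (bardzell Q I n) f \<Longrightarrow> f 0 = 0"
proof -
  assume "bimod_map Q I (bardzell Q I n) f"
  then have "f (0 + 0) = f 0 + f 0"
    unfolding bimod_map_def bardzell_def by (meson span_on_zero)
  then show ?thesis by simp
qed

lemma cls_in_alg [simp]: "cls Q I p \<in> carrier (alg Q I)"
  by (auto simp: cls_def alg_def)

lemma act_unit_tensor: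
  assumes T: "T \<in> paths Q" "i \<le> j" "j \<le> k" "k \<le> plen T"
  shows "act Q I (cls Q I (triv (vert Q T i))) (unit_tensor Q [seg Q T i j]) (cls Q I (seg Q T j k)) =
    path_tensor Q I (triv (vert Q T i)) (seg Q T i j) (seg Q T j k)"
  using T triv_vert_in_Pths[OF T(1), of i] pcat_triv_left[of "vert Q T j" "seg Q T j k"]
  by (auto simp: act_def cls_def unit_tensor_def act_basis_def path_tensor_def ptgt_seg)

lemma act_path_tensor:
  assumes T: "T \<in> paths Q" "i \<le> j" "j \<le> k" "k \<le> plen T"
  shows "act Q I (cls Q I (triv (vert Q T i))) (path_tensor Q I (triv (vert Q T i)) (seg Q T i j) (seg Q T j k))
      (cls Q I (triv (vert Q T k))) = path_tensor Q I (triv (vert Q T i)) (seg Q T i j) (seg Q T j k)"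
  using T triv_vert_in_Pths[OF T(1), of i] triv_vert_in_Pths[OF T(1), of k]
  by (auto simp: act_def cls_def act_basis_def path_tensor_def ptgt_seg)

text \<open>
  The generator \<open>1 \<otimes> x \<otimes> 1\<close> is fixed by the idempotents at the ends of \<open>x\<close>, and so is its image.
\<close>

lemma eval_unit_tensor_ends:
  assumes T: "T \<in> paths Q" "i \<le> j" "j \<le> plen T" and f: "bimod_map Q I (bardzell Q I n) f"
    and AP: "seg Q T i j \<in> AP Q I n"
  shows eval_unit_tensor_in_alg: "f (unit_tensor Q [seg Q T i j]) \<in> carrier (alg Q I)"
    and eval_unit_tensor_left: "cls Q I (triv (vert Q T i)) \<otimes>\<^bsub>alg Q I\<^esub> f (unit_tensor Q [seg Q T i j]) = f (unit_tensor Q [seg Q T i j])"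
    and eval_unit_tensor_right: "f (unit_tensor Q [seg Q T i j]) \<otimes>\<^bsub>alg Q I\<^esub> cls Q I (triv (vert Q T j)) = f (unit_tensor Q [seg Q T i j])"
proof -
  interpret A: ring "alg Q I" by (rule ring_alg)
  let ?u = "unit_tensor Q [seg Q T i j]" and ?e = "\<lambda>i. cls Q I (triv (vert Q T i))"
  note u = unit_tensor_in_bardzell[OF T AP]
  show fu: "f ?u \<in> carrier (alg Q I)"
    using f u by (simp add: bimod_map_def)
  have "act Q I (?e i) ?u (?e j) = ?u"
    using T triv_vert_in_Pths[OF T(1), of i] triv_vert_in_Pths[OF T(1), of j]
    by (simp add: act_def cls_def unit_tensor_def act_basis_def ptgt_seg)
  then have eue: "f ?u = ?e i \<otimes>\<^bsub>alg Q I\<^esub> f ?u \<otimes>\<^bsub>alg Q I\<^esub> ?e j"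
    using f u unfolding bimod_map_def by (metis cls_in_alg)
  have idem: "?e k \<otimes>\<^bsub>alg Q I\<^esub> ?e k = ?e k" if "k \<le> plen T" for k
    using triv_vert_in_Pths[OF T(1) that] by (simp add: alg_def cls_def pmon_mult path_mult_def nform_def)
  have "?e i \<otimes>\<^bsub>alg Q I\<^esub> f ?u = (?e i \<otimes>\<^bsub>alg Q I\<^esub> ?e i) \<otimes>\<^bsub>alg Q I\<^esub> f ?u \<otimes>\<^bsub>alg Q I\<^esub> ?e j"
    by (subst eue) (simp add: A.m_assoc fu)
  then show "?e i \<otimes>\<^bsub>alg Q I\<^esub> f ?u = f ?u"
    using eue idem T by simp
  have "f ?u \<otimes>\<^bsub>alg Q I\<^esub> ?e j = ?e i \<otimes>\<^bsub>alg Q I\<^esub> f ?u \<otimes>\<^bsub>alg Q I\<^esub> (?e j \<otimes>\<^bsub>alg Q I\<^esub> ?e j)"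
    by (subst eue) (simp add: A.m_assoc fu)
  then show "f ?u \<otimes>\<^bsub>alg Q I\<^esub> ?e j = f ?u"
    using eue idem T by simp
qed

lemma eval_G_map_pieces:
  assumes T: "T \<in> paths Q" and f: "bimod_map Q I (bardzell Q I n) f" and n: "even n" "2 \<le> n"
    and js: "sorted js" "length js = n + 1" "last js \<le> plen T" "rel_pairs I (pieces Q T js)"
    and y: "seg Q T (hd js) y \<in> AP Q I n" "hd js \<le> y" "y \<le> last js"
  shows "f (G_map Q I (unit_tensor Q (pieces Q T js))) =
    f (unit_tensor Q [seg Q T (hd js) y]) \<otimes>\<^bsub>alg Q I\<^esub> cls Q I (seg Q T y (last js))"
proof -
  interpret A: ring "alg Q I" by (rule ring_alg)
  define i k vs where "i = hd js" and "k = last js" and "vs = pieces Q T js"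
  have js2: "2 \<le> length js" using js n by simp
  have ik: "i \<le> k" "k \<le> plen T" using y js by (auto simp: i_def k_def)
  have vs: "length vs = n" "pconcat vs = seg Q T i k" "psrc (hd vs) = vert Q T i"
      "ptgt Q (last vs) = vert Q T k" "rel_pairs I vs"
    using js n js2 by (simp_all add: pieces_concat psrc_hd_pieces ptgt_last_pieces length_pieces vs_def i_def k_def)
  then have vs_ne: "vs \<noteq> []" using n by auto
  have y': "i \<le> y" "y \<le> k" using y by (auto simp: i_def k_def)
  have segs: "seg Q (seg Q T i k) 0 (y - i) = seg Q T i y" "seg Q (seg Q T i k) (y - i) (k - i) = seg Q T y k"
    using y' ik by (simp_all add: seg_seg)
  have "(0, y - i) \<in> occs Q (AP Q I (length vs)) (pconcat vs)"
    using y(1) y' ik(2) unfolding vs occs_def i_def[symmetric] by (simp add: plen_seg segs)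
  then have "G_gen Q I vs = path_tensor Q I (triv (vert Q T i)) (seg Q T i y) (seg Q T y k)"
    using G_gen_even[OF vs_ne _ vs(5), of "y - i"] n seg_in_paths[OF T ik] plen_seg[OF ik(2)]
    by (simp add: vs(1,2) segs)
  then have "G_map Q I (unit_tensor Q vs) = path_tensor Q I (triv (vert Q T i)) (seg Q T i y) (seg Q T y k)"
    using act_path_tensor[OF T y' ik(2)] vs(3,4) vs_ne by (simp add: G_map_def bimod_ext_def unit_tensor_def butlast_append)
  also have "\<dots> = act Q I (cls Q I (triv (vert Q T i))) (unit_tensor Q [seg Q T i y]) (cls Q I (seg Q T y k))"
    by (rule act_unit_tensor[OF T y' ik(2), symmetric])
  also have "f \<dots> = cls Q I (triv (vert Q T i)) \<otimes>\<^bsub>alg Q I\<^esub> f (unit_tensor Q [seg Q T i y]) \<otimes>\<^bsub>alg Q I\<^esub> cls Q I (seg Q T y k)"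
    using f unit_tensor_in_bardzell[OF T y'(1), of n] y y' ik unfolding bimod_map_def i_def by simp
  also have "cls Q I (triv (vert Q T i)) \<otimes>\<^bsub>alg Q I\<^esub> f (unit_tensor Q [seg Q T i y]) = f (unit_tensor Q [seg Q T i y])"
    using eval_unit_tensor_left[OF T y'(1) _ f] y y' ik by (simp add: i_def)
  finally show ?thesis by (simp add: vs_def i_def k_def)
qed

text \<open>
  This and the next lemma express the supports in terms of \<open>w\<close> alone, away from the path on which the
  concatenation is given.
\<close>

lemma supp_take:
  assumes T: "T \<in> paths Q" and ps: "rchain T ps" "0 < k" "k \<le> length ps"
  obtains y where "supp Q T (take k ps) = seg Q (supp Q T ps) 0 y" "y \<le> plen (supp Q T ps)"
    "supp Q T (take k ps) \<in> AP Q I (k + 1)"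
proof -
  interpret interval_antichain "R_occs T" st en by (rule R_antichain[OF T])
  have take: "rchain T (take k ps)" using chain_take[OF ps(1)] ps(2) by simp
  have ne: "ps \<noteq> []" using ps by auto
  have "last (take k ps) = ps ! (k - 1)" "last ps = ps ! (length ps - 1)" "hd (take k ps) = hd ps"
    using ps ne by (simp_all add: last_conv_nth)
  moreover have "en (ps ! (k - 1)) \<le> en (ps ! (length ps - 1))"
    using chain_mono_end[OF ps(1), of "k - 1" "length ps - 1"] ps by simp
  ultimately have "snd (last (take k ps)) \<le> snd (last ps)" "hd (take k ps) = hd ps" by simp_all
  then show ?thesis
    using that[of "snd (last (take k ps)) - fst (hd ps)"] rchain_ends[OF T ps(1)] rchain_ends[OF T take] ps(3)
    by (simp add: supp_def seg_seg plen_seg)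
qed

lemma supp_drop:
  assumes T: "T \<in> paths Q" and qs: "op_rchain T (rev qs)" "k < length qs"
  obtains c where "supp Q T (drop k qs) = seg Q (supp Q T qs) c (plen (supp Q T qs))"
    "c \<le> plen (supp Q T qs)" "supp Q T (drop k qs) \<in> AP Q I (length qs - k + 1)"
proof -
  interpret op: interval_antichain "R_occs T" "\<lambda>p. - en p" "\<lambda>p. - st p"
    by (rule interval_antichain.dual[OF R_antichain[OF T]])
  note drop = op_rchain_drop[OF T qs]
  have ne: "qs \<noteq> []" using qs by auto
  have "hd (drop k qs) = qs ! k" "hd qs = qs ! 0"
    using hd_drop_conv_nth[OF qs(2)] hd_conv_nth[OF ne] by simp_all
  moreover have "rev qs ! (length qs - 1 - k) = qs ! k" "rev qs ! (length qs - 1) = qs ! 0"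
    using rev_nth[of "length qs - 1 - k" qs] rev_nth[of "length qs - 1" qs] qs(2) by simp_all
  moreover have "- st (rev qs ! (length qs - 1 - k)) \<le> - st (rev qs ! (length qs - 1))"
    using op.chain_mono_end[OF qs(1), of "length qs - 1 - k" "length qs - 1"] qs(2) by simp
  ultimately have le: "fst (hd qs) \<le> fst (hd (drop k qs))" by simp
  have last: "last (drop k qs) = last qs" using qs(2) by simp
  note ends = op_rchain_ends[OF T qs(1)] and ends' = op_rchain_ends[OF T drop, unfolded last length_drop]
  have "seg Q (seg Q T (fst (hd qs)) (snd (last qs))) (fst (hd (drop k qs)) - fst (hd qs))
      (snd (last qs) - fst (hd qs)) = seg Q T (fst (hd (drop k qs))) (snd (last qs))"
    using seg_seg[OF ends(2), of "fst (hd (drop k qs)) - fst (hd qs)" "snd (last qs) - fst (hd qs)" "fst (hd qs)" Q]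
      ends(1) ends'(1) le by simp
  then show ?thesis
    using that[of "fst (hd (drop k qs)) - fst (hd qs)"] ends(1) ends' le
    unfolding supp_def last plen_seg[OF ends(2)] by simp
qed

lemma op_rchain_cuts:
  assumes T: "T \<in> paths Q"
  shows "op_rchain T (rev qs) \<Longrightarrow> sorted (map fst qs @ [snd (last qs) - 1, snd (last qs)])"
proof (induction qs)
  case (Cons q qs)
  show ?case
  proof (cases "qs = []")
    case True
    then show ?thesis
      using op_rchain_ends[OF T Cons.prems] by simp
  next
    case False
    then obtain q' qs' where qs: "qs = q' # qs'" by (cases qs) auto
    have "sorted (map fst qs @ [snd (last qs) - 1, snd (last qs)])" "fst q \<le> fst q'"
      using Cons.IH[OF op_rchain_tl[OF T Cons.prems False]] op_rchain_Cons(2)[OF T Cons.prems False]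
      by (simp_all add: qs)
    then show ?thesis
      unfolding qs by (simp only: list.map append_Cons sorted2 last.simps list.distinct if_False simp_thms)
  qed
qed (simp add: greedy_chain_def)

text \<open>
  Between the starts of \<open>q\<^sup>j\<close> and \<open>q\<^sup>j\<^sup>+\<^sup>2\<close> lies all of \<open>q\<^sup>j\<close>.  The last pair of pieces is the last relation
  itself.
\<close>

lemma op_rchain_rel_pairs:
  assumes T: "T \<in> paths Q"
  shows "op_rchain T (rev qs) \<Longrightarrow> odd (length qs) \<Longrightarrow>
    rel_pairs I (pieces Q T (map fst qs @ [snd (last qs) - 1, snd (last qs)]))"
proof (induction "length qs" arbitrary: qs rule: less_induct)
  case less
  interpret op: interval_antichain "R_occs T" "\<lambda>p. - en p" "\<lambda>p. - st p"
    by (rule interval_antichain.dual[OF R_antichain[OF T(1)]])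
  consider q where "qs = [q]" | q q1 q2 qs' where "qs = q # q1 # q2 # qs'"
    using less.prems(2) by (cases qs; cases "tl qs"; cases "tl (tl qs)") auto
  then show ?case
  proof cases
    case 1
    then have "(fst q, snd q) \<in> R_occs T" using less.prems(1) by (simp add: greedy_chain_def)
    from R_occs_D[OF this] show ?thesis by (simp add: 1 pcat_seg)
  next
    case 2
    let ?j = "snd (last qs)"
    note op0 = less.prems(1)[unfolded 2]
    note op1 = op_rchain_tl[OF T op0 list.distinct(2)]
    note op2 = op_rchain_tl[OF T op1 list.distinct(2)]
    have q: "q \<in> R_occs T" "fst q < fst q1" "fst q1 < fst q2"
      using op_rchain_Cons[OF T op0] op_rchain_Cons[OF T op1] by simp_all
    have q2: "snd q \<le> fst q2" "fst q2 \<le> plen T"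
    proof -
      have "Suc (Suc (length qs')) < length (rev qs)" by (simp add: 2)
      from op.chain_skip[OF less.prems(1) this] show "snd q \<le> fst q2"
        by (simp add: 2 nth_append rev_nth)
      have "q2 \<in> R_occs T" using op.chain_in[OF op2, of "length qs'"] by (simp add: nth_append)
      then show "fst q2 \<le> plen T" using R_occs_D[of "fst q2" "snd q2" T] by simp
    qed
    have "(fst q, snd q) \<in> R_occs T" using q by simp
    then have "pmon (seg Q T (fst q) (fst q2)) \<in> I"
      using seg_in_I_iff[OF T, of "fst q" "fst q2"] q q2 by fastforce
    moreover have "rel_pairs I (pieces Q T (map fst (q2 # qs') @ [?j - 1, ?j]))"
      using less.hyps[of "q2 # qs'"] op2 less.prems(2) by (simp add: 2)
    ultimately show ?thesis
      using q by (simp add: 2 pcat_seg)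
  qed
qed

text \<open>
  As \<open>f\<close> has even degree, no pair \<open>v\<^sub>2\<^sub>j\<^sub>-\<^sub>1v\<^sub>2\<^sub>j\<close> is torn apart between the arguments of \<open>f\<close> and \<open>g\<close>.
\<close>

lemma bar_cup_kills:
  assumes f: "bimod_map Q I (bardzell Q I (2 * n)) f" and g: "bimod_map Q I (bardzell Q I (2 * m)) g"
    and vs: "length vs = 2 * n + 2 * m" "\<not> rel_pairs I vs" "1 \<le> n" "1 \<le> m"
  shows "f (G_map Q I (unit_tensor Q (take (2 * n) vs))) \<otimes>\<^bsub>alg Q I\<^esub>
    g (G_map Q I (unit_tensor Q (drop (2 * n) vs))) = 0"
proof -
  have bad: "G_map Q I (unit_tensor Q us) = 0" if "us \<noteq> []" "even (length us)" "\<not> rel_pairs I us" for us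
  proof -
    have "2 \<le> length us" using that(1,2) by (cases us; cases "tl us") auto
    then have "G_gen Q I us = 0"
      using that by (simp add: G_gen_def good_iff_rel_pairs)
    then show ?thesis
      using that(1) by (simp add: G_map_def bimod_ext_def unit_tensor_def act_def butlast_append)
  qed
  have "\<not> rel_pairs I (take (2 * n) vs) \<or> \<not> rel_pairs I (drop (2 * n) vs)"
    using rel_pairs_append[of "take (2 * n) vs" I "drop (2 * n) vs"] vs(1,2) by auto
  then have "G_map Q I (unit_tensor Q (take (2 * n) vs)) = 0 \<or> G_map Q I (unit_tensor Q (drop (2 * n) vs)) = 0"
    using bad[of "take (2 * n) vs"] bad[of "drop (2 * n) vs"] vs by fastforce
  moreover have "0 \<otimes>\<^bsub>alg Q I\<^esub> x = 0" "x \<otimes>\<^bsub>alg Q I\<^esub> 0 = 0" for x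
    by (simp_all add: alg_def path_alg_mult nform_def)
  ultimately show ?thesis
    using bimod_map_zero[OF f] bimod_map_zero[OF g] by metis
qed

text \<open>
  The surviving summand of \<open>F\<close> is cut at the start of \<open>q\<^sup>2\<^sup>n\<^sup>+\<^sup>1\<close>, which is \<open>qs ! (2 * n)\<close>, into the arguments of
  \<open>f\<close> and \<open>g\<close>.
\<close>

lemma cup_unit_tensor:
  assumes nm: "1 \<le> n" "1 \<le> m"
    and f: "bimod_map Q I (bardzell Q I (2 * n)) f" and g: "bimod_map Q I (bardzell Q I (2 * m)) g"
    and w: "w \<in> paths Q" and qs: "op_rchain w (rev qs)" "length qs = 2 * n + 2 * m - 1"
      "fst (hd qs) = 0" "snd (last qs) = plen w"
    and u: "seg Q w 0 y \<in> AP Q I (2 * n)" "y \<le> fst (qs ! (2 * n))"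
  shows "cup Q I (2 * n) (2 * m) f g (unit_tensor Q [w]) =
    f (unit_tensor Q [seg Q w 0 y]) \<otimes>\<^bsub>alg Q I\<^esub> cls Q I (seg Q w y (fst (qs ! (2 * n)))) \<otimes>\<^bsub>alg Q I\<^esub>
    g (unit_tensor Q [seg Q w (fst (qs ! (2 * n))) (plen w)])"
proof -
  interpret A: ring "alg Q I" by (rule ring_alg)
  define l c where "l = plen w" and "c = fst (qs ! (2 * n))"
  define k where "k = n + m - 1"
  have k: "2 * n + 2 * m = 2 * k + 2" "length qs = 2 * k + 1" using nm qs by (auto simp: k_def)
  let ?e = "\<lambda>i. triv (vert Q w i)"
  have ends: "?e 0 = triv (psrc w)" "?e l = triv (ptgt Q w)" by (simp_all add: l_def)
  have trivs: "?e 0 \<in> Pths Q I" "?e l \<in> Pths Q I"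
    using triv_vert_in_Pths[OF w, of 0] triv_vert_in_Pths[OF w, of l] by (simp_all only: l_def zero_le order_refl)
  define B where "B vs = f (G_map Q I (unit_tensor Q (take (2 * n) vs))) \<otimes>\<^bsub>alg Q I\<^esub>
    g (G_map Q I (unit_tensor Q (drop (2 * n) vs)))" for vs
  define \<Phi>0 where "\<Phi>0 xs = cls Q I (hd xs) \<otimes>\<^bsub>alg Q I\<^esub> B (butlast (tl xs)) \<otimes>\<^bsub>alg Q I\<^esub> cls Q I (last xs)" for xs
  define \<Phi> where "\<Phi> xs = linext \<Phi>0 (act_basis Q I (?e 0) xs (?e l))" for xs
  define vs where "vs = pieces Q w (map fst qs @ [l - 1, l])"
  have cup: "cup Q I (2 * n) (2 * m) f g (unit_tensor Q [w]) = linext \<Phi> (F_gen Q I (2 * k + 2) w)"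
  proof -
    have "F_map Q I (2 * n + 2 * m) (unit_tensor Q [w]) =
        act Q I (cls Q I (?e 0)) (F_gen Q I (2 * k + 2) w) (cls Q I (?e l))"
      unfolding ends k(1) by (simp add: F_map_def bimod_ext_def unit_tensor_def)
    moreover have "bar_cup Q I (2 * n) (f \<circ> G_map Q I) (g \<circ> G_map Q I) = linext \<Phi>0"
      by (simp add: bar_cup_def \<Phi>0_def[abs_def] B_def Let_def fun_eq_iff)
    ultimately show ?thesis
      using trivs by (simp only: cup_def o_apply linext_act_basis \<Phi>_def[abs_def] simp_thms if_True)
  qed
  have "linext \<Phi> (F_gen Q I (2 * k + 2) (seg Q w (fst (hd qs)) (snd (last qs)))) =
    \<Phi> (?e 0 # vs @ [?e l])"
  proof -
    have "\<Phi> xs = 0" if xs: "length xs = 2 * k + 4" "\<not> rel_pairs I (butlast (tl xs))" for xs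
    proof -
      have "B (butlast (tl xs)) = 0"
        unfolding B_def by (rule bar_cup_kills[OF f g _ xs(2) nm]) (simp add: xs k)
      moreover have "x \<otimes>\<^bsub>alg Q I\<^esub> 0 = 0" "0 \<otimes>\<^bsub>alg Q I\<^esub> x = 0" for x
        by (simp_all add: alg_def path_alg_mult nform_def)
      ultimately show ?thesis
        by (simp add: \<Phi>_def act_basis_def \<Phi>0_def butlast_append)
    qed
    from F_gen_even[OF w qs(1) k(2), of \<Phi>, OF this] show ?thesis
      unfolding qs(3,4) vs_def l_def .
  qed
  also have "\<Phi> (?e 0 # vs @ [?e l]) = cls Q I (?e 0) \<otimes>\<^bsub>alg Q I\<^esub> B vs \<otimes>\<^bsub>alg Q I\<^esub> cls Q I (?e l)"
    using trivs by (simp add: \<Phi>_def act_basis_def \<Phi>0_def butlast_append)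
  finally have cup_B: "cup Q I (2 * n) (2 * m) f g (unit_tensor Q [w]) =
      cls Q I (?e 0) \<otimes>\<^bsub>alg Q I\<^esub> B vs \<otimes>\<^bsub>alg Q I\<^esub> cls Q I (?e l)"
    unfolding cup by (simp add: qs)
  let ?js1 = "map fst (take (2 * n) qs) @ [c]" and ?js2 = "c # map fst (drop (2 * n + 1) qs) @ [l - 1, l]"
  have n2: "2 * n < length qs" using nm qs(2) by simp
  have "map fst qs = map fst (take (2 * n) qs) @ c # map fst (drop (2 * n + 1) qs)"
    using arg_cong[OF id_take_nth_drop[OF n2], of "map fst"] by (simp only: map_append list.map c_def Suc_eq_plus1)
  then have split: "map fst qs @ [l - 1, l] = map fst (take (2 * n) qs) @ ?js2" by (simp only: append.assoc append.simps)
  have vs: "vs = pieces Q w ?js1 @ pieces Q w ?js2"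
    unfolding vs_def split by (rule pieces_append)
  have len1: "length (pieces Q w ?js1) = 2 * n" using n2 by (simp add: length_pieces)
  have rel: "rel_pairs I (pieces Q w ?js1)" "rel_pairs I (pieces Q w ?js2)"
    using op_rchain_rel_pairs[OF w qs(1)] k(2) rel_pairs_append[of "pieces Q w ?js1" I "pieces Q w ?js2"] len1
    unfolding qs(4) l_def[symmetric] vs_def[symmetric] vs by auto
  have sorted: "sorted ?js1" "sorted ?js2"
    using op_rchain_cuts[OF w qs(1)] unfolding qs(4) l_def[symmetric] split by (auto simp: sorted_append)
  have c: "y \<le> c" "c \<le> l" using u sorted(2) by (auto simp: c_def)
  have hd1: "hd ?js1 = 0" using qs(3) n2 nm by (cases qs; cases n) auto
  have AP2: "seg Q w c l \<in> AP Q I (2 * m)"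
    using op_rchain_ends(3)[OF w op_rchain_drop[OF w qs(1) n2]] qs n2 nm by (simp add: hd_drop_conv_nth c_def l_def)
  have B: "B vs = f (unit_tensor Q [seg Q w 0 y]) \<otimes>\<^bsub>alg Q I\<^esub> cls Q I (seg Q w y c) \<otimes>\<^bsub>alg Q I\<^esub>
      (g (unit_tensor Q [seg Q w c l]) \<otimes>\<^bsub>alg Q I\<^esub> cls Q I (?e l))"
  proof -
    have "f (G_map Q I (unit_tensor Q (pieces Q w ?js1))) =
        f (unit_tensor Q [seg Q w 0 y]) \<otimes>\<^bsub>alg Q I\<^esub> cls Q I (seg Q w y c)"
      using eval_G_map_pieces[OF w f _ _ sorted(1) _ _ rel(1), of y] u c nm n2 unfolding hd1 by (simp add: l_def)
    moreover have "g (G_map Q I (unit_tensor Q (pieces Q w ?js2))) =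
        g (unit_tensor Q [seg Q w c l]) \<otimes>\<^bsub>alg Q I\<^esub> cls Q I (?e l)"
      using eval_G_map_pieces[OF w g _ _ sorted(2) _ _ rel(2), of l] AP2 c nm qs(2) by (simp add: l_def)
    ultimately show ?thesis by (simp add: B_def vs len1)
  qed
  have fg: "f (unit_tensor Q [seg Q w 0 y]) \<in> carrier (alg Q I)"
      "cls Q I (?e 0) \<otimes>\<^bsub>alg Q I\<^esub> f (unit_tensor Q [seg Q w 0 y]) = f (unit_tensor Q [seg Q w 0 y])"
      "g (unit_tensor Q [seg Q w c l]) \<in> carrier (alg Q I)"
      "g (unit_tensor Q [seg Q w c l]) \<otimes>\<^bsub>alg Q I\<^esub> cls Q I (?e l) = g (unit_tensor Q [seg Q w c l])"
    using eval_unit_tensor_ends[OF w _ _ f u(1)] eval_unit_tensor_ends[OF w _ _ g AP2] c by (simp_all add: l_def)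
  have "cls Q I (?e 0) \<otimes>\<^bsub>alg Q I\<^esub> B vs \<otimes>\<^bsub>alg Q I\<^esub> cls Q I (?e l) =
     (cls Q I (?e 0) \<otimes>\<^bsub>alg Q I\<^esub> f (unit_tensor Q [seg Q w 0 y])) \<otimes>\<^bsub>alg Q I\<^esub> cls Q I (seg Q w y c) \<otimes>\<^bsub>alg Q I\<^esub>
      (g (unit_tensor Q [seg Q w c l]) \<otimes>\<^bsub>alg Q I\<^esub> cls Q I (?e l))"
    unfolding B fg(4) using fg(1,3) cls_in_alg by (simp only: A.m_assoc A.m_closed fg(4))
  then show ?thesis
    unfolding cup_B fg(2,4) by (simp add: c_def l_def)
qed

text \<open>
  Positions on \<open>w\<close> itself: the prefix \<open>w(p\<^sub>1, \<dots>, p\<^sub>2\<^sub>n\<^sub>-\<^sub>1)\<close> ends no later than \<open>q\<^sup>2\<^sup>n\<^sup>+\<^sup>1\<close> starts, by the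
  interlacing of the two concatenations.
\<close>

lemma concatenation_split:
  assumes w: "w \<in> paths Q" and nm: "1 \<le> n" "1 \<le> m" and AP: "w \<in> AP Q I (2 * n + 2 * m)"
  obtains y qs where "op_rchain w (rev qs)" "length qs = 2 * n + 2 * m - 1"
      "fst (hd qs) = 0" "snd (last qs) = plen w" "seg Q w 0 y \<in> AP Q I (2 * n)" "y \<le> fst (qs ! (2 * n))"
proof -
  interpret interval_antichain "R_occs w" st en by (rule R_antichain[OF w])
  obtain ps where ps: "length ps = 2 * n + 2 * m - 1" "rchain w ps" "fst (hd ps) = 0" "snd (last ps) = plen w"
    using AP_seg_iff[OF w, of 0 "plen w" "2 * n + 2 * m"] AP nm by auto
  obtain rs where rs: "length rs = length ps" "op_rchain w rs" "hd rs = last ps" "last rs = hd ps"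
    and le: "\<And>i. i < length ps \<Longrightarrow> st (ps ! i) \<le> st (rev rs ! i)"
    using op_chain[OF ps(2)] by blast
  have ne: "rs \<noteq> []" "ps \<noteq> []" using rs(2) ps(2) by (auto simp: greedy_chain_def)
  let ?ps = "take (2 * n - 1) ps" and ?y = "snd (ps ! (2 * n - 2))"
  have ps': "rchain w ?ps" "length ?ps + 1 = 2 * n" "hd ?ps = hd ps" "last ?ps = ps ! (2 * n - 2)"
    using chain_take[OF ps(2), of "2 * n - 1"] ps(1) nm ne by (simp_all add: last_conv_nth numeral_2_eq_2)
  have n2: "Suc (Suc (2 * n - 2)) < length ps" "Suc (Suc (2 * n - 2)) = 2 * n" using ps(1) nm by simp_all
  have "en (ps ! (2 * n - 2)) \<le> st (rev rs ! (2 * n))"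
    using chain_skip[OF ps(2) n2(1)] le[of "2 * n"] n2 by simp
  then have y: "?y \<le> fst (rev rs ! (2 * n))" by simp
  have "seg Q w 0 ?y \<in> AP Q I (2 * n)"
    using rchain_ends(3)[OF w ps'(1)] ps'(2-4) ps(3) nm by simp
  then show ?thesis
    using that[of "rev rs" ?y] rs ps ne y by (simp add: hd_rev last_rev)
qed

end

theorem theorem6p4:
  fixes Q :: "('v, 'a) pre_digraph"
    and I :: "(('v, 'a) qpath \<Rightarrow>\<^sub>0 'k::field) set"
    and f g :: "('v, 'a, 'k) tensors \<Rightarrow> (('v, 'a) qpath \<Rightarrow>\<^sub>0 'k)"
    and n m :: nat
    and w T T' :: "('v, 'a) qpath"
    and ps qs :: "occ list"
  assumes "monomial_algebra Q I"
    and "1 \<le> n" and "1 \<le> m"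
    and "cocycle Q I (2 * n) f" and "cocycle Q I (2 * m) g"
    and "w \<in> AP Q I (2 * n + 2 * m)"
    and "T \<in> paths Q" and "concatenation Q I T (2 * n + 2 * m) ps" and "w = supp Q T ps"
    and "T' \<in> paths Q" and "op_concatenation Q I T' (2 * n + 2 * m) qs" and "w = supp Q T' qs"
  shows "let u = supp Q T (take (2 * n - 1) ps);
             v = supp Q T' (drop (2 * n) qs)
         in \<exists>a \<in> paths Q.
              composable Q u a \<and> composable Q a v \<and> w = pconcat [u, a, v] \<and>
              cup Q I (2 * n) (2 * m) f g (unit_tensor Q [w]) =
                f (unit_tensor Q [u]) \<otimes>\<^bsub>alg Q I\<^esub> cls Q I a \<otimes>\<^bsub>alg Q I\<^esub> g (unit_tensor Q [v])"
proof -
  interpret monomial_algebra Q I by fact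
  note nm = \<open>1 \<le> n\<close> \<open>1 \<le> m\<close> and T = \<open>T \<in> paths Q\<close> and T' = \<open>T' \<in> paths Q\<close>
  have f: "bimod_map Q I (bardzell Q I (2 * n)) f" and g: "bimod_map Q I (bardzell Q I (2 * m)) g"
    using assms(4,5) by (simp_all add: cocycle_def)
  interpret T: interval_antichain "R_occs T" st en by (rule R_antichain[OF T])
  interpret T': interval_antichain "R_occs T'" "\<lambda>p. - en p" "\<lambda>p. - st p"
    by (rule interval_antichain.dual[OF R_antichain[OF T']])
  have ps: "rchain T ps" "length ps = 2 * n + 2 * m - 1" and qs: "op_rchain T' (rev qs)" "length qs = 2 * n + 2 * m - 1"
    using assms by (simp_all add: concatenation_iff op_concatenation_iff)
  note w_T = \<open>w = supp Q T ps\<close> and w_T' = \<open>w = supp Q T' qs\<close>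
  have w: "w \<in> paths Q"
    using rchain_ends[OF T ps(1)] seg_in_paths[OF T] by (simp add: w_T supp_def)
  define l where "l = plen w"
  obtain y ks where ks: "op_rchain w (rev ks)" "length ks = 2 * n + 2 * m - 1"
      "fst (hd ks) = 0" "snd (last ks) = plen w" "seg Q w 0 y \<in> AP Q I (2 * n)" "y \<le> fst (ks ! (2 * n))"
    using concatenation_split[OF w nm assms(6)] .
  define c where "c = fst (ks ! (2 * n))"
  have n2: "2 * n < length ks" using ks(2) nm by simp
  have c: "c \<le> l" "seg Q w c l \<in> AP Q I (2 * m)"
    using op_rchain_ends[OF w op_rchain_drop[OF w ks(1) n2]] ks n2 nm
    by (simp_all add: c_def l_def hd_drop_conv_nth)
  have y: "y \<le> c" using ks(6) by (simp add: c_def)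
  have len: "0 < 2 * n - 1" "2 * n - 1 \<le> length ps" "2 * n - 1 + 1 = 2 * n"
      "2 * n < length qs" "length qs - 2 * n + 1 = 2 * m"
    using ps(2) qs(2) nm by simp_all
  obtain y' where y': "supp Q T (take (2 * n - 1) ps) = seg Q w 0 y'" "y' \<le> l"
      "supp Q T (take (2 * n - 1) ps) \<in> AP Q I (2 * n)"
    using supp_take[OF T ps(1) len(1,2)] unfolding len w_T[symmetric] l_def by blast
  \<comment> \<open>concatenations on different paths give the same prefix and the same suffix of \<open>w\<close>\<close>
  have "y' = y"
    using AP_start_unique[OF w, of "2 * n" 0 y' y] y' ks(5) y c nm by (simp add: occs_def l_def)
  then have u: "supp Q T (take (2 * n - 1) ps) = seg Q w 0 y" using y' by simp
  obtain c' where c': "supp Q T' (drop (2 * n) qs) = seg Q w c' l" "c' \<le> l"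
      "supp Q T' (drop (2 * n) qs) \<in> AP Q I (2 * m)"
    using supp_drop[OF T' qs(1) len(4)] unfolding len w_T'[symmetric] l_def by blast
  have "c' = c"
    using AP_end_unique[OF w, of "2 * m" c' l c] c' c nm by (simp add: occs_def l_def)
  then have v: "supp Q T' (drop (2 * n) qs) = seg Q w c l" using c' by simp
  have "pconcat [seg Q w 0 y, seg Q w y c, seg Q w c l] = pcat (seg Q w 0 y) (pcat (seg Q w y c) (seg Q w c l))"
    by (simp add: pconcat_def pcat_def)
  also have "\<dots> = seg Q w 0 l"
    using y c(1) by (simp only: pcat_seg le_trans[OF y c(1)] zero_le)
  also have "\<dots> = w" unfolding l_def by (rule seg_whole)
  finally have w_eq: "w = pconcat [seg Q w 0 y, seg Q w y c, seg Q w c l]" by (rule sym)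
  have a: "seg Q w y c \<in> paths Q"
    using seg_in_paths[OF w y] c(1) by (simp only: l_def)
  show ?thesis
    unfolding Let_def u v
  proof (intro bexI[OF _ a] conjI)
    show "composable Q (seg Q w 0 y) (seg Q w y c)" "composable Q (seg Q w y c) (seg Q w c l)"
      using y by (simp_all only: composable_seg zero_le)
    show "w = pconcat [seg Q w 0 y, seg Q w y c, seg Q w c l]" by (rule w_eq)
    show "cup Q I (2 * n) (2 * m) f g (unit_tensor Q [w]) =
        f (unit_tensor Q [seg Q w 0 y]) \<otimes>\<^bsub>alg Q I\<^esub> cls Q I (seg Q w y c) \<otimes>\<^bsub>alg Q I\<^esub>
        g (unit_tensor Q [seg Q w c l])"
      using cup_unit_tensor[OF nm f g w ks] unfolding c_def l_def .
  qed
qed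

end
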